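(* Let $n\ge 1$, $0<p,q<\infty$, and let $g\in H(\mathbb{B}_n)$ be such that $T_g:H^p\to H^q$ is bounded. Then $H^p\subsetneq[g:H^q]$ (proper inclusion of sets of holomorphic functions on $\mathbb{B}_n$).
   Context: $\mathbb{B}_n=\{z\in\mathbb{C}^n:|z|<1\}$ is the open unit ball, $\mathbb{S}_n=\partial\mathbb{B}_n$ the unit sphere, $d\sigma$ the normalized surface measure on $\mathbb{S}_n$, and $H(\mathbb{B}_n)$ the space of holomorphic functions on $\mathbb{B}_n$. The radial derivative is $Rf(z)=\sum_{k=1}^n z_k\partial_{z_k}f(z)$. For $0<p<\infty$, the Hardy space $H^p$ consists of $f\in H(\mathbb{B}_n)$ with $\|f\|_{H^p}=\sup_{0\le s<1}\left(\int_{\mathbb{S}_n}|f(s\zeta)|^p\,d\sigma(\zeta)\right)^{1/p}<\infty$. For $g\in H(\mathbb{B}_n)$ the Volterra integration operator on $H(\mathbb{B}_n)$ is $T_gf(z)=\int_0^1 f(tz)\,Rg(tz)\,\frac{dt}{t}$. The optimal domain is $[g:H^q]=\{f\in H(\mathbb{B}_n): T_gf\in H^q\}$. *)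

theory Defs
  imports "HOL-Analysis.Analysis"
begin

text \<open>
  Points of $\mathbb{C}^n$ are vectors of type \<^typ>\<open>complex ^ 'n\<close> with \<open>n = CARD('n)\<close>; the norm on this
  type is the Euclidean one, so the unit ball and the unit sphere are \<^term>\<open>ball 0 1\<close> and
  \<^term>\<open>sphere 0 1\<close>. Functions on the ball are total functions of which only the values
  on the ball are ever used.
\<close>

text \<open>Complex Frechet differentiability at every point; intended for open \<open>S\<close>.\<close>

definition holomorphic_sev :: "(complex ^ 'n \<Rightarrow> complex) \<Rightarrow> (complex ^ 'n) set \<Rightarrow> bool" where
  "holomorphic_sev f S \<longleftrightarrow>
     (\<forall>z\<in>S. \<exists>D. (f has_derivative D) (at z) \<and> (\<forall>c v. D (c *s v) = c * D v))"

definition holo_ball :: "(complex ^ 'n \<Rightarrow> complex) set" where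
  "holo_ball = {f. holomorphic_sev f (ball 0 1)}"

definition partial_deriv :: "'n \<Rightarrow> (complex ^ 'n \<Rightarrow> complex) \<Rightarrow> complex ^ 'n \<Rightarrow> complex" where
  "partial_deriv k f z = deriv (\<lambda>w. f (\<chi> j. if j = k then w else z $ j)) (z $ k)"

definition radial_deriv :: "(complex ^ 'n \<Rightarrow> complex) \<Rightarrow> complex ^ 'n \<Rightarrow> complex" where
  "radial_deriv f z = (\<Sum>k\<in>UNIV. z $ k * partial_deriv k f z)"

text \<open>
  Normalized surface measure on the unit sphere, obtained from polar coordinates: the measure of a
  Borel set \<open>A\<close> of the sphere is the proportion of the volume of the unit ball taken up by
  the cone $\{t\zeta : 0 < t < 1,\ \zeta \in A\}$. Here \<open>sgn z = z /\<^sub>R norm z\<close>.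
  The restriction to the sphere makes values of integrands elsewhere irrelevant, also for
  measurability.
\<close>

definition sphere_measure :: "(complex ^ 'n) measure" where
  "sphere_measure =
     restrict_space (distr (uniform_measure lborel (ball 0 1)) borel sgn) (sphere 0 1)"

text \<open>
  The supremum is taken in the extended nonnegative reals. For holomorphic \<open>f\<close> and
  \<open>s < 1\<close> the integrand is continuous on the sphere, hence integrable.
\<close>

definition hardy_norm :: "real \<Rightarrow> (complex ^ 'n \<Rightarrow> complex) \<Rightarrow> ennreal" where
  "hardy_norm p f =
     (SUP s\<in>{0..<1}. ennreal ((LINT \<zeta>|sphere_measure. norm (f (s *\<^sub>R \<zeta>)) powr p) powr (1 / p)))"

definition hardy_space :: "real \<Rightarrow> (complex ^ 'n \<Rightarrow> complex) set" where
  "hardy_space p = {f \<in> holo_ball. hardy_norm p f < \<infinity>}"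

definition volterra ::
  "(complex ^ 'n \<Rightarrow> complex) \<Rightarrow> (complex ^ 'n \<Rightarrow> complex) \<Rightarrow> complex ^ 'n \<Rightarrow> complex" where
  "volterra g f z =
     integral {0..1} (\<lambda>t::real. f (t *\<^sub>R z) * radial_deriv g (t *\<^sub>R z) / complex_of_real t)"

text \<open>Boundedness for the (quasi-)norms; for exponents below 1 these are not norms.\<close>

definition bounded_hardy_operator ::
  "real \<Rightarrow> real \<Rightarrow> ((complex ^ 'n \<Rightarrow> complex) \<Rightarrow> complex ^ 'n \<Rightarrow> complex) \<Rightarrow> bool" where
  "bounded_hardy_operator p q T \<longleftrightarrow>
     (\<exists>C\<ge>0. \<forall>f\<in>hardy_space p. T f \<in> hardy_space q \<and> hardy_norm q (T f) \<le> ennreal C * hardy_norm p f)"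

definition optimal_domain ::
  "(complex ^ 'n \<Rightarrow> complex) \<Rightarrow> real \<Rightarrow> (complex ^ 'n \<Rightarrow> complex) set" where
  "optimal_domain g q = {f \<in> holo_ball. volterra g f \<in> hardy_space q}"

end

theory Submission
  imports Defs "HOL-Complex_Analysis.Complex_Analysis"
    "HOL-Computational_Algebra.Fundamental_Theorem_Algebra"
begin

text \<open>
  Applying the operator to the constant 1 gives \<open>g \<in> H^q\<close>. For a homogeneous polynomial \<open>F\<close> of degree
  \<open>k\<close>, integration by parts shows \<open>T_g F = F * H_k\<close> with
  \<open>H_k(z) = \<integral> k t^(k-1) (g(z) - g(tz)) dt\<close> over \<open>[0, 1]\<close>, and \<open>H_k\<close> tends to 0 in \<open>H^q\<close> as
  \<open>k \<rightarrow> \<infinity>\<close>. Choosing random signs in front of the normalized monomials of degree \<open>k\<close> gives \<open>F\<close> that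
  are flat on the sphere: their \<open>H^p\<close> norms stay bounded below while \<open>T_g F\<close> tends to 0 in \<open>H^q\<close>.
  A gliding hump series of multiples of such polynomials leaves \<open>H^p\<close> while its image
  under \<open>T_g\<close> stays in \<open>H^q\<close>.

  That \<open>H_k \<rightarrow> 0\<close>, also for \<open>q < 1\<close>, rests on a quantitative form of the submean property:
  if the mean of \<open>|f|^q\<close> over the unit circle is close to \<open>|f(0)|^q\<close>, then \<open>f\<close> is close to
  \<open>f(0)\<close> in the mean of order \<open>q\<close>. Composed with disc automorphisms fixing the circle, this
  bounds the radial oscillation of \<open>g\<close> between the radii \<open>s * r\<close> and \<open>s\<close> by the increment of the integral means of
  \<open>|g|^q\<close>, which converge because \<open>g \<in> H^q\<close>.
\<close>

subsection \<open>Rotation invariance of the surface measure\<close>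

text \<open>The factor \<open>H_k\<close> is small only in the mean over the sphere, so for
  \<open>n \<ge> 2\<close> a polynomial whose mass concentrates on a small set, such as a power of a
  coordinate, may sit where \<open>H_k\<close> is large. The average of \<open>|F(z)|^q\<close> over
  all signs is bounded uniformly in \<open>z\<close> and \<open>k\<close>; hence for some choice of
  signs the integral of \<open>|F|^q X\<close> is controlled by that of \<open>X\<close>, for any
  integrable majorant \<open>X\<close> of \<open>|H_k|^q\<close> at radius \<open>s\<close>. This
  choice depends on \<open>s\<close>. As each degree has finitely many choices, one of them works
  for radii tending to 1, and monotonicity of the integral means covers the rest. Degrees are powers
  \<open>k = 2^N\<close>: the weight \<open>k t^(k-1)\<close> then gives the block from
  \<open>1 - 2^-i\<close> to \<open>1 - 2^-(i+1)\<close> a mass that decays geometrically in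
  \<open>|i - N|\<close>, so the block estimates can be summed for every \<open>q > 0\<close>. For
  exponents below 1 the triangle inequality is replaced by one with the constant \<open>2^p\<close>,
  and the submean property of \<open>|f|^q\<close> is reduced to zero-free functions, which have
  powers of order \<open>q\<close>.\<close>

text \<open>Both sides are multiples of each other by the Fubini trick for translation-invariant measures;
  testing on the unit ball shows that the factor is 1.\<close>

lemma emeasure_lborel_isometry_vimage:
  fixes T :: "'a::euclidean_space \<Rightarrow> 'a"
  assumes T: "linear T" "\<And>x. norm (T x) = norm x" and A[measurable]: "A \<in> sets borel"
  shows "emeasure lborel (T -` A) = emeasure lborel A"
proof -
  have [measurable]: "T \<in> borel_measurable borel"
    using linear_continuous_on[OF linear_conv_bounded_linear[THEN iffD1, OF T(1)]]
    by (rule borel_measurable_continuous_onI)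
  have "inj T"
    using T by (metis linear_injective_0 norm_eq_zero)
  then have surj: "surj T"
    using T(1) linear_injective_imp_surjective by blast
  define B where "B = ball (0::'a) 1"
  have B[measurable]: "B \<in> sets borel" by (simp add: B_def)
  have shift: "(\<integral>\<^sup>+ y. f (y + c) \<partial>lborel) = (\<integral>\<^sup>+ y. f y \<partial>lborel)"
    if [measurable]: "f \<in> borel_measurable borel" for f :: "'a \<Rightarrow> ennreal" and c
  proof -
    have "(\<integral>\<^sup>+ y. f y \<partial>lborel) = (\<integral>\<^sup>+ y. f y \<partial>(distr lborel borel ((+) c)))"
      by (simp add: lborel_distr_plus)
    also have "\<dots> = (\<integral>\<^sup>+ y. f (c + y) \<partial>lborel)"
      by (subst nn_integral_distr) auto
    finally show ?thesis by (simp add: add.commute)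
  qed
  have ball: "(\<integral>\<^sup>+ y. indicator B (a - y) \<partial>lborel) = emeasure lborel B" for a
  proof -
    have "(\<integral>\<^sup>+ y. indicator B (a - y) \<partial>lborel) = (\<integral>\<^sup>+ y. indicator B (y - a) \<partial>lborel)"
      by (simp add: B_def indicator_def dist_norm norm_minus_commute)
    also have "\<dots> = (\<integral>\<^sup>+ y. indicator B y \<partial>lborel)"
      using shift[of "indicator B" "-a"] by simp
    finally show ?thesis by simp
  qed
  have TV: "(\<integral>\<^sup>+ u. indicator A (T u) \<partial>lborel) = emeasure lborel (T -` A)"
  proof -
    have "(\<integral>\<^sup>+ u. indicator A (T u) \<partial>lborel) = (\<integral>\<^sup>+ u. indicator (T -` A) u \<partial>lborel)"
      by (simp add: indicator_def vimage_def)
    moreover have "T -` A \<in> sets lborel"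
      using measurable_sets[of T borel borel A] by simp
    ultimately show ?thesis by simp
  qed
  have "emeasure lborel (T -` A) * emeasure lborel B
      = (\<integral>\<^sup>+ u. indicator A (T u) * (\<integral>\<^sup>+ y. indicator B (T u - y) \<partial>lborel) \<partial>lborel)"
    by (simp add: ball nn_integral_multc TV)
  also have "\<dots> = (\<integral>\<^sup>+ u. (\<integral>\<^sup>+ y. indicator A (T u) * indicator B (T u - y) \<partial>lborel) \<partial>lborel)"
    by (simp add: nn_integral_cmult)
  also have "\<dots> = (\<integral>\<^sup>+ y. (\<integral>\<^sup>+ u. indicator A (T u) * indicator B (T u - y) \<partial>lborel) \<partial>lborel)"
    by (rule lborel_pair.Fubini') measurable
  also have "\<dots> = (\<integral>\<^sup>+ y. (\<integral>\<^sup>+ u. indicator A (T u + y) * indicator B u \<partial>lborel) \<partial>lborel)"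
  proof (rule nn_integral_cong)
    fix y :: 'a
    \<comment> \<open>With \<open>T v = y\<close>, replacing \<open>u\<close> by
      \<open>u + v\<close> turns \<open>T u - y\<close> into \<open>T u\<close>, and
      \<open>T u\<close> lies in the unit ball exactly when \<open>u\<close> does because
      \<open>T\<close> preserves norms.\<close>
    obtain v where v: "T v = y" using surj by (metis surjD)
    have "(\<integral>\<^sup>+ u. indicator A (T u) * indicator B (T u - y) \<partial>lborel)
        = (\<integral>\<^sup>+ u. indicator A (T (u + v)) * indicator B (T (u + v) - y) \<partial>lborel :: ennreal)"
      by (subst shift) auto
    also have "\<dots> = (\<integral>\<^sup>+ u. indicator A (T u + y) * indicator B u \<partial>lborel)"
      by (simp add: linear_add[OF T(1)] v B_def indicator_def T(2))
    finally show "(\<integral>\<^sup>+ u. indicator A (T u) * indicator B (T u - y) \<partial>lborel)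
      = (\<integral>\<^sup>+ u. indicator A (T u + y) * indicator B u \<partial>lborel :: ennreal)" .
  qed
  also have "\<dots> = (\<integral>\<^sup>+ u. (\<integral>\<^sup>+ y. indicator A (T u + y) * indicator B u \<partial>lborel) \<partial>lborel)"
    by (rule lborel_pair.Fubini'[symmetric]) measurable
  also have "\<dots> = (\<integral>\<^sup>+ u. emeasure lborel A * indicator B u \<partial>lborel)"
  proof (rule nn_integral_cong)
    fix u :: 'a
    show "(\<integral>\<^sup>+ y. indicator A (T u + y) * indicator B u \<partial>lborel) = emeasure lborel A * indicator B u"
      using shift[of "indicator A" "T u"] by (simp add: nn_integral_multc add.commute)
  qed
  also have "\<dots> = emeasure lborel A * emeasure lborel B"
    by (simp add: nn_integral_cmult)
  finally have "emeasure lborel (T -` A) * emeasure lborel B = emeasure lborel A * emeasure lborel B" .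
  moreover have "emeasure lborel B \<noteq> 0" "emeasure lborel B \<noteq> \<infinity>"
    using emeasure_lborel_ball_finite[of "0::'a" 1] open_not_negligible[of B]
    by (auto simp: B_def negligible_iff_emeasure0 emeasure_completion)
  ultimately show ?thesis
    by (simp add: ennreal_mult_cancel_left mult.commute[of _ "emeasure lborel B"])
qed

section \<open>Complex scalar multiplication and the surface measure\<close>

lemma norm_vector_smult [simp]: "norm (c *s (z :: complex ^ 'n)) = norm c * norm z"
  by (simp add: norm_vec_def norm_mult L2_set_right_distrib)

lemma linear_vector_smult: "linear (\<lambda>z :: complex ^ 'n. c *s z)"
  by (rule linearI) (simp_all add: vector_add_ldistrib vec_eq_iff algebra_simps)

lemma scaleR_eq_smult: "s *\<^sub>R (z :: complex ^ 'n) = of_real s *s z"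
  by (simp add: vec_eq_iff scaleR_conv_of_real[where 'a = complex])

lemma continuous_on_smult [continuous_intros]:
  fixes f :: "'a::topological_space \<Rightarrow> complex"
  assumes "continuous_on A f" "continuous_on A h"
  shows "continuous_on A (\<lambda>x. f x *s (h x :: complex ^ 'n))"
  unfolding vector_scalar_mult_def by (intro continuous_intros assms)

lemma borel_measurable_smult [measurable (raw)]:
  assumes "f \<in> borel_measurable M" "h \<in> borel_measurable M"
  shows "(\<lambda>x. (f x :: complex) *s (h x :: complex ^ 'n)) \<in> borel_measurable M"
  using assms by (rule borel_measurable_continuous_Pair) (intro continuous_intros)

lemma space_sphere_measure [simp]: "space (sphere_measure :: (complex ^ 'n) measure) = sphere 0 1"
  by (simp add: sphere_measure_def space_restrict_space)

lemma sets_sphere_measure [measurable_cong]: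
  "sets (sphere_measure :: (complex ^ 'n) measure) = sets (restrict_space borel (sphere 0 1))"
  unfolding sphere_measure_def by (intro sets_restrict_space_cong) simp

lemma emeasure_sphere_measure:
  fixes A :: "(complex ^ 'n) set"
  assumes "A \<in> sets borel" "A \<subseteq> sphere 0 1"
  shows "emeasure sphere_measure A
    = emeasure lborel (ball 0 1 \<inter> sgn -` A) / emeasure lborel (ball (0 :: complex ^ 'n) 1)"
proof -
  have [measurable]: "sgn \<in> borel_measurable (borel :: (complex ^ 'n) measure)"
    unfolding sgn_div_norm by measurable
  have "emeasure sphere_measure A
      = emeasure (uniform_measure lborel (ball 0 1)) (sgn -` A)"
    unfolding sphere_measure_def
    using assms by (simp add: emeasure_restrict_space emeasure_distr)
  also have "\<dots> = emeasure lborel (ball 0 1 \<inter> sgn -` A) / emeasure lborel (ball (0 :: complex ^ 'n) 1)"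
    using measurable_sets[of sgn borel borel A] assms by (subst emeasure_uniform_measure) auto
  finally show ?thesis .
qed

lemma emeasure_sphere_measure_space:
  "emeasure sphere_measure (sphere 0 1 :: (complex ^ 'n) set) = 1"
proof -
  have "ball 0 1 \<inter> sgn -` sphere 0 1 = ball (0 :: complex ^ 'n) 1 - {0}"
    by (auto simp: norm_sgn sgn_zero_iff)
  moreover have "emeasure lborel (ball (0 :: complex ^ 'n) 1 - {0}) = emeasure lborel (ball (0 :: complex ^ 'n) 1)"
    by (subst emeasure_Diff_null_set) (auto simp: null_sets_def)
  moreover have "emeasure lborel (ball (0 :: complex ^ 'n) 1) \<noteq> 0"
      "emeasure lborel (ball (0 :: complex ^ 'n) 1) \<noteq> \<infinity>"
    using emeasure_lborel_ball_finite[of "0 :: complex ^ 'n" 1] open_not_negligible[of "ball (0 :: complex ^ 'n) 1"]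
    by (auto simp: negligible_iff_emeasure0 emeasure_completion)
  ultimately show ?thesis
    by (subst emeasure_sphere_measure) (auto simp: ennreal_divide_self less_top)
qed

interpretation sphere: finite_measure "sphere_measure :: (complex ^ 'n) measure"
  by (rule finite_measureI) (simp add: emeasure_sphere_measure_space)

lemma measure_sphere_measure_space [simp]:
  "measure sphere_measure (sphere 0 1 :: (complex ^ 'n) set) = 1"
  by (simp add: measure_def emeasure_sphere_measure_space)

text \<open>The map \<open>sgn\<close> commutes with unimodular scalars, so the cone over a rotated
  set is the rotated cone, and Lebesgue measure is invariant under this linear isometry.\<close>

lemma distr_sphere_measure_smult:
  fixes c :: complex
  assumes c: "norm c = 1"
  shows "distr sphere_measure sphere_measure (\<lambda>z :: complex ^ 'n. c *s z) = sphere_measure"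
proof (rule measure_eqI)
  fix A :: "(complex ^ 'n) set"
  assume "A \<in> sets (distr sphere_measure sphere_measure (\<lambda>z. c *s z))"
  then have A: "A \<in> sets sphere_measure" by simp
  then have A': "A \<in> sets borel" "A \<subseteq> sphere 0 1"
    using sets.sets_into_space[OF A] by (auto simp: sets_sphere_measure sets_restrict_space)
  have m: "(\<lambda>z. c *s z) \<in> measurable sphere_measure (sphere_measure :: (complex ^ 'n) measure)"
    unfolding measurable_cong_sets[OF refl sets_sphere_measure]
    by (rule measurable_restrict_space2)
      (auto simp: c intro!: borel_measurable_smult measurable_ident_sets
        measurable_restrict_space1 simp: measurable_cong_sets[OF sets_sphere_measure refl])
  have [measurable]: "(\<lambda>z :: complex ^ 'n. c *s z) \<in> borel_measurable borel"
    by measurable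
  have [measurable]: "sgn \<in> borel_measurable (borel :: (complex ^ 'n) measure)"
    unfolding sgn_div_norm by measurable
  have sgn: "sgn (c *s z) = c *s sgn z" for z :: "complex ^ 'n"
    by (simp add: sgn_div_norm c vec_eq_iff)
  have "emeasure (distr sphere_measure sphere_measure (\<lambda>z. c *s z)) A
      = emeasure sphere_measure ((\<lambda>z. c *s z) -` A)"
  proof -
    have "(\<lambda>z. c *s z) -` A \<inter> sphere 0 1 = (\<lambda>z. c *s z) -` A"
      using A' c by (auto simp: subset_iff)
    then show ?thesis
      using A by (simp add: emeasure_distr[OF m])
  qed
  also have "\<dots> = emeasure lborel (ball 0 1 \<inter> sgn -` ((\<lambda>z. c *s z) -` A)) / emeasure lborel (ball (0 :: complex ^ 'n) 1)"
    using A' c measurable_sets[of "(\<lambda>z. c *s z)" borel borel A]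
    by (subst emeasure_sphere_measure) (auto simp: subset_iff)
  also have "ball 0 1 \<inter> sgn -` ((\<lambda>z. c *s z) -` A) = (\<lambda>z. c *s z) -` (ball 0 1 \<inter> sgn -` A)"
    by (auto simp: sgn c)
  also have "emeasure lborel \<dots> = emeasure lborel (ball 0 1 \<inter> sgn -` A)"
    using measurable_sets[of sgn borel borel A] A'
    by (intro emeasure_lborel_isometry_vimage) (auto simp: c linear_vector_smult)
  finally show "emeasure (distr sphere_measure sphere_measure (\<lambda>z. c *s z)) A = emeasure sphere_measure A"
    using A' by (simp add: emeasure_sphere_measure)
qed simp

lemma measurable_sphere_ident [measurable]: "(\<lambda>z. z) \<in> borel_measurable sphere_measure"
  unfolding measurable_cong_sets[OF sets_sphere_measure refl]
  by (intro measurable_restrict_space1) simp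

lemma integral_sphere_smult:
  fixes f :: "complex ^ 'n \<Rightarrow> real"
  assumes c: "norm c = 1" and f: "f \<in> borel_measurable sphere_measure"
  shows "(LINT z|sphere_measure. f (c *s z)) = (LINT z|sphere_measure. f z)"
proof -
  have m: "(\<lambda>z. c *s z) \<in> measurable sphere_measure (sphere_measure :: (complex ^ 'n) measure)"
    unfolding measurable_cong_sets[OF refl sets_sphere_measure]
    by (rule measurable_restrict_space2) (auto simp: c)
  show ?thesis
    using integral_distr[OF m f] by (simp add: distr_sphere_measure_smult[OF c])
qed

lemma measurable_continuous_on_comp:
  assumes "continuous_on S f" "h \<in> borel_measurable M" "\<And>x. x \<in> space M \<Longrightarrow> h x \<in> S"
  shows "(\<lambda>x. f (h x)) \<in> borel_measurable M"
  by (rule measurable_compose[OF measurable_restrict_space2 borel_measurable_continuous_on_restrict])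
    (use assms in auto)

lemma integrable_sphere_continuous:
  fixes f :: "complex ^ 'n \<Rightarrow> 'b::{banach, second_countable_topology}"
  assumes "continuous_on (sphere 0 1) f"
  shows "integrable sphere_measure f"
proof -
  obtain B where "\<And>z. z \<in> sphere 0 1 \<Longrightarrow> norm (f z) \<le> B"
    using compact_imp_bounded[OF compact_continuous_image[OF assms compact_sphere]]
    unfolding bounded_iff by blast
  then show ?thesis
    using measurable_continuous_on_comp[OF assms measurable_sphere_ident]
    by (intro sphere.integrable_const_bound[of _ B] AE_I2) auto
qed

subsection \<open>Submean inequalities on the circle\<close>

text \<open>Normalized arc length, as an image measure of the unit interval. The target carries the
  trace sigma-algebra, so functions that are continuous merely on the circle are measurable.\<close>

definition circle_measure :: "complex measure" where
  "circle_measure =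
     distr (restrict_space lborel {0..1::real}) (restrict_space borel (sphere 0 1)) (\<lambda>t. cis (2 * pi * t))"

lemma space_circle_measure [simp]: "space circle_measure = sphere 0 1"
  by (simp add: circle_measure_def space_restrict_space)

lemma sets_circle_measure [measurable_cong]: "sets circle_measure = sets (restrict_space borel (sphere 0 1))"
  by (simp add: circle_measure_def)

lemma measurable_circle_ident [measurable]: "(\<lambda>z. z) \<in> borel_measurable circle_measure"
  unfolding measurable_cong_sets[OF sets_circle_measure refl]
  by (intro measurable_restrict_space1) simp

lemma measurable_cis_circle:
  "(\<lambda>t. cis (2 * pi * t)) \<in> measurable (restrict_space lborel {0..1::real}) (restrict_space borel (sphere 0 1))"
proof (rule measurable_restrict_space2)
  have "continuous_on UNIV (\<lambda>t. cis (2 * pi * t))"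
    by (intro continuous_intros)
  then have "(\<lambda>t. cis (2 * pi * t)) \<in> borel_measurable borel"
    by (rule borel_measurable_continuous_onI)
  then show "(\<lambda>t. cis (2 * pi * t)) \<in> restrict_space lborel {0..1} \<rightarrow>\<^sub>M borel"
    by (intro measurable_restrict_space1) simp
qed auto

lemma emeasure_circle_measure_space: "emeasure circle_measure (sphere 0 1) = 1"
proof -
  have "sphere 0 1 \<in> sets (restrict_space borel (sphere (0::complex) 1))"
    by (simp add: sets_restrict_space_iff)
  moreover have "(\<lambda>t. cis (2 * pi * t)) -` sphere 0 1 \<inter> space (restrict_space lborel {0..1}) = {0..1}"
    by (auto simp: space_restrict_space)
  ultimately show ?thesis
    unfolding circle_measure_def
    by (subst emeasure_distr[OF measurable_cis_circle]) (auto simp: emeasure_restrict_space)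
qed

interpretation circle: finite_measure circle_measure
  by (rule finite_measureI) (simp add: emeasure_circle_measure_space)

lemma measure_circle_measure_space [simp]: "measure circle_measure (sphere 0 1) = 1"
  by (simp add: measure_def emeasure_circle_measure_space)

lemma integrable_circle_continuous:
  fixes f :: "complex \<Rightarrow> 'b::{banach, second_countable_topology}"
  assumes "continuous_on (sphere 0 1) f"
  shows "integrable circle_measure f"
proof -
  obtain B where "\<And>z. z \<in> sphere 0 1 \<Longrightarrow> norm (f z) \<le> B"
    using compact_imp_bounded[OF compact_continuous_image[OF assms compact_sphere]]
    unfolding bounded_iff by blast
  then show ?thesis
    using measurable_continuous_on_comp[OF assms measurable_circle_ident]
    by (intro circle.integrable_const_bound[of _ B] AE_I2) auto
qed

lemma integral_circle_continuous:
  fixes f :: "complex \<Rightarrow> 'b::euclidean_space"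
  assumes f: "continuous_on (sphere 0 1) f"
  shows "(LINT \<zeta>|circle_measure. f \<zeta>) = integral {0..1} (\<lambda>t. f (cis (2 * pi * t)))"
proof -
  have c: "continuous_on {0..1} (\<lambda>t. f (cis (2 * pi * t)))"
    by (rule continuous_on_compose2[OF f]) (auto intro!: continuous_intros)
  have "(LINT \<zeta>|circle_measure. f \<zeta>) = (LINT t|restrict_space lborel {0..1}. f (cis (2 * pi * t)))"
    unfolding circle_measure_def
    by (rule integral_distr[OF measurable_cis_circle borel_measurable_continuous_on_restrict[OF f]])
  also have "\<dots> = (LINT t:{0..1}|lborel. f (cis (2 * pi * t)))"
    by (subst integral_restrict_space) (auto simp: set_lebesgue_integral_def)
  also have "\<dots> = integral {0..1} (\<lambda>t. f (cis (2 * pi * t)))"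
    by (rule set_borel_integral_eq_integral(2)) (rule borel_integrable_compact[OF _ c, unfolded set_integrable_def[symmetric]], simp)
  finally show ?thesis .
qed

text \<open>On the circle \<open>dw = 2 pi i \<zeta> dt\<close>; dividing Cauchy's formula by
  \<open>2 pi i\<close> leaves the extra factor \<open>\<zeta>\<close> in the integrand.\<close>

lemma Cauchy_circle_mean:
  assumes F: "continuous_on (cball 0 1) F" "F holomorphic_on ball 0 1" and u: "norm u < 1"
  shows "(LINT \<zeta>|circle_measure. F \<zeta> * \<zeta> / (\<zeta> - u)) = F u"
proof -
  have exp_cis: "exp (2 * of_real pi * \<i> * of_real t) = cis (2 * pi * t)" for t :: real
    by (simp add: cis_conv_exp mult_ac)
  have "((\<lambda>w. F w / (w - u)) has_contour_integral (2 * of_real pi * \<i> * F u)) (circlepath 0 1)"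
    by (rule Cauchy_integral_circlepath) (use assms in auto)
  then have "((\<lambda>t. F (cis (2 * pi * t)) / (cis (2 * pi * t) - u) * (2 * pi * \<i> * cis (2 * pi * t)))
      has_integral (2 * of_real pi * \<i> * F u)) {0..1}"
    unfolding has_contour_integral vector_derivative_circlepath
    by (simp add: circlepath exp_cis)
  from has_integral_mult_right[OF this, of "1 / (2 * of_real pi * \<i>)"]
  have "((\<lambda>t. F (cis (2 * pi * t)) * cis (2 * pi * t) / (cis (2 * pi * t) - u)) has_integral F u) {0..1}"
    by (simp add: field_simps)
  then have "integral {0..1} (\<lambda>t. F (cis (2 * pi * t)) * cis (2 * pi * t) / (cis (2 * pi * t) - u)) = F u"
    by (rule integral_unique)
  moreover have "continuous_on (sphere 0 1) (\<lambda>\<zeta>. F \<zeta> * \<zeta> / (\<zeta> - u))"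
    using u by (intro continuous_intros continuous_on_subset[OF F(1)]) auto
  ultimately show ?thesis
    by (subst integral_circle_continuous) auto
qed

text \<open>Away from the center the factor bounds the Poisson kernel.\<close>

definition submean :: "real \<Rightarrow> (complex \<Rightarrow> complex) \<Rightarrow> bool" where
  "submean q F \<longleftrightarrow> (\<forall>u. norm u < 1 \<longrightarrow>
     norm (F u) powr q \<le> (1 + norm u) / (1 - norm u) * (LINT \<zeta>|circle_measure. norm (F \<zeta>) powr q))"

text \<open>Without zeros there is a logarithm \<open>L\<close>, and \<open>exp (q * L)\<close> is a
  holomorphic function of modulus \<open>|F|^q\<close>, to which Cauchy's formula applies.\<close>

lemma submean_zero_free:
  assumes F: "F holomorphic_on ball 0 R" "\<And>w. w \<in> ball 0 R \<Longrightarrow> F w \<noteq> 0" and R: "R > 1"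
  shows "submean q F"
  unfolding submean_def
proof (intro allI impI)
  fix u :: complex
  assume u: "norm u < 1"
  obtain L where L: "L holomorphic_on ball 0 R" "\<And>w. w \<in> ball 0 R \<Longrightarrow> F w = exp (L w)"
    using simply_connected_eq_holomorphic_log[of "ball (0::complex) R"] F
      convex_imp_simply_connected[of "ball (0::complex) R"] by auto
  define Q where "Q = (\<lambda>w. exp (of_real q * L w))"
  have normQ: "norm (Q w) = norm (F w) powr q" if "w \<in> ball 0 R" for w
    using L(2)[OF that] by (simp add: Q_def norm_exp_eq_Re powr_def)
  have Q: "Q holomorphic_on ball 0 R"
    unfolding Q_def by (intro holomorphic_intros L)
  have sub: "cball 0 1 \<subseteq> ball (0::complex) R" "sphere 0 1 \<subseteq> ball (0::complex) R" "ball 0 1 \<subseteq> ball (0::complex) R"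
    using R by auto
  have nz: "1 - cnj u * w \<noteq> 0" if "norm w \<le> 1" for w
  proof
    assume "1 - cnj u * w = 0"
    then have "norm (cnj u * w) = 1" by simp
    moreover have "norm (cnj u * w) \<le> norm u * 1"
      unfolding norm_mult complex_mod_cnj using that by (intro mult_left_mono) auto
    ultimately show False using u by simp
  qed
  \<comment> \<open>The second factor equals 1 at \<open>u\<close>, so Cauchy's formula for
    \<open>K\<close> returns \<open>Q u\<close>. Together with
    \<open>\<zeta> / (\<zeta> - u)\<close> it has on the circle the modulus of the Poisson kernel,
    at most \<open>(1 + norm u) / (1 - norm u)\<close>.\<close>
  define K where "K = (\<lambda>w. Q w * ((1 - of_real (norm u ^ 2)) / (1 - cnj u * w)))"
  have "K u = (LINT \<zeta>|circle_measure. K \<zeta> * \<zeta> / (\<zeta> - u))"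
  proof (rule Cauchy_circle_mean[symmetric, OF _ _ u])
    show "continuous_on (cball 0 1) K"
      unfolding K_def using nz sub
      by (intro continuous_intros holomorphic_on_imp_continuous_on[OF holomorphic_on_subset[OF Q]]) auto
    show "K holomorphic_on ball 0 1"
      unfolding K_def using nz sub by (intro holomorphic_intros holomorphic_on_subset[OF Q]) auto
  qed
  moreover have "K u = Q u"
    using nz[of u] u unfolding K_def complex_norm_square by (simp add: mult.commute)
  ultimately have Qu: "Q u = (LINT \<zeta>|circle_measure. K \<zeta> * \<zeta> / (\<zeta> - u))" by simp
  have contQ: "continuous_on (sphere 0 1) Q"
    by (intro holomorphic_on_imp_continuous_on holomorphic_on_subset[OF Q] sub)
  have "norm (Q u) \<le> (LINT \<zeta>|circle_measure. (1 + norm u) / (1 - norm u) * norm (Q \<zeta>))"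
    unfolding Qu
  proof (rule Bochner_Integration.integral_norm_bound_integral)
    have "continuous_on (sphere 0 1) (\<lambda>\<zeta>. K \<zeta> * \<zeta> / (\<zeta> - u))"
      unfolding K_def using nz u by (intro continuous_intros contQ) auto
    then show "integrable circle_measure (\<lambda>\<zeta>. K \<zeta> * \<zeta> / (\<zeta> - u))"
      by (rule integrable_circle_continuous)
    show "integrable circle_measure (\<lambda>\<zeta>. (1 + norm u) / (1 - norm u) * norm (Q \<zeta>))"
      by (rule integrable_circle_continuous) (intro continuous_intros contQ)
    fix \<zeta> assume "\<zeta> \<in> space circle_measure"
    then have \<zeta>: "norm \<zeta> = 1" by simp
    have a: "1 - norm u \<le> norm (\<zeta> - u)" using norm_triangle_ineq2[of \<zeta> u] \<zeta> by simp
    have b: "1 - norm u \<le> norm (1 - cnj u * \<zeta>)"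
      using norm_triangle_ineq2[of 1 "cnj u * \<zeta>"] \<zeta> by (simp add: norm_mult)
    have "norm (K \<zeta> * \<zeta> / (\<zeta> - u)) = norm (Q \<zeta>) * (1 - norm u ^ 2) / (norm (1 - cnj u * \<zeta>) * norm (\<zeta> - u))"
    proof -
      have "norm (1 - complex_of_real ((norm u)\<^sup>2)) = 1 - norm u ^ 2"
        using u by (metis abs_of_nonneg norm_of_real of_real_1 of_real_diff diff_ge_0_iff_ge
            abs_square_le_1 abs_norm_cancel less_imp_le)
      then show ?thesis by (simp add: K_def norm_mult norm_divide \<zeta>)
    qed
    also have "\<dots> \<le> norm (Q \<zeta>) * (1 - norm u ^ 2) / ((1 - norm u) * (1 - norm u))"
      using a b u by (intro divide_left_mono mult_mono mult_nonneg_nonneg mult_pos_pos)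
        (auto simp: power2_eq_square mult_le_one abs_square_le_1 less_imp_le)
    also have "\<dots> = (1 + norm u) / (1 - norm u) * norm (Q \<zeta>)"
    proof -
      have "1 - norm u ^ 2 = (1 - norm u) * (1 + norm u)" by (simp add: power2_eq_square algebra_simps)
      then show ?thesis using u by simp
    qed
    finally show "norm (K \<zeta> * \<zeta> / (\<zeta> - u)) \<le> (1 + norm u) / (1 - norm u) * norm (Q \<zeta>)" .
  qed
  also have "\<dots> = (1 + norm u) / (1 - norm u) * (LINT \<zeta>|circle_measure. norm (F \<zeta>) powr q)"
    using sub(2) normQ by (auto intro!: arg_cong2[of _ _ _ _ "(*)"] Bochner_Integration.integral_cong)
  finally show "norm (F u) powr q \<le> (1 + norm u) / (1 - norm u) * (LINT \<zeta>|circle_measure. norm (F \<zeta>) powr q)"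
    using normQ[of u] u R by simp
qed

text \<open>Used twice: to admit zeros on the circle, by approaching a function through its dilates,
  and to pass from Taylor polynomials to holomorphic functions.\<close>

lemma submean_limit:
  assumes F: "\<And>n. submean q (F n)" and cont: "\<And>n::nat. continuous_on (cball 0 1) (F n)"
    and lim: "\<And>w. norm w \<le> 1 \<Longrightarrow> (\<lambda>n. F n w) \<longlonglongrightarrow> G w"
    and bd: "\<And>n w. norm w \<le> 1 \<Longrightarrow> norm (F n w) \<le> B" and q: "q > 0"
  shows "submean q G"
  unfolding submean_def
proof (intro allI impI)
  fix u :: complex
  assume u: "norm u < 1"
  have B: "B \<ge> 0" using bd[of 0 0] order.trans[OF norm_ge_zero] by auto
  have meas: "(\<lambda>\<zeta>. norm (F n \<zeta>) powr q) \<in> borel_measurable circle_measure" for n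
    using q by (intro borel_measurable_integrable integrable_circle_continuous continuous_intros
        continuous_on_subset[OF cont] continuous_on_powr') auto
  have limp: "(\<lambda>n. norm (F n w) powr q) \<longlonglongrightarrow> norm (G w) powr q" if "norm w \<le> 1" for w
    using q by (intro tendsto_powr2 tendsto_intros lim that) auto
  have "(\<lambda>n. LINT \<zeta>|circle_measure. norm (F n \<zeta>) powr q) \<longlonglongrightarrow> (LINT \<zeta>|circle_measure. norm (G \<zeta>) powr q)"
  proof (rule integral_dominated_convergence[where w = "\<lambda>_. B powr q"])
    show "(\<lambda>\<zeta>. norm (G \<zeta>) powr q) \<in> borel_measurable circle_measure"
      by (rule borel_measurable_LIMSEQ_metric[where f = "\<lambda>n \<zeta>. norm (F n \<zeta>) powr q"])
        (use meas limp in auto)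
    show "AE \<zeta> in circle_measure. norm (norm (F i \<zeta>) powr q) \<le> B powr q" for i
      using bd q B by (intro AE_I2) (auto intro!: powr_mono2)
  qed (use meas limp in auto)
  then have "(\<lambda>n. (1 + norm u) / (1 - norm u) * (LINT \<zeta>|circle_measure. norm (F n \<zeta>) powr q))
      \<longlonglongrightarrow> (1 + norm u) / (1 - norm u) * (LINT \<zeta>|circle_measure. norm (G \<zeta>) powr q)"
    by (intro tendsto_intros)
  from tendsto_le[OF _ this limp[of u]] show
    "norm (G u) powr q \<le> (1 + norm u) / (1 - norm u) * (LINT \<zeta>|circle_measure. norm (G \<zeta>) powr q)"
    using F u by (auto simp: submean_def)
qed

text \<open>A factor \<open>w - \<alpha>\<close> with \<open>\<alpha>\<close> in the disc is replaced by \<open>1 - cnj \<alpha> * w\<close>,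
  which has the same modulus on the circle and no zero in the disc.\<close>

lemma poly_zero_free_majorant:
  fixes P :: "complex poly"
  assumes "P \<noteq> 0"
  shows "\<exists>G. G holomorphic_on UNIV \<and> (\<forall>w\<in>ball 0 1. G w \<noteq> 0) \<and>
    (\<forall>w\<in>cball 0 1. norm (poly P w) \<le> norm (G w)) \<and> (\<forall>w\<in>sphere 0 1. norm (poly P w) = norm (G w))"
  using assms
proof (induction "degree P" arbitrary: P rule: less_induct)
  case less
  show ?case
  proof (cases "degree P = 0")
    case True
    then obtain c where "P = [:c:]" by (metis degree_eq_zeroE)
    with less.prems show ?thesis by (intro exI[of _ "\<lambda>_. c"]) auto
  next
    case False
    then have "\<not> (\<exists>a l. a \<noteq> 0 \<and> l = 0 \<and> P = pCons a l)" by auto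
    then obtain a where "poly P a = 0" using fundamental_theorem_of_algebra_alt by blast
    then obtain Q where P: "P = [:- a, 1:] * Q" by (auto simp: poly_eq_0_iff_dvd dvd_def)
    with less.prems have Q: "Q \<noteq> 0" by auto
    have "degree P = degree Q + 1" unfolding P using Q by (subst degree_mult_eq) auto
    then have "degree Q < degree P" by simp
    from less.hyps[OF this Q] obtain G where G: "G holomorphic_on UNIV" "\<And>w. w \<in> ball 0 1 \<Longrightarrow> G w \<noteq> 0"
      "\<And>w. w \<in> cball 0 1 \<Longrightarrow> norm (poly Q w) \<le> norm (G w)"
      "\<And>w. w \<in> sphere 0 1 \<Longrightarrow> norm (poly Q w) = norm (G w)"
      by blast
    have "\<exists>h. h holomorphic_on UNIV \<and> (\<forall>w\<in>ball 0 1. h w \<noteq> 0) \<and>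
      (\<forall>w\<in>cball 0 1. norm (w - a) \<le> norm (h w)) \<and> (\<forall>w\<in>sphere 0 1. norm (w - a) = norm (h w))"
    proof (cases "norm a \<le> 1")
      case True
      have id: "norm (1 - cnj a * w)^2 - norm (w - a)^2 = (1 - norm a ^ 2) * (1 - norm w ^ 2)" for w
        by (simp only: cmod_power2) (simp add: power2_eq_square algebra_simps)
      have "norm (w - a) \<le> norm (1 - cnj a * w)" if "norm w \<le> 1" for w
      proof -
        have "(1 - norm a ^ 2) * (1 - norm w ^ 2) \<ge> 0"
          using True that by (intro mult_nonneg_nonneg) (auto simp: abs_square_le_1)
        then have "norm (w - a) ^ 2 \<le> norm (1 - cnj a * w) ^ 2" using id[of w] by linarith
        then show ?thesis by (rule power2_le_imp_le) simp
      qed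
      moreover have "norm (w - a) = norm (1 - cnj a * w)" if "norm w = 1" for w
      proof -
        have "norm (w - a) ^ 2 = norm (1 - cnj a * w) ^ 2" using id[of w] unfolding that by simp
        then show ?thesis by (rule power2_eq_imp_eq) simp_all
      qed
      moreover have "1 - cnj a * w \<noteq> 0" if "norm w < 1" for w
      proof
        assume "1 - cnj a * w = 0"
        then have "norm (cnj a * w) = 1" by simp
        moreover have "norm (cnj a * w) \<le> 1 * norm w"
          unfolding norm_mult complex_mod_cnj using True by (intro mult_right_mono) auto
        ultimately show False using that by simp
      qed
      moreover have "(\<lambda>w. 1 - cnj a * w) holomorphic_on UNIV" by (intro holomorphic_intros)
      ultimately show ?thesis
        by (intro exI[of _ "\<lambda>w. 1 - cnj a * w"] conjI ballI) auto
    next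
      case False
      moreover have "(\<lambda>w. w - a) holomorphic_on UNIV" by (intro holomorphic_intros)
      ultimately show ?thesis
        by (intro exI[of _ "\<lambda>w. w - a"] conjI ballI) auto
    qed
    then obtain h where h: "h holomorphic_on UNIV" "\<And>w. w \<in> ball 0 1 \<Longrightarrow> h w \<noteq> 0"
      "\<And>w. w \<in> cball 0 1 \<Longrightarrow> norm (w - a) \<le> norm (h w)"
      "\<And>w. w \<in> sphere 0 1 \<Longrightarrow> norm (w - a) = norm (h w)"
      by blast
    have PQ: "norm (poly P w) = norm (w - a) * norm (poly Q w)" for w
    proof -
      have "poly P w = (w - a) * poly Q w" by (simp add: P algebra_simps)
      then show ?thesis by (simp only: norm_mult)
    qed
    show ?thesis
    proof (intro exI[of _ "\<lambda>w. h w * G w"] conjI ballI)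
      show "(\<lambda>w. h w * G w) holomorphic_on UNIV" using G h by (intro holomorphic_intros)
      show "h w * G w \<noteq> 0" if "w \<in> ball 0 1" for w using G(2) h(2) that by simp
      show "norm (poly P w) \<le> norm (h w * G w)" if "w \<in> cball 0 1" for w
        unfolding PQ norm_mult using G(3) h(3) that by (intro mult_mono) auto
      show "norm (poly P w) = norm (h w * G w)" if "w \<in> sphere 0 1" for w
        unfolding PQ norm_mult using G(4) h(4) that by simp
    qed
  qed
qed

text \<open>The majorant from \<open>poly_zero_free_majorant\<close> may vanish on the circle, so it
  is zero-free on a disc of radius above 1 only after a dilation. It has the same mean over the
  circle as the polynomial and is at least as large in modulus at \<open>u\<close>.\<close>

lemma submean_poly:
  assumes q: "q > 0"
  shows "submean q (poly P)"
proof (cases "P = 0")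
  case True
  then show ?thesis by (simp add: submean_def)
next
  case False
  then obtain G where G: "G holomorphic_on UNIV" "\<And>w. w \<in> ball 0 1 \<Longrightarrow> G w \<noteq> 0"
      "\<And>w. w \<in> cball 0 1 \<Longrightarrow> norm (poly P w) \<le> norm (G w)"
      "\<And>w. w \<in> sphere 0 1 \<Longrightarrow> norm (poly P w) = norm (G w)"
    using poly_zero_free_majorant by blast
  \<comment> \<open>The offset 2 keeps \<open>r 0\<close> positive, so that \<open>1 / r n\<close>
    is a radius above 1.\<close>
  define r where "r = (\<lambda>n::nat. 1 - 1 / real (n + 2))"
  have r: "0 < r n" "r n < 1" for n by (auto simp: r_def field_simps)
  have contG: "continuous_on S G" for S
    using holomorphic_on_imp_continuous_on[OF G(1)] continuous_on_subset by blast
  obtain B where B: "\<And>w. w \<in> cball 0 1 \<Longrightarrow> norm (G w) \<le> B"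
    using compact_imp_bounded[OF compact_continuous_image[OF contG compact_cball]]
    unfolding bounded_iff by blast
  have rw: "norm (of_real (r n) * w) \<le> 1" if "norm w \<le> 1" for n and w :: complex
    using r[of n] that by (simp add: norm_mult mult_le_one)
  have "submean q G"
  proof (rule submean_limit[where F = "\<lambda>n w. G (of_real (r n) * w)" and B = B])
    fix n
    show "submean q (\<lambda>w. G (of_real (r n) * w))"
    proof (rule submean_zero_free[where R = "1 / r n"])
      show "(\<lambda>w. G (of_real (r n) * w)) holomorphic_on ball 0 (1 / r n)"
        by (rule holomorphic_on_compose_gen[OF _ G(1), unfolded o_def]) (auto intro!: holomorphic_intros)
      show "G (of_real (r n) * w) \<noteq> 0" if "w \<in> ball 0 (1 / r n)" for w
        using that r[of n] by (intro G(2)) (auto simp: norm_mult field_simps)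
    qed (use r[of n] in auto)
    show "continuous_on (cball 0 1) (\<lambda>w. G (of_real (r n) * w))"
      by (rule continuous_on_compose2[OF contG[of UNIV]]) (auto intro!: continuous_intros)
    show "norm (G (of_real (r n) * w)) \<le> B" if "norm w \<le> 1" for w
      using B rw[OF that] by auto
  next
    fix w :: complex
    have "r \<longlonglongrightarrow> 1 - 0"
      unfolding r_def by (intro tendsto_intros LIMSEQ_ignore_initial_segment[OF lim_inverse_n'])
    then have "(\<lambda>n. of_real (r n) * w) \<longlonglongrightarrow> of_real 1 * w"
      by (intro tendsto_intros) simp
    then show "(\<lambda>n. G (of_real (r n) * w)) \<longlonglongrightarrow> G w"
      by (intro continuous_on_tendsto_compose[OF contG[of UNIV]]) auto
  qed (rule q)
  then have "norm (G u) powr q \<le> (1 + norm u) / (1 - norm u) * (LINT \<zeta>|circle_measure. norm (poly P \<zeta>) powr q)"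
    if "norm u < 1" for u
    using that G(4) Bochner_Integration.integral_cong[of circle_measure circle_measure
        "\<lambda>\<zeta>. norm (poly P \<zeta>) powr q" "\<lambda>\<zeta>. norm (G \<zeta>) powr q"] by (auto simp: submean_def)
  moreover have "norm (poly P u) powr q \<le> norm (G u) powr q" if "norm u < 1" for u
    using that q by (intro powr_mono2 G(3)) auto
  ultimately show ?thesis
    unfolding submean_def using order.trans by blast
qed

text \<open>The detour through Taylor polynomials makes the number of zeros finite, so they can be
  reflected one at a time by induction on the degree.\<close>

lemma submean_holomorphic:
  assumes F: "F holomorphic_on ball 0 R" and R: "R > 1" and q: "q > 0"
  shows "submean q F"
proof -
  define a where "a = (\<lambda>k. (deriv ^^ k) F 0 / fact k)"
  define P where "P = (\<lambda>n. \<Sum>k<n. monom (a k) k)"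
  have P: "poly (P n) w = (\<Sum>k<n. a k * w ^ k)" for n w
    by (simp add: P_def poly_sum poly_monom)
  have sums: "(\<lambda>k. a k * w ^ k) sums F w" if "norm w < R" for w
    using holomorphic_power_series[OF F, of w] that by (simp add: a_def)
  \<comment> \<open>Convergence at a point of modulus above 1 makes the coefficients absolutely
    summable; their sum is the bound required for dominated convergence.\<close>
  define \<rho> where "\<rho> = (1 + R) / 2"
  have \<rho>: "1 < \<rho>" "\<rho> < R" using R by (auto simp: \<rho>_def)
  have "summable (\<lambda>k. a k * of_real \<rho> ^ k)"
    using sums[of "of_real \<rho>"] \<rho> by (auto simp: sums_iff)
  then have s1: "summable (\<lambda>k. norm (a k))"
    using powser_insidea[of a "of_real \<rho>" 1] \<rho> by simp
  show ?thesis
  proof (rule submean_limit[where F = "\<lambda>n. poly (P n)" and B = "\<Sum>k. norm (a k)"])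
    show "(\<lambda>n. poly (P n) w) \<longlonglongrightarrow> F w" if "norm w \<le> 1" for w
      using sums[of w] that R unfolding P sums_def by auto
    show "norm (poly (P n) w) \<le> (\<Sum>k. norm (a k))" if "norm w \<le> 1" for n w
    proof -
      have "norm (poly (P n) w) \<le> (\<Sum>k<n. norm (a k * w ^ k))"
        unfolding P by (rule norm_sum)
      also have "\<dots> \<le> (\<Sum>k<n. norm (a k))"
        using that by (intro sum_mono) (auto simp: norm_mult norm_power mult_left_le power_le_one)
      also have "\<dots> \<le> (\<Sum>k. norm (a k))"
        using s1 by (intro sum_le_suminf) auto
      finally show ?thesis .
    qed
  qed (use q in \<open>auto intro: submean_poly continuous_intros\<close>)
qed

subsection \<open>Oscillation on the circle\<close>

text \<open>On the compact set where \<open>F\<close> is nonnegative, \<open>G\<close> has a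
  positive minimum, and the maximum of \<open>F\<close> divided by it serves as \<open>C\<close>.
  Elsewhere \<open>F\<close> is negative and \<open>G\<close> is not.\<close>

lemma compact_dominated:
  fixes F G :: "'a::topological_space \<Rightarrow> real"
  assumes K: "compact K" and F: "continuous_on K F" and G: "continuous_on K G"
    and nonneg: "\<And>x. x \<in> K \<Longrightarrow> G x \<ge> 0" and zero: "\<And>x. x \<in> K \<Longrightarrow> G x = 0 \<Longrightarrow> F x < 0"
  shows "\<exists>C\<ge>0. \<forall>x\<in>K. F x \<le> C * G x"
proof -
  define L where "L = {x \<in> K. 0 \<le> F x}"
  have "compact L"
  proof -
    obtain T where "closed T" "L = T \<inter> K"
      using continuous_closedin_preimage[OF F closed_atLeast[of 0]] K
      unfolding closedin_closed L_def vimage_def by (auto simp: Int_def conj_commute)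
    then show ?thesis using K by (simp add: compact_Int_closed Int_commute)
  qed
  show ?thesis
  proof (cases "L = {}")
    case True
    then show ?thesis using nonneg by (intro exI[of _ 0]) (force simp: L_def)
  next
    case False
    have sub: "L \<subseteq> K" by (auto simp: L_def)
    obtain a where a: "a \<in> L" "\<And>x. x \<in> L \<Longrightarrow> G a \<le> G x"
      using continuous_attains_inf[OF \<open>compact L\<close> False continuous_on_subset[OF G sub]] by auto
    obtain b where b: "b \<in> L" "\<And>x. x \<in> L \<Longrightarrow> F x \<le> F b"
      using continuous_attains_sup[OF \<open>compact L\<close> False continuous_on_subset[OF F sub]] by auto
    have Ga: "G a > 0" using a(1) zero[of a] nonneg[of a] by (force simp: L_def)
    have Fb: "F b \<ge> 0" using b(1) by (simp add: L_def)
    show ?thesis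
    proof (intro exI[of _ "F b / G a"] conjI ballI)
      show "F b / G a \<ge> 0" using Ga Fb by simp
      fix x assume x: "x \<in> K"
      show "F x \<le> F b / G a * G x"
      proof (cases "x \<in> L")
        case True
        have "F x \<le> F b / G a * G a" using b(2)[OF True] Ga by simp
        also have "\<dots> \<le> F b / G a * G x" using a(2)[OF True] Ga Fb by (intro mult_left_mono) auto
        finally show ?thesis .
      next
        case False
        then show ?thesis using x Ga Fb nonneg[of x] by (force simp: L_def intro: order.trans[of _ 0])
      qed
    qed
  qed
qed

lemma continuous_on_norm_powr:
  fixes h :: "'a::topological_space \<Rightarrow> 'b::real_normed_vector" and q :: real
  assumes "continuous_on S h" "q > 0"
  shows "continuous_on S (\<lambda>w. norm (h w) powr q)"
  using assms by (intro continuous_on_powr' continuous_on_norm continuous_on_const) auto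

text \<open>The substitute for the triangle inequality, valid also for exponents below 1.\<close>

lemma norm_add_powr_le:
  fixes x y :: "'a::real_normed_vector"
  assumes "p \<ge> 0"
  shows "norm (x + y) powr p \<le> 2 powr p * (norm x powr p + norm y powr p)"
proof -
  have "norm (x + y) powr p \<le> (2 * max (norm x) (norm y)) powr p"
    using norm_triangle_ineq[of x y] by (intro powr_mono2 assms) auto
  also have "\<dots> = 2 powr p * max (norm x) (norm y) powr p"
    by (simp add: powr_mult)
  also have "\<dots> \<le> 2 powr p * (norm x powr p + norm y powr p)"
    by (intro mult_left_mono) (auto simp: max_def)
  finally show ?thesis .
qed

text \<open>Equality of \<open>|w| = 1\<close> and \<open>|1 + w| = 2\<close> forces \<open>w = 1\<close>; both deficits on the right
  are controlled by submean inequalities.\<close>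

lemma oscillation_pointwise:
  fixes q \<epsilon> :: real
  assumes q: "q > 0" and \<epsilon>: "\<epsilon> > 0"
  obtains B C where "B \<ge> 0" "C \<ge> 0"
    "\<And>w::complex. norm (w - 1) powr q
       \<le> \<epsilon> + B * (1 - norm ((1 + w) / 2) powr q) + C * (norm w powr (q / 2) - 1)^2"
proof -
  note cont = continuous_on_norm_powr[OF _ q] continuous_on_norm_powr[of _ _ "q / 2", OF _ half_gt_zero[OF q]]
  have le1: "norm ((1 + w) / 2) \<le> 1" if "norm w = 1" for w :: complex
    using norm_triangle_ineq[of 1 w] that by (simp add: norm_divide)
  have eq1: "w = 1" if "norm w = 1" "norm ((1 + w) / 2) powr q = 1" for w :: complex
  proof -
    have "norm ((1 + w) / 2) = 1"
      using that(2) q powr_eq_one_iff_gen by (metis norm_ge_zero order_le_less powr_0 powr_one_gt_zero_iff powr_zero_eq_one zero_neq_one powr_eq_0_iff)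
    then have "(1 + Re w) ^ 2 + Im w ^ 2 = 4"
      using cmod_power2[of "1 + w"] by (simp add: norm_divide)
    moreover have "Re w ^ 2 + Im w ^ 2 = 1" using cmod_power2[of w] that(1) by simp
    ultimately have "Re w = 1" "Re w ^ 2 + Im w ^ 2 = 1" by (simp_all add: power2_eq_square algebra_simps)
    then show ?thesis by (auto simp: complex_eq_iff)
  qed
  have c1: "continuous_on S (\<lambda>w::complex. norm ((1 + w) / 2) powr q)"
    and c2: "continuous_on S (\<lambda>w::complex. norm (w - 1) powr q)"
    and c3: "continuous_on S (\<lambda>w::complex. norm w powr (q / 2))" for S
    by (intro cont continuous_intros; simp)+
  \<comment> \<open>On the circle the last term vanishes, so \<open>B\<close> is chosen there first,
    using only half of \<open>\<epsilon>\<close>. The other half provides the strict inequality that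
    the choice of \<open>C\<close> on a disc requires.\<close>
  have "\<exists>B\<ge>0. \<forall>w\<in>sphere (0::complex) 1.
      norm (w - 1) powr q - \<epsilon> / 2 \<le> B * (1 - norm ((1 + w) / 2) powr q)"
  proof (rule compact_dominated)
    show "0 \<le> 1 - norm ((1 + w) / 2) powr q" if "w \<in> sphere 0 1" for w :: complex
      using le1[of w] that q by (auto intro: powr_le1)
    show "norm (w - 1) powr q - \<epsilon> / 2 < 0" if "w \<in> sphere 0 1" "1 - norm ((1 + w) / 2) powr q = 0" for w :: complex
      using eq1[of w] that \<epsilon> by simp
  qed (intro continuous_intros c1 c2 compact_sphere)+
  then obtain B where B: "B \<ge> 0" "\<And>w::complex. w \<in> sphere 0 1 \<Longrightarrow>
      norm (w - 1) powr q - \<epsilon> / 2 \<le> B * (1 - norm ((1 + w) / 2) powr q)"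
    by blast
  \<comment> \<open>Beyond this radius \<open>norm w powr (q / 2)\<close> is at least 2, so its
    distance to 1 is at least half of itself and the square in the last term is at least
    \<open>norm w powr q / 4\<close>.\<close>
  define R where "R = 4 powr (1 / q)"
  have "4 powr (1 / q) \<ge> (1::real)" using q by (intro ge_one_powr_ge_zero) auto
  then have R: "R \<ge> 1" "R powr q = 4" using q by (auto simp: R_def powr_powr)
  have "\<exists>C\<ge>0. \<forall>w\<in>cball (0::complex) R.
      norm (w - 1) powr q - \<epsilon> - B * (1 - norm ((1 + w) / 2) powr q) \<le> C * (norm w powr (q / 2) - 1)^2"
  proof (rule compact_dominated)
    show "norm (w - 1) powr q - \<epsilon> - B * (1 - norm ((1 + w) / 2) powr q) < 0"
      if "w \<in> cball 0 R" "(norm w powr (q / 2) - 1)\<^sup>2 = 0" for w :: complex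
    proof -
      have *: "norm w powr (q / 2) = 1" using that by simp
      then have "(norm w powr (q / 2)) powr (2 / q) = 1" by simp
      then have "norm w powr 1 = 1" using q by (simp add: powr_powr)
      then have "norm w = 1" by simp
      then show ?thesis using B(2)[of w] \<epsilon> by simp
    qed
    show "0 \<le> (norm w powr (q / 2) - 1)\<^sup>2" for w :: complex by simp
  qed (intro continuous_intros c1 c2 c3 compact_cball)+
  then obtain C where C: "C \<ge> 0" "\<And>w::complex. w \<in> cball 0 R \<Longrightarrow>
      norm (w - 1) powr q - \<epsilon> - B * (1 - norm ((1 + w) / 2) powr q) \<le> C * (norm w powr (q / 2) - 1)^2"
    by blast
  \<comment> \<open>The added summand covers \<open>norm w > R\<close>, where the oscillation and
    the \<open>B\<close> term together are at most
    \<open>(2 powr q + B) * norm w powr q\<close>.\<close>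
  define C' where "C' = C + 4 * (2 powr q + B)"
  have C': "C' \<ge> C" "C' \<ge> 4 * (2 powr q + B)" "C' \<ge> 0" using C(1) B(1) by (auto simp: C'_def)
  show thesis
  proof (rule that[of B C'])
    fix w :: complex
    show "norm (w - 1) powr q \<le> \<epsilon> + B * (1 - norm ((1 + w) / 2) powr q) + C' * (norm w powr (q / 2) - 1)^2"
    proof (cases "norm w \<le> R")
      case True
      have "C * (norm w powr (q / 2) - 1)^2 \<le> C' * (norm w powr (q / 2) - 1)^2"
        using C' by (intro mult_right_mono) auto
      then show ?thesis using C(2)[of w] True by auto
    next
      case False
      then have w: "norm w \<ge> 1" "norm w > R" using R by auto
      have "R powr (q / 2) \<le> norm w powr (q / 2)" using w R q by (intro powr_mono2) auto
      moreover have "R powr (q/2) * R powr (q/2) = 4"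
        using powr_add[of R "q/2" "q/2"] R by simp
      then have "(R powr (q/2))^2 = 2^2" by (simp add: power2_eq_square)
      then have "R powr (q/2) = 2" by (rule power2_eq_imp_eq) auto
      ultimately have 2: "norm w powr (q / 2) \<ge> 2" by simp
      have "(norm w powr (q / 2) - 1)^2 \<ge> (norm w powr (q / 2) / 2)^2"
        using 2 by (intro power_mono) auto
      also have "(norm w powr (q / 2) / 2)^2 = norm w powr q / 4"
        using powr_add[of "norm w" "q/2" "q/2"] by (simp add: power2_eq_square)
      finally have sq: "norm w powr q / 4 \<le> (norm w powr (q / 2) - 1)^2" .
      have "norm (w - 1) \<le> 2 * norm w" using norm_triangle_ineq4[of w 1] w by simp
      then have "norm (w - 1) powr q \<le> (2 * norm w) powr q" using q by (intro powr_mono2) auto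
      then have a: "norm (w - 1) powr q \<le> 2 powr q * norm w powr q" by (simp add: powr_mult)
      have "norm ((1 + w) / 2) \<le> norm w" using norm_triangle_ineq[of 1 w] w by (simp add: norm_divide)
      then have b: "norm ((1 + w) / 2) powr q \<le> norm w powr q" using q by (intro powr_mono2) auto
      have "norm (w - 1) powr q + B * norm ((1 + w) / 2) powr q \<le> (2 powr q + B) * norm w powr q"
        using a mult_left_mono[OF b B(1)] by (simp add: algebra_simps)
      also have "\<dots> = 4 * (2 powr q + B) * (norm w powr q / 4)" by simp
      also have "\<dots> \<le> C' * (norm w powr (q / 2) - 1)^2"
        using sq C' by (intro mult_mono) auto
      finally show ?thesis using \<epsilon> B(1) by (simp add: algebra_simps)
    qed
  qed (use B C' in auto)
qed

text \<open>After division by \<open>F 0\<close>, \<open>oscillation_pointwise\<close> is integrated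
  with \<open>w = h \<zeta>\<close>. The submean property of \<open>(1 + h) / 2\<close> makes the
  \<open>B\<close> term nonpositive, and that of \<open>h\<close> with exponent \<open>q / 2\<close>
  gives \<open>J \<ge> 1\<close>, hence \<open>I - 2 * J + 1 \<le> I - 1\<close>.\<close>

lemma circle_oscillation_le:
  fixes q \<epsilon> :: real
  assumes q: "q > 0" and \<epsilon>: "\<epsilon> > 0"
  obtains C where "C \<ge> 0"
    "\<And>F R. F holomorphic_on ball 0 R \<Longrightarrow> R > 1 \<Longrightarrow>
      (LINT \<zeta>|circle_measure. norm (F \<zeta> - F 0) powr q) \<le>
        \<epsilon> * norm (F 0) powr q + C * ((LINT \<zeta>|circle_measure. norm (F \<zeta>) powr q) - norm (F 0) powr q)"
proof -
  obtain B C where BC: "B \<ge> 0" "C \<ge> 0"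
    and pw: "\<And>w::complex. norm (w - 1) powr q
       \<le> \<epsilon> + B * (1 - norm ((1 + w) / 2) powr q) + C * (norm w powr (q / 2) - 1)^2"
    using oscillation_pointwise[OF q \<epsilon>] by blast
  show thesis
  \<comment> \<open>The added 1 settles the case \<open>F 0 = 0\<close>, where the oscillation is
    the mean itself.\<close>
  proof (rule that[of "C + 1"])
    show "C + 1 \<ge> 0" using BC by simp
    fix F :: "complex \<Rightarrow> complex" and R :: real
    assume F: "F holomorphic_on ball 0 R" and R: "R > 1"
    have sm: "norm (h 0) powr b \<le> (LINT \<zeta>|circle_measure. norm (h \<zeta>) powr b)"
      if "h holomorphic_on ball 0 R" "b > 0" for h b
      using submean_holomorphic[OF that(1) R that(2)] unfolding submean_def by (auto dest!: spec[of _ 0])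
    have int: "integrable circle_measure (\<lambda>\<zeta>. norm (h \<zeta>) powr b)"
      if "h holomorphic_on ball 0 R" "b > 0" for h b
    proof -
      have "continuous_on (sphere 0 1) h"
        using R by (intro holomorphic_on_imp_continuous_on[OF holomorphic_on_subset[OF that(1)]]) auto
      then show ?thesis
        using that by (intro integrable_circle_continuous continuous_on_norm_powr)
    qed
    show "(LINT \<zeta>|circle_measure. norm (F \<zeta> - F 0) powr q) \<le>
        \<epsilon> * norm (F 0) powr q + (C + 1) * ((LINT \<zeta>|circle_measure. norm (F \<zeta>) powr q) - norm (F 0) powr q)"
    proof (cases "F 0 = 0")
      case True
      have "1 * (LINT \<zeta>|circle_measure. norm (F \<zeta>) powr q) \<le> (C + 1) * (LINT \<zeta>|circle_measure. norm (F \<zeta>) powr q)"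
        using BC by (intro mult_right_mono Bochner_Integration.integral_nonneg) auto
      then show ?thesis using True by simp
    next
      case False
      define h where "h = (\<lambda>w. F w / F 0)"
      have h: "h holomorphic_on ball 0 R" "h 0 = 1"
        unfolding h_def using False by (auto intro!: holomorphic_intros F)
      have h': "(\<lambda>w. (1 + h w) / 2) holomorphic_on ball 0 R" "(\<lambda>w. h w - 1) holomorphic_on ball 0 R"
        by (intro holomorphic_intros h(1) | simp)+
      define I where "I = (LINT \<zeta>|circle_measure. norm (h \<zeta>) powr q)"
      define J where "J = (LINT \<zeta>|circle_measure. norm (h \<zeta>) powr (q / 2))"
      define K where "K = (LINT \<zeta>|circle_measure. norm ((1 + h \<zeta>) / 2) powr q)"
      have J: "J \<ge> 1" and I: "I \<ge> 1" and K: "K \<ge> 1"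
        using sm[OF h(1), of "q/2"] sm[OF h(1) q] sm[OF h'(1) q] h(2) q by (auto simp: I_def J_def K_def)
      have half: "(norm w powr (q / 2) - 1)^2 = norm w powr q - 2 * norm w powr (q / 2) + 1" for w :: complex
        using powr_add[of "norm w" "q/2" "q/2"] by (simp add: power2_eq_square algebra_simps)
      have intK: "integrable circle_measure (\<lambda>\<zeta>. (norm (1 + h \<zeta>) / 2) powr q)"
        using int[OF h'(1) q] by (simp add: norm_divide)
      have "(LINT \<zeta>|circle_measure. norm (h \<zeta> - 1) powr q)
        \<le> (LINT \<zeta>|circle_measure. \<epsilon> + B * (1 - norm ((1 + h \<zeta>) / 2) powr q)
              + C * (norm (h \<zeta>) powr q - 2 * norm (h \<zeta>) powr (q / 2) + 1))"
        using pw unfolding half using q h h' intK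
        by (intro integral_mono) (auto intro!: Bochner_Integration.integrable_add
            Bochner_Integration.integrable_diff integrable_mult_right int)
      also have "\<dots> = \<epsilon> + B * (1 - K) + C * (I - 2 * J + 1)"
        using q h h' intK unfolding I_def J_def K_def
        by (simp add: Bochner_Integration.integral_add Bochner_Integration.integral_diff int
            Bochner_Integration.integrable_diff Bochner_Integration.integrable_add)
      also have "\<dots> \<le> \<epsilon> + 0 + (C + 1) * (I - 1)"
      proof (intro add_mono)
        show "B * (1 - K) \<le> 0" using BC K by (simp add: mult_nonneg_nonpos)
        show "C * (I - 2 * J + 1) \<le> (C + 1) * (I - 1)"
        proof -
          have "C * (I - 2 * J + 1) \<le> C * (I - 1)" using J BC by (intro mult_left_mono) auto
          also have "\<dots> \<le> (C + 1) * (I - 1)" using I by (intro mult_right_mono) auto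
          finally show ?thesis .
        qed
      qed simp
      finally have main: "(LINT \<zeta>|circle_measure. norm (h \<zeta> - 1) powr q) \<le> \<epsilon> + (C + 1) * (I - 1)" by simp
      have e1: "(LINT \<zeta>|circle_measure. norm (F \<zeta> - F 0) powr q)
          = norm (F 0) powr q * (LINT \<zeta>|circle_measure. norm (h \<zeta> - 1) powr q)"
      proof -
        have "F \<zeta> - F 0 = F 0 * (h \<zeta> - 1)" for \<zeta> using False by (simp add: h_def field_simps)
        then show ?thesis by (simp add: norm_mult powr_mult)
      qed
      have e2: "(LINT \<zeta>|circle_measure. norm (F \<zeta>) powr q) = norm (F 0) powr q * I"
      proof -
        have "F \<zeta> = F 0 * h \<zeta>" for \<zeta> using False by (simp add: h_def)
        then have "norm (F \<zeta>) powr q = norm (F 0) powr q * norm (h \<zeta>) powr q" for \<zeta>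
          by (metis norm_mult powr_mult norm_ge_zero)
        then have "(LINT \<zeta>|circle_measure. norm (F \<zeta>) powr q)
            = (LINT \<zeta>|circle_measure. norm (F 0) powr q * norm (h \<zeta>) powr q)"
          by (rule Bochner_Integration.integral_cong[OF refl])
        then show ?thesis by (simp add: I_def)
      qed
      show ?thesis
        using mult_left_mono[OF main, of "norm (F 0) powr q"] unfolding e1 e2 by (simp add: algebra_simps)
    qed
  qed
qed

subsection \<open>Holomorphic functions on the ball\<close>

lemma holo_ball_derivative:
  assumes "f \<in> holo_ball" "z \<in> ball 0 1"
  obtains D where "(f has_derivative D) (at z)" "\<And>c v. D (c *s v) = c * D v"
  using assms unfolding holo_ball_def holomorphic_sev_def by blast

lemma continuous_on_holo_ball:
  assumes "f \<in> holo_ball"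
  shows "continuous_on (ball 0 1) f"
  by (intro continuous_at_imp_continuous_on ballI)
    (use assms in \<open>metis holo_ball_derivative has_derivative_continuous\<close>)

lemma has_field_derivative_line:
  fixes f :: "complex ^ 'n \<Rightarrow> complex"
  assumes D: "(f has_derivative D) (at (a + w *s b))" "\<And>c v. D (c *s v) = c * D v"
  shows "((\<lambda>w. f (a + w *s b)) has_field_derivative D b) (at w)"
proof -
  have "linear (\<lambda>w. w *s b)"
    by (rule linearI) (simp_all add: vec_eq_iff algebra_simps)
  then have "((\<lambda>w. a + w *s b) has_derivative (\<lambda>w. w *s b)) (at w)"
    by (auto intro!: derivative_eq_intros linear_imp_has_derivative)
  from has_derivative_compose[OF this D(1)]
  show ?thesis
    by (simp add: has_field_derivative_def D(2) mult.commute[of _ "D b"])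
qed

lemma line_holomorphic:
  assumes f: "f \<in> holo_ball" and sub: "\<And>w. w \<in> S \<Longrightarrow> a + w *s b \<in> ball 0 1"
  shows "(\<lambda>w. f (a + w *s b)) holomorphic_on S"
  unfolding holomorphic_on_def
proof
  fix w assume "w \<in> S"
  then obtain D where "(f has_derivative D) (at (a + w *s b))" "\<And>c v. D (c *s v) = c * D v"
    using holo_ball_derivative[OF f sub] by blast
  then have "(\<lambda>w. f (a + w *s b)) field_differentiable (at w)"
    using has_field_derivative_line field_differentiable_def by blast
  then show "(\<lambda>w. f (a + w *s b)) field_differentiable (at w within S)"
    by (rule field_differentiable_at_within)
qed

lemma slice_holomorphic:
  assumes "f \<in> holo_ball" "norm z \<le> 1"
  shows "(\<lambda>w. f (w *s z)) holomorphic_on ball 0 1"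
proof -
  have "0 + w *s z \<in> ball 0 1" if "w \<in> ball 0 1" for w
    using that assms(2) mult_left_le[of "norm z" "norm w"] by simp
  from line_holomorphic[OF assms(1), of "ball 0 1" 0 z, OF this] show ?thesis by simp
qed

text \<open>The partial derivatives are the values \<open>D (axis k 1)\<close>, and complex
  linearity reassembles them along the basis expansion of \<open>z\<close>.\<close>

lemma radial_deriv_eq:
  fixes f :: "complex ^ 'n \<Rightarrow> complex"
  assumes D: "(f has_derivative D) (at z)" "\<And>c v. D (c *s v) = c * D v"
  shows "radial_deriv f z = D z"
proof -
  have "partial_deriv k f z = D (axis k 1)" for k
  proof -
    have "(\<chi> j. if j = k then w else z $ j) = (z - (z $ k) *s axis k 1) + w *s axis k 1" for w
      by (auto simp: vec_eq_iff axis_def)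
    moreover have "(z - (z $ k) *s axis k 1) + (z $ k) *s axis k 1 = z" by simp
    ultimately show ?thesis
      unfolding partial_deriv_def
      using has_field_derivative_line[of f D "z - (z $ k) *s axis k 1" "z $ k" "axis k 1"] D
      by (simp add: DERIV_imp_deriv)
  qed
  then have "radial_deriv f z = (\<Sum>k\<in>UNIV. D (z $ k *s axis k 1))"
    by (simp add: radial_deriv_def D(2))
  also have "\<dots> = D (\<Sum>k\<in>UNIV. z $ k *s axis k 1)"
    using has_derivative_linear[OF D(1)] by (simp add: linear_sum)
  finally show ?thesis by (simp add: basis_expansion)
qed

lemma radial_deriv_slice:
  assumes f: "f \<in> holo_ball" and w: "w *s z \<in> ball 0 1"
  shows "radial_deriv f (w *s z) = w * deriv (\<lambda>w. f (w *s z)) w"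
proof -
  obtain D where D: "(f has_derivative D) (at (w *s z))" "\<And>c v. D (c *s v) = c * D v"
    using holo_ball_derivative[OF f w] by blast
  have "deriv (\<lambda>w. f (w *s z)) w = D z"
    using has_field_derivative_line[of f D 0 w z] D by (simp add: DERIV_imp_deriv)
  then show ?thesis using radial_deriv_eq[OF D] D(2) by simp
qed

text \<open>Along a ray the radial derivative carries a factor \<open>t\<close>, which cancels the
  singular factor \<open>1 / t\<close>; the new integrand is continuous on the closed
  interval.\<close>

lemma volterra_eq:
  assumes g: "g \<in> holo_ball" and z: "norm z < 1"
  shows "volterra g f z = integral {0..1} (\<lambda>t. f (of_real t *s z) * deriv (\<lambda>w. g (w *s z)) (of_real t))"
  unfolding volterra_def
\<comment> \<open>At \<open>t = 0\<close> the original integrand is 0, as a quotient by zero, and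
  may differ from the new one; a single point is negligible.\<close>
proof (rule integral_spike[of "{0}"])
  fix t :: real assume t: "t \<in> {0..1} - {0}"
  then have "of_real t *s z \<in> ball 0 1" using z mult_left_le_one_le[of "norm z" t] by simp
  from radial_deriv_slice[OF g this] t
  show "f (of_real t *s z) * deriv (\<lambda>w. g (w *s z)) (of_real t) = f (t *\<^sub>R z) * radial_deriv g (t *\<^sub>R z) / of_real t"
    by (simp add: scaleR_eq_smult)
qed simp

lemma slice_holomorphic_gt_1:
  assumes g: "g \<in> holo_ball" and z: "norm z < 1"
  obtains R where "R > 1" "(\<lambda>w. g (w *s z)) holomorphic_on ball 0 R"
proof (cases "z = 0")
  case True
  then have "(\<lambda>w. g (w *s z)) = (\<lambda>w. g 0)" by simp
  then show thesis using that[of 2] by simp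
next
  case False
  have "0 + w *s z \<in> ball 0 1" if "w \<in> ball 0 (1 / norm z)" for w
    using that False by (simp add: pos_less_divide_eq)
  from line_holomorphic[OF g, of "ball 0 (1 / norm z)" 0 z, OF this]
  have "(\<lambda>w. g (w *s z)) holomorphic_on ball 0 (1 / norm z)" by simp
  moreover have "1 / norm z > 1" using False z by simp
  ultimately show thesis by (rule that[rotated])
qed

lemma continuous_on_real_line_smult:
  assumes f: "f \<in> holo_ball" and z: "norm z < 1"
  shows "continuous_on {0..1} (\<lambda>t::real. f (of_real t *s z))"
proof (rule continuous_on_compose2[OF continuous_on_holo_ball[OF f]])
  show "(\<lambda>t. of_real t *s z) ` {0..1} \<subseteq> ball 0 1"
    using z mult_left_le_one_le[of "norm z"] by (force simp: image_subset_iff)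
qed (intro continuous_intros)

lemma continuous_on_deriv_slice:
  assumes g: "g \<in> holo_ball" and z: "norm z < 1"
  shows "continuous_on {0..1} (\<lambda>t::real. deriv (\<lambda>w. g (w *s z)) (of_real t))"
proof -
  obtain R where R: "R > 1" "(\<lambda>w. g (w *s z)) holomorphic_on ball 0 R"
    using slice_holomorphic_gt_1[OF g z] by blast
  have "continuous_on (ball 0 R) (deriv (\<lambda>w. g (w *s z)))"
    by (intro holomorphic_on_imp_continuous_on holomorphic_deriv R) auto
  then show ?thesis
    by (rule continuous_on_compose2) (use R(1) in \<open>auto intro!: continuous_intros\<close>)
qed

lemma volterra_integrable:
  assumes "g \<in> holo_ball" "f \<in> holo_ball" "norm z < 1"
  shows "(\<lambda>t::real. f (of_real t *s z) * deriv (\<lambda>w. g (w *s z)) (of_real t)) integrable_on {0..1}"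
  using assms by (intro integrable_continuous_real continuous_on_mult
      continuous_on_real_line_smult continuous_on_deriv_slice)

lemma volterra_add:
  assumes "g \<in> holo_ball" "f \<in> holo_ball" "h \<in> holo_ball" "norm z < 1"
  shows "volterra g (\<lambda>z. f z + h z) z = volterra g f z + volterra g h z"
  using assms volterra_integrable[of g f z] volterra_integrable[of g h z]
  by (simp add: volterra_eq distrib_right Henstock_Kurzweil_Integration.integral_add)

lemma volterra_cmult:
  assumes "g \<in> holo_ball" "f \<in> holo_ball" "norm z < 1"
  shows "volterra g (\<lambda>z. c * f z) z = c * volterra g f z"
  using assms volterra_integrable[of g f z]
  by (simp add: volterra_eq mult.assoc)

lemma holo_ball_const: "(\<lambda>_. c) \<in> holo_ball"
  unfolding holo_ball_def holomorphic_sev_def by (auto intro!: exI[of _ "\<lambda>_. 0"])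

lemma holo_ball_component: "(\<lambda>z. z $ i) \<in> holo_ball"
  unfolding holo_ball_def holomorphic_sev_def
  by (auto intro!: exI[of _ "\<lambda>v. v $ i"] bounded_linear_imp_has_derivative bounded_linear_vec_nth)

lemma holo_ball_add:
  fixes f h :: "complex ^ 'n \<Rightarrow> complex"
  assumes "f \<in> holo_ball" "h \<in> holo_ball"
  shows "(\<lambda>z. f z + h z) \<in> holo_ball"
  unfolding holo_ball_def holomorphic_sev_def mem_Collect_eq
proof
  fix z :: "complex ^ 'n" assume z: "z \<in> ball 0 1"
  obtain D E where "(f has_derivative D) (at z)" "\<And>c v. D (c *s v) = c * D v"
    "(h has_derivative E) (at z)" "\<And>c v. E (c *s v) = c * E v"
    using holo_ball_derivative[OF assms(1) z] holo_ball_derivative[OF assms(2) z] by metis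
  then show "\<exists>D. ((\<lambda>z. f z + h z) has_derivative D) (at z) \<and> (\<forall>c v. D (c *s v) = c * D v)"
    by (intro exI[of _ "\<lambda>v. D v + E v"]) (auto intro!: derivative_intros simp: algebra_simps)
qed

lemma holo_ball_mult:
  fixes f h :: "complex ^ 'n \<Rightarrow> complex"
  assumes "f \<in> holo_ball" "h \<in> holo_ball"
  shows "(\<lambda>z. f z * h z) \<in> holo_ball"
  unfolding holo_ball_def holomorphic_sev_def mem_Collect_eq
proof
  fix z :: "complex ^ 'n" assume z: "z \<in> ball 0 1"
  obtain D E where "(f has_derivative D) (at z)" "\<And>c v. D (c *s v) = c * D v"
    "(h has_derivative E) (at z)" "\<And>c v. E (c *s v) = c * E v"
    using holo_ball_derivative[OF assms(1) z] holo_ball_derivative[OF assms(2) z] by metis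
  then show "\<exists>D. ((\<lambda>z. f z * h z) has_derivative D) (at z) \<and> (\<forall>c v. D (c *s v) = c * D v)"
    by (intro exI[of _ "\<lambda>v. f z * E v + D v * h z"] conjI allI has_derivative_mult) (auto simp: algebra_simps)
qed

lemma holo_ball_power:
  assumes "f \<in> holo_ball"
  shows "(\<lambda>z. f z ^ k) \<in> holo_ball"
  by (induction k) (auto intro: holo_ball_const holo_ball_mult assms)

text \<open>Cauchy's estimate on the complex line through \<open>x\<close> in direction
  \<open>h\<close>: the disc of radius \<open>(r' - r) / norm h\<close> in the parameter stays in
  the ball of radius \<open>r'\<close>.\<close>

lemma holo_ball_derivative_bound:
  assumes f: "f \<in> holo_ball" and D: "(f has_derivative D) (at x)" "\<And>c v. D (c *s v) = c * D v"
    and x: "norm x < r" "r < r'" "r' < 1" and B: "\<And>z. z \<in> cball 0 r' \<Longrightarrow> norm (f z) \<le> B"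
  shows "norm (D h) \<le> B / (r' - r) * norm h"
proof (cases "h = 0")
  case True
  then show ?thesis using linear_0[OF has_derivative_linear[OF D(1)]] by simp
next
  case False
  define \<delta> where "\<delta> = (r' - r) / norm h"
  have \<delta>: "\<delta> > 0" "\<delta> * norm h = r' - r" using x False by (auto simp: \<delta>_def)
  have in1: "x + w *s h \<in> cball 0 r'" if "w \<in> cball 0 \<delta>" for w
  proof -
    have "norm (x + w *s h) \<le> norm x + norm w * norm h"
      using norm_triangle_ineq[of x "w *s h"] by simp
    also have "norm w * norm h \<le> \<delta> * norm h" using that by (intro mult_right_mono) auto
    finally show ?thesis using x \<delta> by simp
  qed
  have hol: "(\<lambda>w. f (x + w *s h)) holomorphic_on cball 0 \<delta>"
    using in1 x by (intro line_holomorphic[OF f]) force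
  have "norm ((deriv ^^ 1) (\<lambda>w. f (x + w *s h)) 0) \<le> fact 1 * B / \<delta> ^ 1"
  proof (rule Cauchy_inequality)
    show "(\<lambda>w. f (x + w *s h)) holomorphic_on ball 0 \<delta>" by (rule holomorphic_on_subset[OF hol]) auto
    show "continuous_on (cball 0 \<delta>) (\<lambda>w. f (x + w *s h))" by (rule holomorphic_on_imp_continuous_on[OF hol])
    show "norm (f (x + w *s h)) \<le> B" if "norm (0 - w) = \<delta>" for w
      using that by (intro B in1) simp
  qed (rule \<delta>)
  moreover have "deriv (\<lambda>w. f (x + w *s h)) 0 = D h"
    using has_field_derivative_line[of f D x 0 h] D by (simp add: DERIV_imp_deriv)
  ultimately show ?thesis using False x by (simp add: \<delta>_def)
qed

lemma deriv_slice_bound: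
  assumes f: "f \<in> holo_ball" and z: "norm z \<le> r" and r: "0 \<le> r" "r < r'" "r' < 1"
    and B: "\<And>z. z \<in> cball 0 r' \<Longrightarrow> norm (f z) \<le> B" and t: "0 \<le> t" "t \<le> 1"
  shows "norm (deriv (\<lambda>w. f (w *s z)) (of_real t)) \<le> 2 * B / (r' - r)"
proof -
  \<comment> \<open>\<open>holo_ball_derivative_bound\<close> requires a strict inequality, while
    \<open>norm z = r\<close> is allowed here; the intermediate radius costs the factor 2.\<close>
  define r'' where "r'' = (r + r') / 2"
  have r'': "r < r''" "r'' < r'" "r' - r'' = (r' - r) / 2" using r by (auto simp: r''_def field_simps)
  have tz: "norm (of_real t *s z) \<le> r"
    using mult_mono[of t 1 "norm z" r] t z r by simp
  obtain D where D: "(f has_derivative D) (at (of_real t *s z))" "\<And>c v. D (c *s v) = c * D v"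
    using holo_ball_derivative[OF f, of "of_real t *s z"] tz r by auto
  have "deriv (\<lambda>w. f (w *s z)) (of_real t) = D z"
    using has_field_derivative_line[of f D 0 "of_real t" z] D by (simp add: DERIV_imp_deriv)
  moreover have "norm (D z) \<le> B / (r' - r'') * norm z"
    using tz r'' r by (intro holo_ball_derivative_bound[OF f D _ _ _ B]) auto
  moreover have "B \<ge> 0" using order.trans[OF norm_ge_zero B[of 0]] r by auto
  then have "B / (r' - r'') * norm z \<le> B / (r' - r'') * 1"
    using z r r'' by (intro mult_left_mono) auto
  ultimately show ?thesis using r'' by (simp add: mult.commute)
qed

text \<open>Weierstrass' theorem. Cauchy's estimate for the differences \<open>F m - F n\<close>
  makes the derivatives uniformly Cauchy on a smaller ball, so the sequence can be differentiated
  termwise, and complex linearity passes to the limit.\<close>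

lemma holo_ball_limit:
  fixes F :: "nat \<Rightarrow> complex ^ 'n \<Rightarrow> complex"
  assumes F: "\<And>n. F n \<in> holo_ball"
    and lim: "\<And>r. r < 1 \<Longrightarrow> uniform_limit (cball 0 r) F f sequentially"
  shows "f \<in> holo_ball"
  unfolding holo_ball_def holomorphic_sev_def mem_Collect_eq
proof
  fix z0 :: "complex ^ 'n" assume z0: "z0 \<in> ball 0 1"
  define r where "r = (1 + norm z0) / 2"
  define r' where "r' = (1 + r) / 2"
  have r: "norm z0 < r" "r < r'" "r' < 1" using z0 by (auto simp: r_def r'_def field_simps)
  define S where "S = ball (0 :: complex ^ 'n) r"
  have z0S: "z0 \<in> S" using r by (simp add: S_def)
  define P where "P = (\<lambda>n x D. (F n has_derivative D) (at x) \<and> (\<forall>c v. D (c *s v) = c * D v))"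
  define D where "D = (\<lambda>n x. SOME D. P n x D)"
  have "P n x (D n x)" if "x \<in> S" for n x
  proof -
    have "x \<in> ball 0 1" using that r by (simp add: S_def)
    then have "\<exists>D. P n x D" using F[of n] by (simp only: holo_ball_def holomorphic_sev_def P_def mem_Collect_eq)
    then show ?thesis unfolding D_def by (rule someI_ex)
  qed
  then have D: "\<And>n x. x \<in> S \<Longrightarrow> (F n has_derivative D n x) (at x)"
    "\<And>n x c v. x \<in> S \<Longrightarrow> D n x (c *s v) = c * D n x v"
    unfolding P_def by blast+
  have cauchy: "\<exists>N. \<forall>m\<ge>N. \<forall>n\<ge>N. \<forall>x\<in>S. \<forall>h. norm (D m x h - D n x h) \<le> e * norm h" if "e > 0" for e
  proof -
    define e' where "e' = e * (r' - r)"
    have "e' > 0" using that r by (simp add: e'_def)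
    have "uniformly_Cauchy_on (cball 0 r') F"
      using uniformly_convergent_Cauchy lim[OF r(3)] uniformly_convergent_on_def by blast
    then obtain N where N: "\<And>x m n. x \<in> cball 0 r' \<Longrightarrow> m \<ge> N \<Longrightarrow> n \<ge> N \<Longrightarrow> dist (F m x) (F n x) < e'"
      using \<open>e' > 0\<close> unfolding uniformly_Cauchy_on_def by metis
    have "norm (D m x h - D n x h) \<le> e * norm h" if "m \<ge> N" "n \<ge> N" "x \<in> S" for m n x h
    proof -
      have "norm (D m x h - D n x h) \<le> e' / (r' - r) * norm h"
      proof (rule holo_ball_derivative_bound[where f = "\<lambda>z. F m z + (-1) * F n z" and D = "\<lambda>h. D m x h - D n x h" and x = x])
        show "(\<lambda>z. F m z + - 1 * F n z) \<in> holo_ball"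
          by (intro holo_ball_add holo_ball_mult holo_ball_const F)
        show "((\<lambda>z. F m z + - 1 * F n z) has_derivative (\<lambda>h. D m x h - D n x h)) (at x)"
          using has_derivative_diff[OF D(1) D(1), of x m n] that by simp
        show "norm (F m z + - 1 * F n z) \<le> e'" if "z \<in> cball 0 r'" for z
          using N[OF that \<open>m \<ge> N\<close> \<open>n \<ge> N\<close>] by (simp add: dist_norm)
      qed (use that r D(2) in \<open>auto simp: S_def algebra_simps\<close>)
      then show ?thesis using r by (simp add: e'_def)
    qed
    then show ?thesis by blast
  qed
  define D' where "D' = (\<lambda>x h. lim (\<lambda>n. D n x h))"
  have D': "(\<lambda>n. D n x h) \<longlonglongrightarrow> D' x h" if "x \<in> S" for x h
  proof -
    have "Cauchy (\<lambda>n. D n x h)"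
    proof (rule metric_CauchyI)
      fix e :: real assume e: "e > 0"
      define e2 where "e2 = e / (norm h + 1)"
      have pos: "norm h + 1 > 0" using norm_ge_zero[of h] by linarith
      then have "e2 > 0" using e by (simp add: e2_def)
      moreover have "e2 * norm h < e"
        using e pos by (simp add: e2_def divide_less_eq)
      ultimately show "\<exists>M. \<forall>m\<ge>M. \<forall>n\<ge>M. dist (D m x h) (D n x h) < e"
        using cauchy[of e2] that unfolding dist_norm by (meson order.strict_trans1)
    qed
    then show ?thesis unfolding D'_def by (simp add: Cauchy_convergent_iff convergent_LIMSEQ_iff)
  qed
  have "\<exists>g. \<forall>x\<in>S. (\<lambda>n. F n x) \<longlonglongrightarrow> g x \<and> (g has_derivative D' x) (at x within S)"
  proof (rule has_derivative_sequence[where f' = D])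
    show "convex S" by (simp add: S_def)
    show "(F n has_derivative D n x) (at x within S)" if "x \<in> S" for n x
      using D(1)[OF that] by (rule has_derivative_at_withinI)
    show "\<forall>\<^sub>F n in sequentially. \<forall>x\<in>S. \<forall>h. norm (D n x h - D' x h) \<le> e * norm h" if e: "e > 0" for e
    proof -
      obtain N where N: "\<And>m n x h. m \<ge> N \<Longrightarrow> n \<ge> N \<Longrightarrow> x \<in> S \<Longrightarrow> norm (D m x h - D n x h) \<le> e * norm h"
        using cauchy[OF e] by blast
      have "norm (D n x h - D' x h) \<le> e * norm h" if "n \<ge> N" "x \<in> S" for n x h
      proof (rule tendsto_upperbound)
        show "(\<lambda>m. norm (D n x h - D m x h)) \<longlonglongrightarrow> norm (D n x h - D' x h)"
          by (intro tendsto_intros D' that)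
        show "\<forall>\<^sub>F m in sequentially. norm (D n x h - D m x h) \<le> e * norm h"
          using N that by (auto simp: eventually_sequentially intro!: exI[of _ N])
      qed simp
      then show ?thesis by (auto simp: eventually_sequentially)
    qed
    show "z0 \<in> S" by (rule z0S)
    show "(\<lambda>n. F n z0) \<longlonglongrightarrow> f z0"
      using tendsto_uniform_limitI[OF lim[of r]] r by auto
  qed
  then obtain g where g: "\<And>x. x \<in> S \<Longrightarrow> (\<lambda>n. F n x) \<longlonglongrightarrow> g x"
    "\<And>x. x \<in> S \<Longrightarrow> (g has_derivative D' x) (at x within S)" by blast
  have fg: "g x = f x" if "x \<in> S" for x
  proof (rule LIMSEQ_unique[OF g(1)[OF that]])
    show "(\<lambda>n. F n x) \<longlonglongrightarrow> f x"
      using that r tendsto_uniform_limitI[OF lim[of r]] by (auto simp: S_def)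
  qed
  have "open S" by (simp add: S_def)
  have "(g has_derivative D' z0) (at z0)"
    using g(2)[OF z0S] at_within_open[OF z0S \<open>open S\<close>] by simp
  then have "(f has_derivative D' z0) (at z0)"
    by (rule has_derivative_transform_within_open[OF _ \<open>open S\<close> z0S]) (rule fg)
  moreover have "D' z0 (c *s v) = c * D' z0 v" for c v
  proof (rule LIMSEQ_unique[OF D'[OF z0S]])
    show "(\<lambda>n. D n z0 (c *s v)) \<longlonglongrightarrow> c * D' z0 v"
      unfolding D(2)[OF z0S] by (intro tendsto_intros D' z0S)
  qed
  ultimately show "\<exists>D. (f has_derivative D) (at z0) \<and> (\<forall>c v. D (c *s v) = c * D v)" by blast
qed

section \<open>Integral means and Hardy spaces\<close>

definition hardy_mean :: "real \<Rightarrow> (complex ^ 'n \<Rightarrow> complex) \<Rightarrow> real \<Rightarrow> real" where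
  "hardy_mean p f s = (LINT \<zeta>|sphere_measure. norm (f (of_real s *s \<zeta>)) powr p)"

lemma hardy_mean_nonneg: "hardy_mean p f s \<ge> 0"
  unfolding hardy_mean_def by (intro Bochner_Integration.integral_nonneg) auto

text \<open>Replaces the extended real supremum by a real bound on the \<open>p\<close>-th powers,
  so that roots do not appear in the later estimates.\<close>

lemma hardy_space_iff:
  fixes f :: "complex ^ 'n \<Rightarrow> complex"
  assumes p: "p > 0"
  shows "f \<in> hardy_space p \<longleftrightarrow> f \<in> holo_ball \<and> (\<exists>B. \<forall>s\<in>{0..<1}. hardy_mean p f s \<le> B)"
proof -
  have norm: "hardy_norm p f = (SUP s\<in>{0..<1}. ennreal (hardy_mean p f s powr (1 / p)))"
    by (simp add: hardy_norm_def hardy_mean_def scaleR_eq_smult)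
  have "hardy_norm p f < \<infinity>" if "\<forall>s\<in>{0..<1}. hardy_mean p f s \<le> B" for B
  proof -
    have "hardy_norm p f \<le> ennreal (B powr (1 / p))"
      unfolding norm using that p hardy_mean_nonneg
      by (intro SUP_least ennreal_leI powr_mono2) auto
    then show ?thesis by (simp add: order.strict_trans1)
  qed
  moreover have "\<exists>B. \<forall>s\<in>{0..<1}. hardy_mean p f s \<le> B" if fin: "hardy_norm p f < \<infinity>"
  proof -
    obtain C where C: "C \<ge> 0" "hardy_norm p f = ennreal C"
      using fin by (cases "hardy_norm p f") auto
    have "hardy_mean p f s \<le> C powr p" if "s \<in> {0..<1}" for s
    proof -
      have "ennreal (hardy_mean p f s powr (1 / p)) \<le> ennreal C"
        using that unfolding C(2)[symmetric] norm by (intro SUP_upper)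
      then have "hardy_mean p f s powr (1 / p) \<le> C" using C by (simp add: ennreal_le_iff)
      then have "(hardy_mean p f s powr (1 / p)) powr p \<le> C powr p"
        using p by (intro powr_mono2) auto
      then show ?thesis using p hardy_mean_nonneg[of p f s] by (simp add: powr_powr)
    qed
    then show ?thesis by blast
  qed
  ultimately show ?thesis unfolding hardy_space_def by blast
qed

lemma continuous_on_sphere_smult:
  fixes f :: "complex ^ 'n \<Rightarrow> 'b::topological_space" and s :: complex
  assumes f: "continuous_on (ball 0 1) f" and s: "norm s < 1"
  shows "continuous_on (sphere 0 1) (\<lambda>\<zeta>. f (s *s \<zeta>))"
  by (rule continuous_on_compose2[OF f]) (use s in \<open>auto intro!: continuous_on_smult continuous_on_const continuous_on_id\<close>)

lemma hardy_mean_integrable: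
  assumes "f \<in> holo_ball" "p > 0" "norm s < 1"
  shows "integrable sphere_measure (\<lambda>\<zeta>. norm (f (s *s \<zeta>)) powr p)"
  using assms by (intro integrable_sphere_continuous continuous_on_norm_powr
      continuous_on_sphere_smult continuous_on_holo_ball)

lemma integral_sphere_const_bound:
  fixes f :: "complex ^ 'n \<Rightarrow> real"
  assumes "integrable sphere_measure f" "\<And>z. norm z = 1 \<Longrightarrow> f z \<le> B"
  shows "(LINT z|sphere_measure. f z) \<le> B"
proof -
  have "(LINT z|sphere_measure. f z) \<le> (LINT z|(sphere_measure :: (complex ^ 'n) measure). B)"
    using assms by (intro integral_mono) auto
  then show ?thesis by simp
qed

lemma bounded_imp_hardy_space:
  assumes f: "f \<in> holo_ball" and p: "p > 0" and B: "\<And>z. norm z < 1 \<Longrightarrow> norm (f z) \<le> B"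
  shows "f \<in> hardy_space p"
  unfolding hardy_space_iff[OF p]
proof (intro conjI f exI[of _ "B powr p"] ballI)
  fix s :: real assume s: "s \<in> {0..<1}"
  show "hardy_mean p f s \<le> B powr p"
    unfolding hardy_mean_def
    using s p by (intro integral_sphere_const_bound hardy_mean_integrable f powr_mono2 B) auto
qed

subsection \<open>Radial oscillation and integral means\<close>

lemma open_contains_larger_ball:
  assumes A: "open A" "cball (0::complex) 1 \<subseteq> A"
  obtains R where "R > 1" "ball 0 R \<subseteq> A"
proof -
  obtain e where e: "e > 0" "(\<Union>x\<in>cball (0::complex) 1. ball x e) \<subseteq> A"
    using compact_subset_open_imp_ball_epsilon_subset[OF compact_cball A] by blast
  have "w \<in> A" if "w \<in> ball 0 (1 + e)" for w
  proof (cases "norm w \<le> 1")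
    case True
    then show ?thesis using A by auto
  next
    case False
    define x where "x = w / of_real (norm w)"
    have "w - x = of_real (norm w - 1) * (w / of_real (norm w))"
    proof -
      have "w \<noteq> 0" using False by auto
      then show ?thesis by (simp add: x_def field_simps)
    qed
    then have "norm (w - x) = norm (complex_of_real (norm w - 1)) * norm (w / of_real (norm w))"
      by (simp only: norm_mult)
    also have "\<dots> = norm w - 1" using False unfolding norm_of_real by (auto simp: norm_divide)
    finally have "w \<in> ball x e" using that by (simp add: dist_norm norm_minus_commute)
    moreover have "x \<in> cball 0 1" using False by (auto simp: x_def norm_divide)
    ultimately show ?thesis using e(2) by blast
  qed
  then show thesis using e(1) by (intro that[of "1 + e"]) auto
qed

text \<open>The automorphism of the disc taking 0 to \<open>r\<close>, for
  \<open>0 \<le> r < 1\<close>. It preserves the circle, and its real coefficients make it commute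
  with conjugation.\<close>

definition mobius :: "real \<Rightarrow> complex \<Rightarrow> complex" where
  "mobius r w = (of_real r + w) / (1 + of_real r * w)"

lemma mobius_denom:
  assumes "0 \<le> r" "r < 1" "norm w \<le> 1"
  shows "1 + of_real r * (w :: complex) \<noteq> 0"
proof
  assume "1 + of_real r * w = 0"
  then have "of_real r * w = -1" by (simp add: add_eq_0_iff)
  then have "norm (of_real r * w) = norm (- 1 :: complex)" by (rule arg_cong)
  then have "r * norm w = 1" using assms(1) by (simp add: norm_mult)
  moreover have "r * norm w \<le> r * 1" using assms by (intro mult_left_mono) auto
  ultimately show False using assms by simp
qed

lemma norm_mobius_identity:
  "norm (1 + of_real r * w) ^ 2 - norm (of_real r + w :: complex) ^ 2 = (1 - r ^ 2) * (1 - norm w ^ 2)"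
  by (simp only: cmod_power2) (simp add: power2_eq_square algebra_simps)

lemma norm_mobius_le:
  assumes "0 \<le> r" "r < 1" "norm w \<le> 1"
  shows "norm (mobius r w) \<le> 1"
proof -
  have "(1 - r ^ 2) * (1 - norm w ^ 2) \<ge> 0"
    using assms by (intro mult_nonneg_nonneg) (auto simp: abs_square_le_1)
  then have "norm (of_real r + w) ^ 2 \<le> norm (1 + of_real r * w) ^ 2"
    using norm_mobius_identity[of r w] by linarith
  then have "norm (of_real r + w) \<le> norm (1 + of_real r * w)"
    by (rule power2_le_imp_le) simp
  then show ?thesis using mobius_denom[OF assms] by (simp add: mobius_def norm_divide)
qed

lemma norm_mobius_circle:
  assumes "0 \<le> r" "r < 1" "norm w = 1"
  shows "norm (mobius r w) = 1"
proof -
  have "norm (of_real r + w) ^ 2 = norm (1 + of_real r * w) ^ 2"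
    using norm_mobius_identity[of r w] unfolding assms(3) by simp
  then have "norm (of_real r + w) = norm (1 + of_real r * w)"
    by (rule power2_eq_imp_eq) simp_all
  then show ?thesis using mobius_denom[of r w] assms by (simp add: mobius_def norm_divide)
qed

lemma cnj_mobius: "cnj (mobius r w) = mobius r (cnj w)"
  by (simp add: mobius_def)

lemma mobius_0 [simp]: "mobius r 0 = of_real r"
  by (simp add: mobius_def)

text \<open>The submean lemmas ask for holomorphy on a disc of radius above 1. There is room for it
  because the pole lies outside the closed disc and \<open>s < 1\<close> keeps the image of the
  closed disc inside the open one.\<close>

lemma mobius_slice_holomorphic:
  assumes g: "g \<in> holo_ball" and z: "norm z = 1" and r: "0 \<le> r" "r < 1" and s: "0 \<le> s" "s < 1"
  obtains R where "R > 1" "(\<lambda>w. g ((of_real s * mobius r w) *s z)) holomorphic_on ball 0 R"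
proof -
  define U where "U = {w::complex. 1 + of_real r * w \<noteq> 0}"
  have U: "open U"
    unfolding U_def by (intro open_Collect_neq continuous_intros)
  have mob: "mobius r holomorphic_on U"
    unfolding mobius_def U_def by (intro holomorphic_intros) auto
  define A where "A = U \<inter> (\<lambda>w. of_real s * mobius r w) -` ball 0 1"
  have "open A"
    unfolding A_def using U
    by (intro continuous_open_preimage continuous_intros holomorphic_on_imp_continuous_on[OF mob]) auto
  moreover have "cball 0 1 \<subseteq> A"
  proof
    fix w :: complex assume w: "w \<in> cball 0 1"
    have "s * norm (mobius r w) \<le> s * 1" using norm_mobius_le[OF r, of w] w s by (intro mult_left_mono) auto
    then show "w \<in> A" using mobius_denom[OF r, of w] w s by (auto simp: A_def U_def norm_mult)
  qed
  ultimately obtain R where R: "R > 1" "ball 0 R \<subseteq> A"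
    using open_contains_larger_ball by blast
  have "(\<lambda>w. g ((of_real s * mobius r w) *s z)) holomorphic_on A"
  proof (rule holomorphic_on_compose_gen[of _ A "\<lambda>w. g (w *s z)" "ball 0 1", unfolded o_def])
    show "(\<lambda>w. of_real s * mobius r w) holomorphic_on A"
      by (intro holomorphic_intros holomorphic_on_subset[OF mob]) (auto simp: A_def)
    show "(\<lambda>w. g (w *s z)) holomorphic_on ball 0 1"
      using slice_holomorphic[OF g] z by simp
  qed (auto simp: A_def)
  then show thesis using R holomorphic_on_subset by (intro that[of R]) auto
qed

section \<open>Averaging over the circle and the sphere\<close>

lemma circle_sphere_Fubini:
  fixes \<Phi> :: "complex \<Rightarrow> complex ^ 'n \<Rightarrow> real"
  assumes m: "case_prod \<Phi> \<in> borel_measurable (circle_measure \<Otimes>\<^sub>M sphere_measure)"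
    and B: "\<And>\<zeta> z. norm \<zeta> = 1 \<Longrightarrow> norm z = 1 \<Longrightarrow> \<bar>\<Phi> \<zeta> z\<bar> \<le> B"
  shows "(LINT z|sphere_measure. (LINT \<zeta>|circle_measure. \<Phi> \<zeta> z))
    = (LINT \<zeta>|circle_measure. (LINT z|sphere_measure. \<Phi> \<zeta> z))"
    and "integrable sphere_measure (\<lambda>z. LINT \<zeta>|circle_measure. \<Phi> \<zeta> z)"
proof -
  interpret pair_sigma_finite circle_measure "sphere_measure :: (complex ^ 'n) measure" ..
  interpret P: finite_measure "circle_measure \<Otimes>\<^sub>M (sphere_measure :: (complex ^ 'n) measure)"
    by (intro finite_measure_pair_measure circle.finite_measure_axioms sphere.finite_measure_axioms)
  have "integrable (circle_measure \<Otimes>\<^sub>M sphere_measure) (case_prod \<Phi>)"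
    using B by (intro P.integrable_const_bound[of _ B] m AE_I2) (auto simp: space_pair_measure)
  then show "(LINT z|sphere_measure. (LINT \<zeta>|circle_measure. \<Phi> \<zeta> z))
    = (LINT \<zeta>|circle_measure. (LINT z|sphere_measure. \<Phi> \<zeta> z))"
    and "integrable sphere_measure (\<lambda>z. LINT \<zeta>|circle_measure. \<Phi> \<zeta> z)"
    by (rule Fubini_integral, rule integrable_snd)
qed

lemma holo_ball_bounded:
  assumes "g \<in> holo_ball" "r < 1"
  obtains B where "B \<ge> 0" "\<And>z. norm z \<le> r \<Longrightarrow> norm (g z) \<le> B"
proof -
  have "continuous_on (cball 0 r) g"
    using assms by (intro continuous_on_subset[OF continuous_on_holo_ball]) auto
  then obtain B where B: "\<And>z. z \<in> cball 0 r \<Longrightarrow> norm (g z) \<le> B"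
    using compact_imp_bounded[OF compact_continuous_image[OF _ compact_cball], of 0 r g]
    unfolding bounded_iff by blast
  have "norm (g z) \<le> max B 0" if "norm z \<le> r" for z
    using B[of z] that by auto
  then show thesis by (intro that[of "max B 0"]) auto
qed

lemma measurable_circle_sphere_smult:
  fixes g :: "complex ^ 'n \<Rightarrow> complex"
  assumes g: "g \<in> holo_ball" and a: "a \<in> borel_measurable borel" "\<And>\<zeta>. norm \<zeta> = 1 \<Longrightarrow> norm (a \<zeta>) < 1"
  shows "(\<lambda>(\<zeta>, z). g (a \<zeta> *s z)) \<in> borel_measurable (circle_measure \<Otimes>\<^sub>M sphere_measure)"
proof -
  have [measurable]: "a \<in> borel_measurable circle_measure"
    using measurable_compose[OF measurable_circle_ident a(1)] by simp
  show ?thesis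
    unfolding case_prod_beta
    by (rule measurable_continuous_on_comp[OF continuous_on_holo_ball[OF g]])
      (use a(2) in \<open>auto simp: space_pair_measure\<close>)
qed

lemma borel_measurable_mobius [measurable]: "mobius r \<in> borel_measurable borel"
  unfolding mobius_def by measurable

lemma norm_smult_mobius_lt:
  assumes "0 \<le> r" "r < 1" "0 \<le> s" "s < 1" "norm w \<le> 1"
  shows "norm (of_real s * mobius r w) < 1"
proof -
  have "s * norm (mobius r w) \<le> s * 1" using norm_mobius_le[OF assms(1,2,5)] assms by (intro mult_left_mono) auto
  then show ?thesis using assms by (simp add: norm_mult)
qed

text \<open>After exchanging the integrals, the inner one over the sphere does not depend on
  \<open>\<zeta>\<close>: \<open>mobius r \<zeta>\<close> is unimodular and disappears by rotation
  invariance.\<close>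

lemma integral_sphere_mobius:
  assumes g: "g \<in> holo_ball" and q: "q > 0" and r: "0 \<le> r" "r < 1" and s: "0 \<le> s" "s < 1"
  shows "(LINT z|sphere_measure. (LINT \<zeta>|circle_measure. norm (g ((of_real s * mobius r \<zeta>) *s z)) powr q))
      = hardy_mean q g s"
    and "integrable sphere_measure (\<lambda>z. LINT \<zeta>|circle_measure. norm (g ((of_real s * mobius r \<zeta>) *s z)) powr q)"
proof -
  obtain B where B: "B \<ge> 0" "\<And>z. norm z \<le> s \<Longrightarrow> norm (g z) \<le> B"
    using holo_ball_bounded[OF g s(2)] by blast
  have m: "(\<lambda>(\<zeta>, z). norm (g ((of_real s * mobius r \<zeta>) *s z)) powr q) \<in> borel_measurable (circle_measure \<Otimes>\<^sub>M sphere_measure)"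
    using measurable_circle_sphere_smult[OF g, of "\<lambda>\<zeta>. of_real s * mobius r \<zeta>"] norm_smult_mobius_lt[OF r s]
    unfolding case_prod_beta by simp
  have bd: "\<bar>norm (g ((of_real s * mobius r \<zeta>) *s z)) powr q\<bar> \<le> B powr q"
    if "norm \<zeta> = 1" "norm z = 1" for \<zeta> z
    using that norm_mobius_circle[OF r, of \<zeta>] s q by (auto intro!: powr_mono2 B simp: norm_mult)
  show "integrable sphere_measure (\<lambda>z. LINT \<zeta>|circle_measure. norm (g ((of_real s * mobius r \<zeta>) *s z)) powr q)"
    by (rule circle_sphere_Fubini(2)[OF m bd])
  have "(LINT z|sphere_measure. (LINT \<zeta>|circle_measure. norm (g ((of_real s * mobius r \<zeta>) *s z)) powr q))
      = (LINT \<zeta>|circle_measure. (LINT z|sphere_measure. norm (g ((of_real s * mobius r \<zeta>) *s z)) powr q))"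
    by (rule circle_sphere_Fubini(1)[OF m bd])
  also have "\<dots> = (LINT \<zeta>|circle_measure. hardy_mean q g s)"
  proof (rule Bochner_Integration.integral_cong[OF refl])
    fix \<zeta> assume "\<zeta> \<in> space circle_measure"
    then have "norm (mobius r \<zeta>) = 1" using norm_mobius_circle[OF r] by simp
    from integral_sphere_smult[OF this, of "\<lambda>z. norm (g (of_real s *s z)) powr q"]
    show "(LINT z|sphere_measure. norm (g ((of_real s * mobius r \<zeta>) *s z)) powr q) = hardy_mean q g s"
      using hardy_mean_integrable[OF g q, of "of_real s"] s
      by (simp add: hardy_mean_def vector_smult_assoc borel_measurable_integrable)
  qed
  also have "\<dots> = hardy_mean q g s" by simp
  finally show "(LINT z|sphere_measure. (LINT \<zeta>|circle_measure. norm (g ((of_real s * mobius r \<zeta>) *s z)) powr q))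
      = hardy_mean q g s" .
qed

text \<open>With \<open>r = s' / s\<close> the slice
  \<open>w \<mapsto> g ((s * mobius r w) *s z)\<close> has center value \<open>g (s' *s z)\<close>.
  Its submean inequality at the center is integrated over the sphere.\<close>

lemma hardy_mean_mono:
  assumes g: "g \<in> holo_ball" and q: "q > 0" and s: "0 \<le> s'" "s' \<le> s" "s < 1"
  shows "hardy_mean q g s' \<le> hardy_mean q g s"
proof (cases "s' = s")
  case False
  define r where "r = s' / s"
  have r: "0 \<le> r" "r < 1" "s * r = s'" and s0: "0 \<le> s" using s False by (auto simp: r_def)
  have "hardy_mean q g s' \<le> (LINT z|sphere_measure. (LINT \<zeta>|circle_measure. norm (g ((of_real s * mobius r \<zeta>) *s z)) powr q))"
    unfolding hardy_mean_def
  proof (rule integral_mono)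
    show "integrable sphere_measure (\<lambda>\<zeta>. norm (g (of_real s' *s \<zeta>)) powr q)"
      using s by (intro hardy_mean_integrable g q) auto
    show "integrable sphere_measure (\<lambda>z. LINT \<zeta>|circle_measure. norm (g ((of_real s * mobius r \<zeta>) *s z)) powr q)"
      by (rule integral_sphere_mobius(2)[OF g q r(1,2) s0 s(3)])
    fix z :: "complex ^ 'a" assume "z \<in> space sphere_measure"
    then have z: "norm z = 1" by simp
    obtain R where R: "R > 1" "(\<lambda>w. g ((of_real s * mobius r w) *s z)) holomorphic_on ball 0 R"
      using mobius_slice_holomorphic[OF g z r(1,2) s0 s(3)] by blast
    from submean_holomorphic[OF R(2,1) q]
    show "norm (g (of_real s' *s z)) powr q \<le> (LINT \<zeta>|circle_measure. norm (g ((of_real s * mobius r \<zeta>) *s z)) powr q)"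
      unfolding submean_def using r(3) by (auto dest!: spec[of _ 0] simp flip: of_real_mult)
  qed
  also have "\<dots> = hardy_mean q g s"
    by (rule integral_sphere_mobius(1)[OF g q r(1,2) s0 s(3)])
  finally show ?thesis .
qed simp

text \<open>Measures how far \<open>g\<close> on the circle of radius \<open>s * r\<close> in the
  slice of \<open>z\<close> is from the single value \<open>g (of_real s *s z)\<close>. The circle
  is parametrized through \<open>mobius r (cnj \<zeta>)\<close> because on the circle this is the
  inverse of \<open>mobius r \<zeta>\<close>, the rotation applied below.\<close>

definition mobius_osc :: "real \<Rightarrow> (complex ^ 'n \<Rightarrow> complex) \<Rightarrow> real \<Rightarrow> real \<Rightarrow> complex ^ 'n \<Rightarrow> real" where
  "mobius_osc q g s r z =
     (LINT \<zeta>|circle_measure. norm (g (of_real s *s z) - g ((of_real (s * r) * mobius r (cnj \<zeta>)) *s z)) powr q)"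

text \<open>Rotating the variable on the sphere by \<open>mobius r \<zeta>\<close> turns the oscillation around the
  boundary value at \<open>s *s z\<close> into one around the value at the center \<open>(s * r) *s z\<close>.\<close>

lemma integral_mobius_osc_le:
  assumes q: "q > 0" and \<epsilon>: "\<epsilon> > 0"
  shows "\<exists>C\<ge>0. \<forall>(g :: complex ^ 'n \<Rightarrow> complex) r s.
      g \<in> holo_ball \<longrightarrow> 0 \<le> r \<longrightarrow> r < 1 \<longrightarrow> 0 \<le> s \<longrightarrow> s < 1 \<longrightarrow>
      integrable sphere_measure (mobius_osc q g s r) \<and>
      (LINT z|sphere_measure. mobius_osc q g s r z)
        \<le> \<epsilon> * hardy_mean q g (s * r) + C * (hardy_mean q g s - hardy_mean q g (s * r))"
proof -
  obtain C where C: "C \<ge> 0" and osc: "\<And>F R. F holomorphic_on ball 0 R \<Longrightarrow> R > 1 \<Longrightarrow>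
      (LINT \<zeta>|circle_measure. norm (F \<zeta> - F 0) powr q) \<le>
        \<epsilon> * norm (F 0) powr q + C * ((LINT \<zeta>|circle_measure. norm (F \<zeta>) powr q) - norm (F 0) powr q)"
    using circle_oscillation_le[OF q \<epsilon>] by metis
  show ?thesis
  proof (intro exI[of _ C] conjI[OF C] allI impI, goal_cases)
    case (1 g r s)
    then have g: "g \<in> holo_ball" and r: "0 \<le> r" "r < 1" and s: "0 \<le> s" "s < 1" by auto
    have sr: "0 \<le> s * r" "s * r \<le> s" "s * r < 1" using r s mult_left_le[of r s] by auto
    have nsr: "norm (complex_of_real (s * r)) < 1" using sr unfolding norm_of_real by simp
    obtain B where B: "B \<ge> 0" "\<And>z. norm z \<le> s \<Longrightarrow> norm (g z) \<le> B"
      using holo_ball_bounded[OF g s(2)] by blast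
    have bd: "norm (g x - g y) powr q \<le> (2 * B) powr q" if "norm x \<le> s" "norm y \<le> s" for x y
      using norm_triangle_ineq4[of "g x" "g y"] B(2)[OF that(1)] B(2)[OF that(2)] q
      by (intro powr_mono2) auto
    have meas: "(\<lambda>(\<zeta>, z). norm (g (a \<zeta> *s z) - g (b \<zeta> *s z)) powr q)
        \<in> borel_measurable (circle_measure \<Otimes>\<^sub>M (sphere_measure :: (complex ^ 'n) measure))"
      if "a \<in> borel_measurable borel" "b \<in> borel_measurable borel"
        "\<And>\<zeta>. norm \<zeta> = 1 \<Longrightarrow> norm (a \<zeta>) < 1" "\<And>\<zeta>. norm \<zeta> = 1 \<Longrightarrow> norm (b \<zeta>) < 1" for a b
      using measurable_circle_sphere_smult[OF g that(1,3)] measurable_circle_sphere_smult[OF g that(2,4)]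
      unfolding case_prod_beta by measurable
    have cnj_meas: "cnj \<in> borel_measurable borel"
      by (intro borel_measurable_continuous_onI continuous_intros)
    have m1: "(\<lambda>(\<zeta>, z). norm (g (of_real s *s z) - g ((of_real (s * r) * mobius r (cnj \<zeta>)) *s z)) powr q)
        \<in> borel_measurable (circle_measure \<Otimes>\<^sub>M (sphere_measure :: (complex ^ 'n) measure))"
      using sr s r norm_mobius_circle[OF r] measurable_compose[OF cnj_meas borel_measurable_mobius]
      by (intro meas borel_measurable_times) (auto simp: norm_mult)
    have m2: "(\<lambda>(\<zeta>, z). norm (g ((of_real s * mobius r \<zeta>) *s z) - g (of_real (s * r) *s z)) powr q)
        \<in> borel_measurable (circle_measure \<Otimes>\<^sub>M (sphere_measure :: (complex ^ 'n) measure))"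
      using sr s r norm_mobius_circle[OF r]
      by (intro meas borel_measurable_times) (auto simp: norm_mult)
    have b1: "\<bar>norm (g (of_real s *s z) - g ((of_real (s * r) * mobius r (cnj \<zeta>)) *s z)) powr q\<bar> \<le> (2 * B) powr q"
      if "norm \<zeta> = 1" "norm z = 1" for \<zeta> z
      using that sr s norm_mobius_circle[OF r, of "cnj \<zeta>"] bd by (auto simp: norm_mult)
    have b2: "\<bar>norm (g ((of_real s * mobius r \<zeta>) *s z) - g (of_real (s * r) *s z)) powr q\<bar> \<le> (2 * B) powr q"
      if "norm \<zeta> = 1" "norm z = 1" for \<zeta> z
      using that sr s norm_mobius_circle[OF r, of "\<zeta>"] bd by (auto simp: norm_mult)
    have int: "integrable sphere_measure (mobius_osc q g s r)"
      unfolding mobius_osc_def by (rule circle_sphere_Fubini(2)[OF m1 b1])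
    have rot: "(LINT z|sphere_measure. norm (g (of_real s *s z) - g ((of_real (s * r) * mobius r (cnj \<zeta>)) *s z)) powr q)
      = (LINT z|sphere_measure. norm (g ((of_real s * mobius r \<zeta>) *s z) - g (of_real (s * r) *s z)) powr q)"
      if \<zeta>: "norm \<zeta> = 1" for \<zeta>
    proof -
      have m: "norm (mobius r \<zeta>) = 1" "norm (mobius r (cnj \<zeta>)) = 1"
        using \<zeta> by (auto intro: norm_mobius_circle r)
      \<comment> \<open>The factors are conjugate and unimodular. Thus the rotation by
        \<open>mobius r \<zeta>\<close> leaves the constant \<open>s * r\<close> in the second
        argument of the difference and moves the dependence on \<open>\<zeta>\<close> to the
        first.\<close>
      have "mobius r (cnj \<zeta>) * mobius r \<zeta> = 1"
        using complex_norm_square[of "mobius r \<zeta>"] m by (simp add: cnj_mobius mult.commute)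
      moreover have "(\<lambda>z. norm (g (of_real s *s z) - g ((of_real (s * r) * mobius r (cnj \<zeta>)) *s z)) powr q)
          \<in> borel_measurable (sphere_measure :: (complex ^ 'n) measure)"
        using m s sr q by (intro borel_measurable_integrable integrable_sphere_continuous continuous_on_norm_powr
            continuous_on_diff continuous_on_sphere_smult continuous_on_holo_ball g) (auto simp: norm_mult)
      ultimately show ?thesis
        using integral_sphere_smult[OF m(1), of "\<lambda>z. norm (g (of_real s *s z) - g ((of_real (s * r) * mobius r (cnj \<zeta>)) *s z)) powr q"]
        by (simp add: vector_smult_assoc mult.assoc)
    qed
    have "(LINT z|sphere_measure. mobius_osc q g s r z)
      = (LINT \<zeta>|circle_measure. (LINT z|sphere_measure. norm (g (of_real s *s z) - g ((of_real (s * r) * mobius r (cnj \<zeta>)) *s z)) powr q))"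
      unfolding mobius_osc_def by (rule circle_sphere_Fubini(1)[OF m1 b1])
    also have "\<dots> = (LINT \<zeta>|circle_measure. (LINT z|sphere_measure. norm (g ((of_real s * mobius r \<zeta>) *s z) - g (of_real (s * r) *s z)) powr q))"
      by (rule Bochner_Integration.integral_cong[OF refl]) (rule rot, simp)
    also have "\<dots> = (LINT z|sphere_measure. (LINT \<zeta>|circle_measure. norm (g ((of_real s * mobius r \<zeta>) *s z) - g (of_real (s * r) *s z)) powr q))"
      by (rule circle_sphere_Fubini(1)[OF m2 b2, symmetric])
    also have "\<dots> \<le> (LINT z|sphere_measure. \<epsilon> * norm (g (of_real (s * r) *s z)) powr q
        + C * ((LINT \<zeta>|circle_measure. norm (g ((of_real s * mobius r \<zeta>) *s z)) powr q) - norm (g (of_real (s * r) *s z)) powr q))"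
    proof (rule integral_mono[OF circle_sphere_Fubini(2)[OF m2 b2]])
      show "integrable sphere_measure (\<lambda>z. \<epsilon> * norm (g (of_real (s * r) *s z)) powr q
        + C * ((LINT \<zeta>|circle_measure. norm (g ((of_real s * mobius r \<zeta>) *s z)) powr q) - norm (g (of_real (s * r) *s z)) powr q))"
        by (intro Bochner_Integration.integrable_add integrable_mult_right Bochner_Integration.integrable_diff
          integral_sphere_mobius(2) hardy_mean_integrable g q r s nsr)
      fix z :: "complex ^ 'n" assume "z \<in> space sphere_measure"
      then have z: "norm z = 1" by simp
      obtain R where R: "R > 1" "(\<lambda>w. g ((of_real s * mobius r w) *s z)) holomorphic_on ball 0 R"
        using mobius_slice_holomorphic[OF g z r s] by blast
      from osc[OF R(2,1)]
      show "(LINT \<zeta>|circle_measure. norm (g ((of_real s * mobius r \<zeta>) *s z) - g (of_real (s * r) *s z)) powr q)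
        \<le> \<epsilon> * norm (g (of_real (s * r) *s z)) powr q
        + C * ((LINT \<zeta>|circle_measure. norm (g ((of_real s * mobius r \<zeta>) *s z)) powr q) - norm (g (of_real (s * r) *s z)) powr q)"
        by (simp only: mobius_0 of_real_mult)
    qed
    also have "\<dots> = \<epsilon> * hardy_mean q g (s * r) + C * (hardy_mean q g s - hardy_mean q g (s * r))"
    proof -
      have i: "integrable sphere_measure (\<lambda>z. norm (g (of_real (s * r) *s z)) powr q)"
        by (intro hardy_mean_integrable g q nsr)
      note j = integral_sphere_mobius[OF g q r s]
      show ?thesis
        using i j(2) unfolding hardy_mean_def[of q g "s * r"] j(1)[symmetric]
        by (simp only: Bochner_Integration.integral_add Bochner_Integration.integral_diff integral_mult_right_zero
            integrable_mult_right Bochner_Integration.integrable_diff)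
    qed
    finally show ?case using int by simp
  qed
qed

text \<open>The submean inequality away from the center, evaluated at the real point
  \<open>u\<close>; for \<open>\<bar>u\<bar> \<le> 3 / 4\<close> its factor is at most
  \<open>(1 + 3 / 4) / (1 - 3 / 4) = 7\<close>.\<close>

lemma mobius_osc_Harnack:
  assumes g: "g \<in> holo_ball" and q: "q > 0" and z: "norm z = 1" and r: "0 \<le> r" "r < 1" and s: "0 \<le> s" "s < 1"
    and u: "\<bar>u\<bar> \<le> 3 / 4"
  shows "norm (g (of_real s *s z) - g ((of_real (s * r) * mobius r (of_real u)) *s z)) powr q \<le> 7 * mobius_osc q g s r z"
proof -
  have sr: "0 \<le> s * r" "s * r < 1" using r s mult_left_le[of r s] by auto
  obtain R where R: "R > 1" "(\<lambda>w. g ((of_real (s * r) * mobius r w) *s z)) holomorphic_on ball 0 R"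
    by (rule mobius_slice_holomorphic[OF g z r sr])
  define F where "F = (\<lambda>w. g (of_real s *s z) - g ((of_real (s * r) * mobius r w) *s z))"
  have F: "F holomorphic_on ball 0 R" unfolding F_def by (intro holomorphic_intros R)
  have "cnj ` ball 0 R = ball 0 R"
  proof (intro equalityI subsetI)
    fix x :: complex assume "x \<in> ball 0 R"
    then have "cnj x \<in> ball 0 R" by simp
    then have "cnj (cnj x) \<in> cnj ` ball 0 R" by (rule imageI)
    then show "x \<in> cnj ` ball 0 R" by simp
  qed auto
  \<comment> \<open>The integral in \<open>mobius_osc\<close> samples \<open>F\<close> at
    \<open>cnj \<zeta>\<close>. Conjugating the values as well restores holomorphy without changing
    moduli, and the real point \<open>u\<close> is fixed by conjugation.\<close>
  with F have "(cnj \<circ> F \<circ> cnj) holomorphic_on ball 0 R"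
    by (intro holomorphic_on_compose_cnj_cnj) auto
  from submean_holomorphic[OF this R(1) q]
  have "norm (F (of_real u)) powr q \<le> (1 + \<bar>u\<bar>) / (1 - \<bar>u\<bar>) * mobius_osc q g s r z"
    unfolding submean_def using u by (auto dest!: spec[of _ "of_real u"] simp: mobius_osc_def F_def simp del: complex_cnj_diff)
  also have "\<dots> \<le> 7 * mobius_osc q g s r z"
  proof (intro mult_right_mono)
    show "(1 + \<bar>u\<bar>) / (1 - \<bar>u\<bar>) \<le> 7" using u by (simp add: divide_le_eq)
    show "0 \<le> mobius_osc q g s r z" unfolding mobius_osc_def by (intro Bochner_Integration.integral_nonneg) auto
  qed
  finally show ?thesis by (simp add: F_def)
qed

subsection \<open>Dyadic decomposition of the radius\<close>

text \<open>Every \<open>x i\<close> is at most the \<open>q\<close>-quasi-norm \<open>M\<close> of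
  the whole family. This crude bound treats all \<open>q > 0\<close> alike, where Hoelder's
  inequality or subadditivity would require a case distinction at 1.\<close>

lemma weighted_sum_powr_le:
  fixes b x :: "'i \<Rightarrow> real"
  assumes I: "finite I" and b: "\<And>i. i \<in> I \<Longrightarrow> b i \<ge> 0" and x: "\<And>i. i \<in> I \<Longrightarrow> x i \<ge> 0" and q: "q > 0"
  shows "(\<Sum>i\<in>I. b i * x i) powr q \<le> (\<Sum>i\<in>I. b i) powr q * (\<Sum>i\<in>I. x i powr q)"
proof -
  define M where "M = (\<Sum>i\<in>I. x i powr q) powr (1 / q)"
  have S: "(\<Sum>i\<in>I. x i powr q) \<ge> 0" by (intro sum_nonneg) auto
  have xM: "x i \<le> M" if "i \<in> I" for i
  proof -
    have "x i powr q \<le> (\<Sum>i\<in>I. x i powr q)" using that I by (intro member_le_sum) auto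
    then have "(x i powr q) powr (1 / q) \<le> M" unfolding M_def using q by (intro powr_mono2) auto
    then show ?thesis using q x[OF that] by (simp add: powr_powr)
  qed
  have "(\<Sum>i\<in>I. b i * x i) \<le> (\<Sum>i\<in>I. b i * M)" using b xM by (intro sum_mono mult_left_mono) auto
  also have "\<dots> = (\<Sum>i\<in>I. b i) * M" by (simp add: sum_distrib_right)
  finally have "(\<Sum>i\<in>I. b i * x i) powr q \<le> ((\<Sum>i\<in>I. b i) * M) powr q"
    using q b x by (intro powr_mono2 sum_nonneg mult_nonneg_nonneg) auto
  also have "\<dots> = (\<Sum>i\<in>I. b i) powr q * M powr q"
    by (rule powr_mult)
  also have "M powr q = (\<Sum>i\<in>I. x i powr q)" using q S by (simp add: M_def powr_powr)
  finally show ?thesis .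
qed

text \<open>Since subtraction of natural numbers is truncated, one of the two exponents is 0 and the
  product is \<open>\<rho>\<close> to the power \<open>|N - i|\<close>.\<close>

lemma two_sided_geometric_sum_le:
  fixes \<rho> :: real
  assumes "0 < \<rho>" "\<rho> < 1"
  shows "(\<Sum>i<I. \<rho> ^ (N - i) * \<rho> ^ (i - N)) \<le> 2 / (1 - \<rho>)"
proof -
  have geo: "(\<Sum>j<n. \<rho> ^ j) \<le> 1 / (1 - \<rho>)" for n
  proof -
    have "(\<Sum>j<n. \<rho> ^ j) = (1 - \<rho> ^ n) / (1 - \<rho>)" using assms by (simp add: sum_gp_strict)
    also have "\<dots> \<le> 1 / (1 - \<rho>)" using assms by (intro divide_right_mono) auto
    finally show ?thesis .
  qed
  have "(\<Sum>i<I. \<rho> ^ (N - i) * \<rho> ^ (i - N)) \<le> (\<Sum>i<N + I. \<rho> ^ (N - i) * \<rho> ^ (i - N))"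
    using assms by (intro sum_mono2) auto
  also have "\<dots> = (\<Sum>i<N. \<rho> ^ (N - i) * \<rho> ^ (i - N)) + (\<Sum>i=N..<N + I. \<rho> ^ (N - i) * \<rho> ^ (i - N))"
    unfolding lessThan_atLeast0 by (rule sum.atLeastLessThan_concat[symmetric]) auto
  also have "(\<Sum>i=N..<N + I. \<rho> ^ (N - i) * \<rho> ^ (i - N)) = (\<Sum>j<I. \<rho> ^ j)"
    by (rule sum.reindex_bij_witness[of _ "\<lambda>j. j + N" "\<lambda>i. i - N"]) auto
  also have "(\<Sum>i<N. \<rho> ^ (N - i) * \<rho> ^ (i - N)) = (\<Sum>j<N. \<rho> ^ Suc j)"
    by (rule sum.reindex_bij_witness[of _ "\<lambda>j. N - Suc j" "\<lambda>i. N - Suc i"]) (auto simp: Suc_diff_Suc)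
  also have "\<dots> \<le> (\<Sum>j<N. \<rho> ^ j)" using assms by (intro sum_mono power_decreasing) auto
  finally show ?thesis using geo[of N] geo[of I] by simp
qed

lemma power_diff_le_mult:
  fixes x y :: real
  assumes "0 \<le> y" "y \<le> x" "x \<le> 1"
  shows "x ^ k - y ^ k \<le> real k * (x - y)"
proof (induction k)
  case (Suc k)
  have "x ^ Suc k - y ^ Suc k = x * (x ^ k - y ^ k) + y ^ k * (x - y)" by (simp add: algebra_simps)
  also have "\<dots> \<le> 1 * (x ^ k - y ^ k) + 1 * (x - y)"
    using assms power_mono[of y x k] power_le_one[of y k] by (intro add_mono mult_right_mono) auto
  also have "\<dots> \<le> real (Suc k) * (x - y)" using Suc by (simp add: algebra_simps)
  finally show ?case .
qed simp

text \<open>The mass that the density \<open>k t^(k-1)\<close> with \<open>k = 2^N\<close> puts on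
  the \<open>i\<close>-th dyadic block, from \<open>1 - 2^-i\<close> to
  \<open>1 - 2^-(i+1)\<close>.\<close>

definition dyadic_weight :: "nat \<Rightarrow> nat \<Rightarrow> real" where
  "dyadic_weight N i = (1 - (1 / 2) ^ Suc i) ^ (2 ^ N) - (1 - (1 / 2) ^ i) ^ (2 ^ N)"

lemma dyadic_weight_nonneg: "0 \<le> dyadic_weight N i"
  unfolding dyadic_weight_def
  by (simp, intro power_mono) (auto simp: power_le_one)

text \<open>For \<open>i \<ge> N\<close> the mass is at most \<open>2^N\<close> times the length of
  the block. For \<open>i < N\<close> it is at most the value of \<open>t^(2^N)\<close> at the right
  end, which is bounded by \<open>exp (- 2^(N-i-1))\<close> and so by the reciprocal of
  \<open>2^(N-i-1)\<close>.\<close>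

lemma dyadic_weight_le: "dyadic_weight N i \<le> 2 * ((1 / 2) ^ (N - i) * (1 / 2) ^ (i - N))"
proof (cases "N \<le> i")
  case True
  have "dyadic_weight N i \<le> real (2 ^ N) * ((1 - (1 / 2) ^ Suc i) - (1 - (1 / 2) ^ i))"
    unfolding dyadic_weight_def by (intro power_diff_le_mult) (auto simp: power_le_one)
  also have "\<dots> = 2 ^ N * (1 / 2) ^ Suc i" by simp
  also have "(1 / 2 :: real) ^ Suc i = (1 / 2) ^ N * (1 / 2) ^ (i - N) / 2"
    using True by (simp flip: power_add)
  also have "(2::real) ^ N * ((1 / 2) ^ N * (1 / 2) ^ (i - N) / 2) = (1 / 2) ^ (i - N) / 2"
    by (simp add: power_one_over)
  finally have "dyadic_weight N i \<le> (1 / 2) ^ (i - N) / 2" .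
  also have "\<dots> \<le> 2 * (1 / 2) ^ (i - N)" by simp
  finally show ?thesis using True by simp
next
  case False
  define x where "x = (1 / 2 :: real) ^ Suc i"
  have x: "0 < x" "x \<le> 1" unfolding x_def by (auto intro!: power_le_one simp del: power_Suc)
  have "0 \<le> (1 - (1 / 2 :: real) ^ i) ^ (2 ^ N)" by (intro zero_le_power) (simp add: power_le_one)
  then have "dyadic_weight N i \<le> (1 - x) ^ (2 ^ N)"
    unfolding dyadic_weight_def x_def by linarith
  also have "\<dots> \<le> exp (- x) ^ (2 ^ N)"
    using x exp_ge_add_one_self[of "- x"] by (intro power_mono) auto
  also have "\<dots> = inverse (exp (2 ^ N * x))"
    using exp_of_nat_mult[of "2 ^ N" x] by (simp add: exp_minus power_inverse)
  also have "\<dots> \<le> inverse (2 ^ N * x)"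
  proof (rule le_imp_inverse_le)
    show "2 ^ N * x \<le> exp (2 ^ N * x)" using exp_ge_add_one_self[of "2 ^ N * x"] by linarith
  qed (use x in simp)
  also have "\<dots> = 2 * (1 / 2) ^ (N - i)"
  proof -
    have "(2::real) ^ N = 2 ^ i * 2 ^ (N - i)" using False by (simp flip: power_add)
    then show ?thesis by (simp add: x_def power_one_over field_simps)
  qed
  finally show ?thesis using False by simp
qed

lemma dyadic_weight_powr_le:
  assumes "e > 0"
  shows "dyadic_weight N i powr e \<le> 2 powr e * (((1 / 2) powr e) ^ (N - i) * ((1 / 2) powr e) ^ (i - N))"
proof -
  have "dyadic_weight N i powr e \<le> (2 * ((1 / 2) ^ (N - i) * (1 / 2) ^ (i - N))) powr e"
    using assms by (intro powr_mono2 dyadic_weight_le dyadic_weight_nonneg) auto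
  also have "\<dots> = 2 powr e * (((1 / 2) powr e) ^ (N - i) * ((1 / 2) powr e) ^ (i - N))"
  proof -
    have "((1 / 2 :: real) ^ n) powr e = ((1 / 2) powr e) ^ n" for n
      by (induction n) (simp_all only: power_Suc powr_mult power_0 powr_one_eq_one)
    then show ?thesis by (simp add: powr_mult)
  qed
  finally show ?thesis .
qed

lemma dyadic_weight_powr_sum_le:
  assumes "e > 0"
  shows "(\<Sum>i<I. dyadic_weight N i powr e) \<le> 2 powr e * (2 / (1 - (1 / 2) powr e))"
proof -
  have \<rho>: "0 < (1 / 2 :: real) powr e" "(1 / 2 :: real) powr e < 1"
    using assms powr_less_mono2[of e "1/2" 1] by auto
  have "(\<Sum>i<I. dyadic_weight N i powr e)
      \<le> (\<Sum>i<I. 2 powr e * (((1 / 2) powr e) ^ (N - i) * ((1 / 2) powr e) ^ (i - N)))"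
    by (intro sum_mono dyadic_weight_powr_le assms)
  also have "\<dots> \<le> 2 powr e * (2 / (1 - (1 / 2) powr e))"
    unfolding sum_distrib_left[symmetric]
    by (intro mult_left_mono two_sided_geometric_sum_le \<rho>) auto
  finally show ?thesis .
qed

text \<open>With one \<open>r\<close> for the whole block, each of its points is
  \<open>t = r * mobius r u\<close> for a real \<open>u\<close> with
  \<open>\<bar>u\<bar> \<le> 3 / 4\<close>. So \<open>mobius_osc_Harnack\<close> bounds the radial
  oscillation on the block by a single circular one.\<close>

lemma dyadic_block_osc:
  assumes g: "g \<in> holo_ball" and q: "q > 0" and z: "norm z = 1" and s: "0 \<le> s" "s < 1"
    and t: "1 - (1 / 2) ^ i \<le> t" "t \<le> 1 - (1 / 2) ^ Suc i"
  shows "norm (g (of_real s *s z) - g (of_real t *s (of_real s *s z))) powr q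
    \<le> 7 * mobius_osc q g s (1 - (1 / 2) ^ (i + 2)) z"
proof -
  \<comment> \<open>With the exponent \<open>i + 2\<close> the block is
    \<open>2 * \<delta> \<le> 1 - t \<le> 4 * \<delta>\<close>, and
    \<open>\<delta> \<le> 1 / 4\<close> even for \<open>i = 0\<close>. The first inequality yields
    \<open>u \<le> 0\<close>; the second reduces \<open>- u \<le> 3 / 4\<close> to
    \<open>4 * \<delta> * \<delta> \<le> \<delta>\<close>.\<close>
  define \<delta> where "\<delta> = (1 / 2 :: real) ^ (i + 2)"
  have "(1 / 2 :: real) ^ i \<le> 1" by (simp add: power_le_one)
  then have \<delta>: "0 < \<delta>" "\<delta> \<le> 1 / 4" by (auto simp: \<delta>_def)
  have t': "2 * \<delta> \<le> 1 - t" "1 - t \<le> 4 * \<delta>" using t by (auto simp: \<delta>_def)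
  define r where "r = 1 - \<delta>"
  have r: "0 < r" "r < 1" using \<delta> by (auto simp: r_def)
  \<comment> \<open>The solution of \<open>r * (r + u) = t * (1 + r * u)\<close>.\<close>
  define u where "u = (t - r ^ 2) / (r * (1 - t))"
  have d: "r * (1 - t) > 0" using r \<delta> t' by (intro mult_pos_pos) auto
  have num: "r ^ 2 - t = (1 - t) - 2 * \<delta> + \<delta> ^ 2" by (simp add: r_def power2_eq_square algebra_simps)
  have "r ^ 2 - t \<ge> 0" using num t' zero_le_power2[of \<delta>] by linarith
  then have u0: "u \<le> 0" unfolding u_def using d by (intro divide_nonpos_pos) auto
  have "r ^ 2 - t \<le> 3 / 4 * (r * (1 - t))"
  proof -
    have "(1 - t) * (1 / 4 + 3 / 4 * \<delta>) \<le> (4 * \<delta>) * (1 / 4 + 3 / 4 * \<delta>)"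
      using t' \<delta> by (intro mult_right_mono) auto
    moreover have "\<delta> * \<delta> \<le> \<delta> * (1 / 4)" using \<delta> by (intro mult_left_mono) auto
    ultimately show ?thesis unfolding num by (simp add: r_def power2_eq_square field_simps)
  qed
  then have "- u \<le> 3 / 4"
    unfolding u_def minus_divide_left using d by (subst pos_divide_le_eq) (auto simp: mult.commute)
  with u0 have u: "\<bar>u\<bar> \<le> 3 / 4" by simp
  have den: "1 + r * u > 0"
  proof -
    have "r * - u \<le> 1 * (3 / 4)" using u u0 r by (intro mult_mono) auto
    then show ?thesis by simp
  qed
  have "r * u * (1 - t) = t - r ^ 2" unfolding u_def using d r by (simp add: field_simps)
  then have "r * (r + u) = t * (1 + r * u)" by (simp add: algebra_simps power2_eq_square)
  then have "r * ((r + u) / (1 + r * u)) = t" using den by (simp add: field_simps)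
  moreover have "mobius r (of_real u) = of_real ((r + u) / (1 + r * u))" by (simp add: mobius_def)
  ultimately have "of_real r * mobius r (of_real u) = complex_of_real t"
    by (simp only: of_real_mult[symmetric])
  then have eq: "of_real (s * r) * mobius r (of_real u) = complex_of_real t * of_real s"
    by (simp only: of_real_mult mult.assoc) (rule mult.commute)
  show ?thesis
    using mobius_osc_Harnack[OF g q z less_imp_le[OF r(1)] r(2) s u]
    unfolding eq by (simp only: vector_smult_assoc r_def \<delta>_def)
qed

section \<open>Integrals against the weight \<open>k t^(k-1)\<close>\<close>

lemma integral_power_weight:
  fixes a b :: real
  assumes "a \<le> b"
  shows "((\<lambda>t. real k * t ^ (k - 1)) has_integral (b ^ k - a ^ k)) {a..b}"
  by (rule fundamental_theorem_of_calculus[OF assms])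
    (auto intro!: derivative_eq_intros simp: has_real_derivative_iff_has_vector_derivative[symmetric])

lemma norm_integral_power_weight_le:
  fixes W :: "real \<Rightarrow> complex"
  assumes ab: "a \<le> b" "0 \<le> a" and W: "continuous_on {a..b} W" "\<And>t. t \<in> {a..b} \<Longrightarrow> norm (W t) \<le> y"
  shows "norm (integral {a..b} (\<lambda>t. of_real (real k * t ^ (k - 1)) * W t)) \<le> (b ^ k - a ^ k) * y"
proof -
  have h: "((\<lambda>t. real k * t ^ (k - 1) * y) has_integral ((b ^ k - a ^ k) * y)) {a..b}"
    by (intro has_integral_mult_left integral_power_weight ab)
  have "norm (integral {a..b} (\<lambda>t. of_real (real k * t ^ (k - 1)) * W t))
      \<le> integral {a..b} (\<lambda>t. real k * t ^ (k - 1) * y)"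
  proof (rule integral_norm_bound_integral)
    show "(\<lambda>t. of_real (real k * t ^ (k - 1)) * W t) integrable_on {a..b}"
      by (intro integrable_continuous_real continuous_intros W)
    show "norm (of_real (real k * t ^ (k - 1)) * W t) \<le> real k * t ^ (k - 1) * y" if "t \<in> {a..b}" for t
      using that ab W(2)[OF that] unfolding norm_mult norm_of_real
      by (intro mult_mono) auto
  qed (use h in blast)
  then show ?thesis unfolding integral_unique[OF h] .
qed

lemma norm_dyadic_integral_le:
  fixes W :: "real \<Rightarrow> complex"
  assumes W: "continuous_on {0..1} W"
    and y: "\<And>i t. 1 - (1 / 2) ^ i \<le> t \<Longrightarrow> t \<le> 1 - (1 / 2) ^ Suc i \<Longrightarrow> norm (W t) \<le> y i"
  shows "norm (integral {0..1 - (1 / 2) ^ I} (\<lambda>t. of_real (real (2 ^ N) * t ^ (2 ^ N - 1)) * W t))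
    \<le> (\<Sum>i<I. dyadic_weight N i * y i)"
proof (induction I)
  case (Suc I)
  define a b :: real where "a = 1 - (1 / 2) ^ I" and "b = 1 - (1 / 2) ^ Suc I"
  have ab: "0 \<le> a" "a \<le> b" "b \<le> 1" by (auto simp: a_def b_def power_le_one)
  define h where "h = (\<lambda>t. of_real (real (2 ^ N) * t ^ (2 ^ N - 1)) * W t)"
  have h: "h integrable_on {0..b}"
    unfolding h_def using ab
    by (intro integrable_continuous_real continuous_intros continuous_on_subset[OF W]) auto
  have "integral {0..b} h = integral {0..a} h + integral {a..b} h"
    using Henstock_Kurzweil_Integration.integral_combine[OF ab(1,2) h] by simp
  also have "norm \<dots> \<le> norm (integral {0..a} h) + norm (integral {a..b} h)"
    by (rule norm_triangle_ineq)
  also have "\<dots> \<le> (\<Sum>i<I. dyadic_weight N i * y i) + dyadic_weight N I * y I"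
  proof (rule add_mono)
    show "norm (integral {0..a} h) \<le> (\<Sum>i<I. dyadic_weight N i * y i)"
      using Suc unfolding a_def h_def .
    show "norm (integral {a..b} h) \<le> dyadic_weight N I * y I"
      unfolding h_def dyadic_weight_def a_def[symmetric] b_def[symmetric]
      using ab y[of I] by (intro norm_integral_power_weight_le continuous_on_subset[OF W]) (auto simp: a_def b_def)
  qed
  finally show ?case by (simp add: b_def h_def)
qed simp

text \<open>The function \<open>H_k\<close> of the overview. For \<open>k > 0\<close> the weight is
  a probability density, which for large \<open>k\<close> concentrates at distance about
  \<open>1 / k\<close> from 1.\<close>

definition dilation_defect :: "(complex ^ 'n \<Rightarrow> complex) \<Rightarrow> nat \<Rightarrow> complex ^ 'n \<Rightarrow> complex" where
  "dilation_defect g k z =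
     integral {0..1} (\<lambda>t. of_real (real k * t ^ (k - 1)) * (g z - g (of_real t *s z)))"

text \<open>Only \<open>K\<close> is uniform; the cutoff \<open>I\<close> may depend on everything
  but \<open>z\<close>. Since \<open>g\<close> is bounded on the closed ball of radius
  \<open>s\<close>, the part of the integral beyond \<open>1 - 2^-I\<close> is absorbed by
  \<open>\<delta>\<close>, and infinite sums of oscillations are avoided.\<close>

lemma dilation_defect_powr_le:
  assumes q: "q > 0"
  shows "\<exists>K\<ge>0. \<forall>(g :: complex ^ 'n \<Rightarrow> complex) N s \<delta>.
      g \<in> holo_ball \<longrightarrow> 0 \<le> s \<longrightarrow> s < 1 \<longrightarrow> \<delta> > 0 \<longrightarrow>
      (\<exists>I. \<forall>z. norm z = 1 \<longrightarrow> norm (dilation_defect g (2 ^ N) (of_real s *s z)) powr q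
        \<le> K * (\<Sum>i<I. dyadic_weight N i powr (q / 2) * mobius_osc q g s (1 - (1 / 2) ^ (i + 2)) z) + \<delta>)"
proof -
  \<comment> \<open>The outer \<open>2 powr q\<close> comes from splitting the integral at the
    cutoff, the inner power from the sum of the square roots of the weights, and 7 from the Harnack
    bound.\<close>
  define K where "K = 2 powr q * ((2 powr (1/2) * (2 / (1 - (1 / 2) powr (1/2)))) powr q * 7)"
  show ?thesis
  proof (intro exI[of _ K] conjI allI impI)
    fix g :: "complex ^ 'n \<Rightarrow> complex" and N :: nat and s \<delta> :: real
    assume g: "g \<in> holo_ball" and s: "0 \<le> s" "s < 1" and \<delta>: "\<delta> > 0"
    obtain B where B: "B \<ge> 0" "\<And>z. norm z \<le> s \<Longrightarrow> norm (g z) \<le> B"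
      using holo_ball_bounded[OF g s(2)] by blast
    have "(\<lambda>I. 2 powr q * (real (2 ^ N) * (1 / 2) ^ I * (2 * B)) powr q) \<longlonglongrightarrow> 2 powr q * (real (2 ^ N) * 0 * (2 * B)) powr q"
      using q B by (intro tendsto_intros tendsto_powr2 LIMSEQ_realpow_zero) auto
    then have "(\<lambda>I. 2 powr q * (real (2 ^ N) * (1 / 2) ^ I * (2 * B)) powr q) \<longlonglongrightarrow> 0" by simp
    then have "\<forall>\<^sub>F I in sequentially. 2 powr q * (real (2 ^ N) * (1 / 2) ^ I * (2 * B)) powr q < \<delta>"
      by (rule order_tendstoD(2)) (rule \<delta>)
    then obtain I where I: "2 powr q * (real (2 ^ N) * (1 / 2) ^ I * (2 * B)) powr q < \<delta>"
      by (auto simp: eventually_sequentially)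
    show "\<exists>I. \<forall>z. norm z = 1 \<longrightarrow> norm (dilation_defect g (2 ^ N) (of_real s *s z)) powr q
        \<le> K * (\<Sum>i<I. dyadic_weight N i powr (q / 2) * mobius_osc q g s (1 - (1 / 2) ^ (i + 2)) z) + \<delta>"
    proof (intro exI[of _ I] allI impI)
      fix z :: "complex ^ 'n" assume z: "norm z = 1"
      define A where "A = (\<lambda>i. mobius_osc q g s (1 - (1 / 2) ^ (i + 2)) z)"
      have A: "A i \<ge> 0" for i
        unfolding A_def mobius_osc_def by (intro Bochner_Integration.integral_nonneg) auto
      define y where "y = (\<lambda>i. (7 * A i) powr (1 / q))"
      define x where "x = complex_of_real s *s z"
      have x: "norm x = s" using z s by (simp add: x_def)
      define W where "W = (\<lambda>t::real. g x - g (of_real t *s x))"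
      have W: "continuous_on {0..1} W"
        unfolding W_def using x s by (intro continuous_intros continuous_on_real_line_smult g) auto
      have Wy: "norm (W t) \<le> y i" if "1 - (1 / 2) ^ i \<le> t" "t \<le> 1 - (1 / 2) ^ Suc i" for i t
      proof -
        have "(norm (W t) powr q) powr (1 / q) \<le> (7 * A i) powr (1 / q)"
          using dyadic_block_osc[OF g q z s that] q unfolding W_def x_def A_def by (intro powr_mono2) auto
        then show ?thesis using q by (simp add: powr_powr y_def)
      qed
      define a :: real where "a = 1 - (1 / 2) ^ I"
      have a: "0 \<le> a" "a \<le> 1" by (auto simp: a_def power_le_one)
      define h where "h = (\<lambda>t. of_real (real (2 ^ N) * t ^ (2 ^ N - 1)) * W t)"
      have h: "h integrable_on {0..1}"
        unfolding h_def by (intro integrable_continuous_real continuous_intros W)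
      have "dilation_defect g (2 ^ N) x = integral {0..a} h + integral {a..1} h"
        using Henstock_Kurzweil_Integration.integral_combine[OF a h]
        by (simp add: dilation_defect_def h_def W_def)
      then have "norm (dilation_defect g (2 ^ N) x) powr q
          \<le> 2 powr q * (norm (integral {0..a} h) powr q + norm (integral {a..1} h) powr q)"
        using norm_add_powr_le[of q "integral {0..a} h" "integral {a..1} h"] q by simp
      also have "norm (integral {0..a} h) powr q
        \<le> (2 powr (1/2) * (2 / (1 - (1 / 2) powr (1/2)))) powr q * 7 * (\<Sum>i<I. dyadic_weight N i powr (q / 2) * A i)"
      proof -
        have "norm (integral {0..a} h) \<le> (\<Sum>i<I. dyadic_weight N i * y i)"
          unfolding h_def a_def by (rule norm_dyadic_integral_le[OF W Wy])
        \<comment> \<open>One square root of each weight is summed uniformly in \<open>N\<close> by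
          \<open>weighted_sum_powr_le\<close>; the other stays with the oscillation, so that the
          decay away from \<open>i = N\<close> survives raising to the power
          \<open>q\<close>.\<close>
        also have "\<dots> = (\<Sum>i<I. dyadic_weight N i powr (1/2) * (dyadic_weight N i powr (1/2) * y i))"
          using dyadic_weight_nonneg by (intro sum.cong refl) (simp flip: mult.assoc powr_add)
        finally have "norm (integral {0..a} h) powr q
          \<le> (\<Sum>i<I. dyadic_weight N i powr (1/2) * (dyadic_weight N i powr (1/2) * y i)) powr q"
          using q by (intro powr_mono2) auto
        also have "\<dots> \<le> (\<Sum>i<I. dyadic_weight N i powr (1/2)) powr q * (\<Sum>i<I. (dyadic_weight N i powr (1/2) * y i) powr q)"
          using q by (intro weighted_sum_powr_le) (auto simp: y_def)
        also have "(\<Sum>i<I. (dyadic_weight N i powr (1/2) * y i) powr q) = (\<Sum>i<I. 7 * (dyadic_weight N i powr (q/2) * A i))"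
          using q A by (intro sum.cong refl) (simp add: y_def powr_mult powr_powr)
        also have "\<dots> = 7 * (\<Sum>i<I. dyadic_weight N i powr (q/2) * A i)" by (simp add: sum_distrib_left)
        also have "(\<Sum>i<I. dyadic_weight N i powr (1/2)) powr q \<le> (2 powr (1/2) * (2 / (1 - (1 / 2) powr (1/2)))) powr q"
          using q by (intro powr_mono2 dyadic_weight_powr_sum_le sum_nonneg) auto
        finally show ?thesis
          using A by (simp add: mult.assoc mult_right_mono sum_nonneg)
      qed
      also have "norm (integral {a..1} h) powr q \<le> (real (2 ^ N) * (1 / 2) ^ I * (2 * B)) powr q"
      proof (intro powr_mono2)
        have "norm (W t) \<le> 2 * B" if "t \<in> {a..1}" for t
        proof -
          have "norm (of_real t *s x) \<le> s" using that a x s by (simp add: mult_left_le_one_le)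
          then show ?thesis
            using norm_triangle_ineq4[of "g x" "g (of_real t *s x)"] B(2)[of x] B(2)[of "of_real t *s x"] x
            by (simp add: W_def)
        qed
        then have "norm (integral {a..1} h) \<le> (1 ^ (2 ^ N) - a ^ (2 ^ N)) * (2 * B)"
          unfolding h_def using a by (intro norm_integral_power_weight_le continuous_on_subset[OF W]) auto
        also have "\<dots> \<le> (real (2 ^ N) * (1 - a)) * (2 * B)"
          using a B by (intro mult_right_mono power_diff_le_mult) auto
        finally show "norm (integral {a..1} h) \<le> real (2 ^ N) * (1 / 2) ^ I * (2 * B)" by (simp add: a_def)
      qed (use q in auto)
      finally have "norm (dilation_defect g (2 ^ N) x) powr q
        \<le> 2 powr q * ((2 powr (1/2) * (2 / (1 - (1 / 2) powr (1/2)))) powr q * 7 * (\<Sum>i<I. dyadic_weight N i powr (q / 2) * A i)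
          + (real (2 ^ N) * (1 / 2) ^ I * (2 * B)) powr q)" by simp
      then have "norm (dilation_defect g (2 ^ N) x) powr q
        \<le> K * (\<Sum>i<I. dyadic_weight N i powr (q / 2) * A i) + \<delta>"
        using I by (simp add: K_def algebra_simps)
      then show "norm (dilation_defect g (2 ^ N) (of_real s *s z)) powr q
        \<le> K * (\<Sum>i<I. dyadic_weight N i powr (q / 2) * mobius_osc q g s (1 - (1 / 2) ^ (i + 2)) z) + \<delta>"
        by (simp only: A_def x_def)
    qed
  qed (simp add: K_def)
qed

text \<open>The blocks are split at an index \<open>J\<close>. For \<open>i \<ge> J\<close> both
  \<open>s\<close> and \<open>s * R i\<close> are so close to 1 that the means of
  \<open>|g|^q\<close> at these radii differ by at most \<open>e\<close>. For \<open>i < J\<close>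
  their difference is only bounded by the supremum \<open>M\<close>, but the weights of these blocks
  tend to 0 as \<open>N\<close> grows.\<close>

lemma dilation_defect_small:
  fixes g :: "complex ^ 'n \<Rightarrow> complex"
  assumes g: "g \<in> hardy_space q" and q: "q > 0" and \<eta>: "\<eta> > 0"
  shows "\<exists>N0 s0. 0 \<le> s0 \<and> s0 < 1 \<and> (\<forall>N\<ge>N0. \<forall>s\<in>{s0..<1}. \<exists>X. integrable sphere_measure X \<and> (\<forall>z. X z \<ge> 0) \<and>
       (\<forall>z. norm z = 1 \<longrightarrow> norm (dilation_defect g (2 ^ N) (of_real s *s z)) powr q \<le> X z) \<and>
       (LINT z|sphere_measure. X z) \<le> \<eta>)"
proof -
  have gh: "g \<in> holo_ball" and bdd: "bdd_above (hardy_mean q g ` {0..<1})"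
    using g unfolding hardy_space_iff[OF q] bdd_above_def by auto
  define M where "M = (SUP s\<in>{0..<1}. hardy_mean q g s)"
  have M_upper: "hardy_mean q g s \<le> M" if "0 \<le> s" "s < 1" for s
    unfolding M_def using that by (intro cSUP_upper bdd) auto
  have M0: "M \<ge> 0" using M_upper[of 0] hardy_mean_nonneg[of q g 0] by simp
  have M_approx: "\<exists>s1. 0 \<le> s1 \<and> s1 < 1 \<and> hardy_mean q g s1 > M - e" if "e > 0" for e
  proof -
    have "M - e < M" using that by simp
    then show ?thesis using less_cSUP_iff[OF _ bdd, of "M - e"] unfolding M_def by force
  qed
  obtain K where K: "K \<ge> 0" and dil: "\<And>N s \<delta>. 0 \<le> s \<Longrightarrow> s < 1 \<Longrightarrow> \<delta> > 0 \<Longrightarrow>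
      \<exists>I. \<forall>z. norm z = 1 \<longrightarrow> norm (dilation_defect g (2 ^ N) (of_real s *s z)) powr q
        \<le> K * (\<Sum>i<I. dyadic_weight N i powr (q / 2) * mobius_osc q g s (1 - (1 / 2) ^ (i + 2)) z) + \<delta>"
    using dilation_defect_powr_le[OF q, where 'n = 'n] gh by blast
  define \<rho> where "\<rho> = (1 / 2 :: real) powr (q / 2)"
  have \<rho>: "0 < \<rho>" "\<rho> < 1" using q powr_less_mono2[of "q / 2" "1/2" 1] by (auto simp: \<rho>_def)
  define K' where "K' = 2 powr (q / 2) * (2 / (1 - \<rho>))"
  have K': "K' \<ge> 0" using \<rho> by (simp add: K'_def)
  \<comment> \<open>Each of four contributions to the final estimate is allotted
    \<open>\<eta> / 8\<close>; the added 1 keeps the denominator positive.\<close>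
  define \<epsilon> where "\<epsilon> = \<eta> / (8 * (K * K' * M + 1))"
  have KM: "K * K' * M \<ge> 0" using K K' M0 by simp
  then have \<epsilon>: "\<epsilon> > 0" using \<eta> by (simp add: \<epsilon>_def)
  have \<epsilon>_le: "K * K' * M * \<epsilon> \<le> \<eta> / 8"
  proof -
    have "K * K' * M * \<epsilon> \<le> (K * K' * M + 1) * \<epsilon>" using \<epsilon> by (intro mult_right_mono) auto
    also have "\<dots> = \<eta> / 8" using KM by (simp add: \<epsilon>_def field_simps)
    finally show ?thesis .
  qed
  obtain C where C: "C \<ge> 0" and osc: "\<And>r s. 0 \<le> r \<Longrightarrow> r < 1 \<Longrightarrow> 0 \<le> s \<Longrightarrow> s < 1 \<Longrightarrow>
      integrable sphere_measure (mobius_osc q g s r) \<and>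
      (LINT z|sphere_measure. mobius_osc q g s r z)
        \<le> \<epsilon> * hardy_mean q g (s * r) + C * (hardy_mean q g s - hardy_mean q g (s * r))"
    using integral_mobius_osc_le[OF q \<epsilon>, where 'n = 'n] gh by blast
  define e where "e = \<eta> / (8 * (K * K' * C + 1))"
  have KC: "K * K' * C \<ge> 0" using K K' C by simp
  then have e: "e > 0" using \<eta> by (simp add: e_def)
  have e_le: "K * K' * C * e \<le> \<eta> / 8"
  proof -
    have "K * K' * C * e \<le> (K * K' * C + 1) * e" using e by (intro mult_right_mono) auto
    also have "\<dots> = \<eta> / 8" using KC by (simp add: e_def field_simps)
    finally show ?thesis .
  qed
  obtain s1 where s1: "0 \<le> s1" "s1 < 1" "hardy_mean q g s1 > M - e" using M_approx[OF e] by blast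
  define R where "R = (\<lambda>i::nat. 1 - (1 / 2 :: real) ^ (i + 2))"
  have R: "0 \<le> R i" "R i < 1" for i
    unfolding R_def using power_le_one[of "1/2 :: real" "i + 2"] by (auto simp del: power_Suc)
  have R_mono: "R i \<le> R j" if "i \<le> j" for i j
    unfolding R_def using that by (intro diff_left_mono power_decreasing) auto
  \<comment> \<open>The square appears because \<open>s \<ge> R J\<close> and
    \<open>i \<ge> J\<close> give \<open>s * R i \<ge> R J * R J\<close>, which must exceed
    \<open>s1\<close>.\<close>
  have "(\<lambda>i. (1 - (1 / 2 :: real) ^ (i + 2))\<^sup>2) \<longlonglongrightarrow> (1 - 0)\<^sup>2"
    by (intro tendsto_intros LIMSEQ_ignore_initial_segment LIMSEQ_realpow_zero) auto
  then have "\<forall>\<^sub>F i in sequentially. (R i)\<^sup>2 > s1"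
    unfolding R_def using s1 by (intro order_tendstoD(1)) auto
  then obtain J where J: "(R J)\<^sup>2 > s1" by (auto simp: eventually_sequentially)
  have "(\<lambda>m. K * (C * M * (real J * (2 powr (q / 2) * \<rho> ^ m)))) \<longlonglongrightarrow> K * (C * M * (real J * (2 powr (q / 2) * 0)))"
    using \<rho> by (intro tendsto_intros LIMSEQ_realpow_zero) auto
  then have "\<forall>\<^sub>F m in sequentially. K * (C * M * (real J * (2 powr (q / 2) * \<rho> ^ m))) < \<eta> / 8"
    using \<eta> by (intro order_tendstoD(2)) auto
  then obtain m0 where m0: "\<And>m. m \<ge> m0 \<Longrightarrow> K * (C * M * (real J * (2 powr (q / 2) * \<rho> ^ m))) < \<eta> / 8"
    by (auto simp: eventually_sequentially)
  show ?thesis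
  proof (intro exI[of _ "J + m0"] exI[of _ "R J"] conjI allI impI ballI)
    fix N s assume N: "J + m0 \<le> N" and "s \<in> {R J..<1}"
    then have s: "R J \<le> s" "s < 1" by auto
    have s0: "0 \<le> s" using s R[of J] by simp
    obtain I where I: "\<And>z. norm z = 1 \<Longrightarrow> norm (dilation_defect g (2 ^ N) (of_real s *s z)) powr q
        \<le> K * (\<Sum>i<I. dyadic_weight N i powr (q / 2) * mobius_osc q g s (R i) z) + \<eta> / 8"
      using dil[OF s0 s(2), of "\<eta> / 8" N] \<eta> unfolding R_def by auto
    define w where "w = (\<lambda>i. dyadic_weight N i powr (q / 2))"
    have w: "w i \<ge> 0" for i by (simp add: w_def)
    define X where "X = (\<lambda>z. K * (\<Sum>i<I. w i * mobius_osc q g s (R i) z) + \<eta> / 8)"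
    have int: "integrable sphere_measure (mobius_osc q g s (R i))" for i
      using osc[OF R s0 s(2)] by simp
    have X_int: "integrable sphere_measure X"
      unfolding X_def by (intro Bochner_Integration.integrable_add integrable_mult_right
          Bochner_Integration.integrable_sum int sphere.integrable_const)
    have osc_nonneg: "mobius_osc q g s r z \<ge> 0" for r z
      unfolding mobius_osc_def by (intro Bochner_Integration.integral_nonneg) auto
    have X_nonneg: "X z \<ge> 0" for z
      unfolding X_def using K \<eta> w osc_nonneg by (intro add_nonneg_nonneg mult_nonneg_nonneg sum_nonneg) auto
    have osc_le: "(LINT z|sphere_measure. mobius_osc q g s (R i) z) \<le> (\<epsilon> * M + C * e) + C * M * (if i \<in> {..<J} then 1 else 0)" for i
    proof -
      have sr: "0 \<le> s * R i" "s * R i < 1"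
        using s0 s R[of i] mult_left_le[of "R i" s] by auto
      have "hardy_mean q g s - hardy_mean q g (s * R i) \<le> e + M * (if i \<in> {..<J} then 1 else 0)"
      proof (cases "i < J")
        case True
        then show ?thesis using M_upper[OF s0 s(2)] hardy_mean_nonneg[of q g "s * R i"] e by simp
      next
        case False
        have "s1 \<le> R J * R J" using J by (simp add: power2_eq_square)
        also have "\<dots> \<le> s * R i" using False s R s0 by (intro mult_mono R_mono) auto
        finally have "hardy_mean q g s1 \<le> hardy_mean q g (s * R i)"
          using sr s1 by (intro hardy_mean_mono gh q) auto
        then show ?thesis using False s1(3) M_upper[OF s0 s(2)] by simp
      qed
      then have "C * (hardy_mean q g s - hardy_mean q g (s * R i)) \<le> C * (e + M * (if i \<in> {..<J} then 1 else 0))"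
        using C by (intro mult_left_mono)
      moreover have "\<epsilon> * hardy_mean q g (s * R i) \<le> \<epsilon> * M"
        using M_upper[OF sr] \<epsilon> by (intro mult_left_mono) auto
      ultimately show ?thesis using osc[OF R s0 s(2), of i] by (simp add: algebra_simps)
    qed
    have "(LINT z|sphere_measure. X z) = K * (\<Sum>i<I. w i * (LINT z|sphere_measure. mobius_osc q g s (R i) z)) + \<eta> / 8"
      unfolding X_def using int by simp
    also have "(\<Sum>i<I. w i * (LINT z|sphere_measure. mobius_osc q g s (R i) z))
      \<le> (\<Sum>i<I. w i * ((\<epsilon> * M + C * e) + C * M * (if i \<in> {..<J} then 1 else 0)))"
      by (intro sum_mono mult_left_mono osc_le w)
    also have "\<dots> = (\<epsilon> * M + C * e) * (\<Sum>i<I. w i) + C * M * (\<Sum>i<I. if i \<in> {..<J} then w i else 0)"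
      unfolding sum_distrib_left sum.distrib[symmetric] by (intro sum.cong) (auto simp: algebra_simps)
    also have "(\<Sum>i<I. if i \<in> {..<J} then w i else 0) = (\<Sum>i\<in>{..<I} \<inter> {..<J}. w i)"
      by (rule sum.inter_restrict[symmetric]) simp
    also have "(\<Sum>i\<in>{..<I} \<inter> {..<J}. w i) \<le> real J * (2 powr (q / 2) * \<rho> ^ (N - J))"
    proof -
      have "(\<Sum>i\<in>{..<I} \<inter> {..<J}. w i) \<le> (\<Sum>i<J. w i)" using w by (intro sum_mono2) auto
      also have "\<dots> \<le> (\<Sum>i<J. 2 powr (q / 2) * \<rho> ^ (N - J))"
      proof (rule sum_mono)
        fix i assume "i \<in> {..<J}"
        then have i: "i < J" "i \<le> N" using N by auto
        have "w i \<le> 2 powr (q / 2) * (\<rho> ^ (N - i) * \<rho> ^ (i - N))"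
          unfolding w_def \<rho>_def using q by (intro dyadic_weight_powr_le) auto
        also have "\<rho> ^ (N - i) * \<rho> ^ (i - N) = \<rho> ^ (N - i)" using i by simp
        also have "\<rho> ^ (N - i) \<le> \<rho> ^ (N - J)" using i \<rho> by (intro power_decreasing) auto
        finally show "w i \<le> 2 powr (q / 2) * \<rho> ^ (N - J)" by simp
      qed
      finally show ?thesis by simp
    qed
    also have "(\<Sum>i<I. w i) \<le> K'"
      unfolding w_def K'_def \<rho>_def using q by (intro dyadic_weight_powr_sum_le) auto
    finally have "(LINT z|sphere_measure. X z) \<le> K * ((\<epsilon> * M + C * e) * K' + C * M * (real J * (2 powr (q / 2) * \<rho> ^ (N - J)))) + \<eta> / 8"
      using K C M0 \<epsilon> e by (simp add: mult_left_mono)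
    also have "\<dots> = K * K' * M * \<epsilon> + K * K' * C * e + K * (C * M * (real J * (2 powr (q / 2) * \<rho> ^ (N - J)))) + \<eta> / 8"
      by (simp add: algebra_simps)
    also have "\<dots> \<le> \<eta>"
    proof -
      have "m0 \<le> N - J" using N by simp
      then show ?thesis using \<epsilon>_le e_le m0[of "N - J"] \<eta> by linarith
    qed
    finally have "(LINT z|sphere_measure. X z) \<le> \<eta>" .
    then show "\<exists>X. integrable sphere_measure X \<and> (\<forall>z. X z \<ge> 0) \<and>
       (\<forall>z. norm z = 1 \<longrightarrow> norm (dilation_defect g (2 ^ N) (of_real s *s z)) powr q \<le> X z) \<and>
       (LINT z|sphere_measure. X z) \<le> \<eta>"
      using X_int X_nonneg I by (intro exI[of _ X]) (auto simp: X_def w_def)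
  qed (use R in auto)
qed

subsection \<open>Random homogeneous polynomials\<close>

text \<open>Continuity on the whole space is included because membership in \<open>holo_ball\<close>
  says nothing about the sphere, over which these functions are integrated.\<close>

definition homogeneous :: "nat \<Rightarrow> (complex ^ 'n \<Rightarrow> complex) \<Rightarrow> bool" where
  "homogeneous k \<phi> \<longleftrightarrow> \<phi> \<in> holo_ball \<and> continuous_on UNIV \<phi> \<and> (\<forall>c z. \<phi> (c *s z) = c ^ k * \<phi> z)"

lemma homogeneous_add: "homogeneous k \<phi> \<Longrightarrow> homogeneous k \<psi> \<Longrightarrow> homogeneous k (\<lambda>z. \<phi> z + \<psi> z)"
  unfolding homogeneous_def by (auto intro: holo_ball_add continuous_intros simp: algebra_simps)

lemma homogeneous_cmult: "homogeneous k \<phi> \<Longrightarrow> homogeneous k (\<lambda>z. a * \<phi> z)"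
  unfolding homogeneous_def
  by (auto intro!: holo_ball_mult holo_ball_const continuous_intros simp: algebra_simps)

lemma homogeneous_diff: "homogeneous k \<phi> \<Longrightarrow> homogeneous k \<psi> \<Longrightarrow> homogeneous k (\<lambda>z. \<phi> z - \<psi> z)"
  using homogeneous_add[of k \<phi> "\<lambda>z. - 1 * \<psi> z"] homogeneous_cmult[of k \<psi> "- 1"] by simp

lemma homogeneous_0: "homogeneous k (\<lambda>_. 0)"
  unfolding homogeneous_def by (auto intro: holo_ball_const)

text \<open>The normalized monomials: the squares of their moduli are the terms of the multinomial
  expansion of \<open>(\<Sum>i\<in>A. |z_i|^2)^k\<close>, obtained by adding one coordinate at a time.\<close>

lemma homogeneous_family_exists:
  fixes A :: "'n::finite set"
  shows "\<exists>L :: (complex ^ 'n \<Rightarrow> complex) list. length L \<le> (k + 1) ^ card A \<and> (\<forall>\<phi>\<in>set L. homogeneous k \<phi>) \<and>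
     (\<forall>z. (\<Sum>\<phi>\<leftarrow>L. norm (\<phi> z) ^ 2) = (\<Sum>i\<in>A. norm (z $ i) ^ 2) ^ k)"
proof -
  have "finite A" by simp
  then show ?thesis
  proof (induction A arbitrary: k rule: finite_induct)
    case empty
    show ?case
    proof (cases "k = 0")
      case True
      then show ?thesis
        by (intro exI[of _ "[\<lambda>_. 1]"]) (auto simp: homogeneous_def intro: holo_ball_const)
    next
      case False
      then show ?thesis by (intro exI[of _ "[]"]) (auto simp: power_0_left)
    qed
  next
    case (insert a A)
    then obtain L :: "nat \<Rightarrow> (complex ^ 'n \<Rightarrow> complex) list" where L: "\<And>k. length (L k) \<le> (k + 1) ^ card A"
      "\<And>k \<phi>. \<phi> \<in> set (L k) \<Longrightarrow> homogeneous k \<phi>"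
      "\<And>k z. (\<Sum>\<phi>\<leftarrow>L k. norm (\<phi> z) ^ 2) = (\<Sum>i\<in>A. norm (z $ i) ^ 2) ^ k"
      by metis
    \<comment> \<open>The square root makes the squared modulus the binomial coefficient times the
      \<open>j\<close>-th power of \<open>|z_a|^2\<close>, which is one term of the binomial
      expansion.\<close>
    define T where "T = (\<lambda>j (\<phi> :: complex ^ 'n \<Rightarrow> complex) z. of_real (sqrt (real (k choose j))) * (z $ a) ^ j * \<phi> z)"
    define L' where "L' = concat (map (\<lambda>j. map (T j) (L (k - j))) [0..<Suc k])"
    have len: "length L' \<le> (k + 1) ^ card (insert a A)"
    proof -
      have "length L' = (\<Sum>j<Suc k. length (L (k - j)))"
        by (simp add: L'_def length_concat o_def sum_list_distinct_conv_sum_set lessThan_atLeast0 del: upt_Suc)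
      also have "\<dots> \<le> (\<Sum>j<Suc k. (k + 1) ^ card A)"
        using L(1) by (intro sum_mono order.trans[OF L(1)] power_mono) auto
      finally show ?thesis using insert.hyps by simp
    qed
    have hom: "homogeneous k \<psi>" if \<psi>: "\<psi> \<in> set L'" for \<psi>
    proof -
      obtain j \<phi> where j: "j \<le> k" "\<phi> \<in> set (L (k - j))" "\<psi> = T j \<phi>"
        using \<psi> by (auto simp: L'_def less_Suc_eq_le simp del: upt_Suc)
      have \<phi>: "homogeneous (k - j) \<phi>" using L(2) j by blast
      have "(c * z $ a) ^ j * \<phi> (c *s z) = c ^ k * ((z $ a) ^ j * \<phi> z)" for c z
      proof -
        have "c ^ k = c ^ j * c ^ (k - j)" using j by (simp flip: power_add)
        then show ?thesis using \<phi> by (simp add: homogeneous_def power_mult_distrib)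
      qed
      then show ?thesis
        using \<phi> unfolding j(3) T_def homogeneous_def
        by (auto intro!: holo_ball_mult holo_ball_const holo_ball_power holo_ball_component continuous_intros
            simp: mult.assoc)
    qed
    have sum: "(\<Sum>\<phi>\<leftarrow>L'. norm (\<phi> z) ^ 2) = (\<Sum>i\<in>insert a A. norm (z $ i) ^ 2) ^ k" for z
    proof -
      have concat: "(\<Sum>x\<leftarrow>concat (map h xs). f x) = (\<Sum>j\<leftarrow>xs. \<Sum>x\<leftarrow>h j. f x)"
        for h :: "nat \<Rightarrow> (complex ^ 'n \<Rightarrow> complex) list" and xs and f :: "_ \<Rightarrow> real"
        by (induction xs) auto
      have T2: "norm (T j \<phi> z) ^ 2 = real (k choose j) * (norm (z $ a) ^ 2) ^ j * norm (\<phi> z) ^ 2" for j \<phi>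
        by (simp add: T_def norm_mult norm_power power_mult_distrib power_even_eq[symmetric] mult.commute
            flip: power_mult)
      have inner: "(\<Sum>\<phi>\<leftarrow>map (T j) (L (k - j)). norm (\<phi> z) ^ 2)
        = real (k choose j) * (norm (z $ a) ^ 2) ^ j * (\<Sum>i\<in>A. norm (z $ i) ^ 2) ^ (k - j)" for j
        by (simp add: o_def T2 sum_list_const_mult L(3))
      have "(\<Sum>\<phi>\<leftarrow>L'. norm (\<phi> z) ^ 2) = (\<Sum>j\<leftarrow>[0..<Suc k]. \<Sum>\<phi>\<leftarrow>map (T j) (L (k - j)). norm (\<phi> z) ^ 2)"
        unfolding L'_def by (rule concat)
      also have "\<dots> = (\<Sum>j\<le>k. real (k choose j) * (norm (z $ a) ^ 2) ^ j * (\<Sum>i\<in>A. norm (z $ i) ^ 2) ^ (k - j))"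
        unfolding inner by (simp add: sum_list_distinct_conv_sum_set atLeast0_lessThan_Suc atLeastLessThanSuc_atLeastAtMost atMost_atLeast0 del: upt_Suc)
      also have "\<dots> = (norm (z $ a) ^ 2 + (\<Sum>i\<in>A. norm (z $ i) ^ 2)) ^ k"
        by (rule binomial_ring[symmetric])
      finally show ?thesis using insert.hyps by simp
    qed
    show ?case using len hom sum by (intro exI[of _ L']) auto
  qed
qed

text \<open>The sums over all choices of signs, kept as a list so that coinciding ones count with
  multiplicity. Expectations over independent fair signs become sums over this list divided by its
  length.\<close>

primrec signed_sums :: "('a \<Rightarrow> complex) list \<Rightarrow> ('a \<Rightarrow> complex) list" where
  "signed_sums [] = [\<lambda>_. 0]"
| "signed_sums (\<phi> # L) = map (\<lambda>F z. F z + \<phi> z) (signed_sums L) @ map (\<lambda>F z. F z - \<phi> z) (signed_sums L)"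

lemma length_signed_sums: "length (signed_sums L) = 2 ^ length L"
  by (induction L) auto

lemma homogeneous_signed_sums:
  assumes "\<forall>\<phi>\<in>set L. homogeneous k \<phi>" "F \<in> set (signed_sums L)"
  shows "homogeneous k F"
  using assms by (induction L arbitrary: F) (auto intro: homogeneous_add homogeneous_diff homogeneous_0)

lemma norm_signed_sums_le:
  assumes "F \<in> set (signed_sums L)"
  shows "norm (F z) \<le> (\<Sum>\<phi>\<leftarrow>L. norm (\<phi> z))"
  using assms
proof (induction L arbitrary: F)
  case (Cons \<phi> L)
  then obtain G where G: "G \<in> set (signed_sums L)" "F = (\<lambda>z. G z + \<phi> z) \<or> F = (\<lambda>z. G z - \<phi> z)" by auto
  then show ?case
    using Cons.IH[OF G(1)] norm_triangle_ineq[of "G z" "\<phi> z"] norm_triangle_ineq4[of "G z" "\<phi> z"] by auto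
qed simp

text \<open>The parallelogram law cancels the cross terms of \<open>x + \<phi> z\<close> and
  \<open>x - \<phi> z\<close>; the shift \<open>x\<close> is what carries the induction.\<close>

lemma signed_sums_second_moment:
  "(\<Sum>F\<leftarrow>signed_sums L. norm (x + F z) ^ 2) = 2 ^ length L * (norm x ^ 2 + (\<Sum>\<phi>\<leftarrow>L. norm (\<phi> z) ^ 2))"
proof (induction L arbitrary: x)
  case (Cons \<phi> L)
  have "norm (x + \<phi> z) ^ 2 + norm (x - \<phi> z) ^ 2 = 2 * norm x ^ 2 + 2 * norm (\<phi> z) ^ 2"
    by (simp only: cmod_power2) (simp add: power2_eq_square algebra_simps)
  moreover have "(\<Sum>F\<leftarrow>signed_sums (\<phi> # L). norm (x + F z) ^ 2)
    = (\<Sum>F\<leftarrow>signed_sums L. norm ((x + \<phi> z) + F z) ^ 2) + (\<Sum>F\<leftarrow>signed_sums L. norm ((x - \<phi> z) + F z) ^ 2)"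
    by (simp add: o_def algebra_simps)
  moreover have "c * (a + d) + c * (b + d) = c * ((a + b) + 2 * d)" for a b c d :: real
    by (simp add: algebra_simps)
  ultimately show ?case unfolding Cons.IH by (simp only:) (simp add: algebra_simps)
qed simp

text \<open>The sub-Gaussian bound for a fair sign: \<open>ln (cosh x)\<close> has derivative
  \<open>tanh x\<close>, which is at most \<open>x\<close> for \<open>x \<ge> 0\<close>.\<close>

lemma cosh_le_exp_square: "cosh x \<le> exp (x\<^sup>2 / 2)" for x :: real
proof -
  have mono: "ln (cosh x) \<le> x\<^sup>2 / 2" if "x \<ge> 0" for x :: real
  proof -
    have tanh: "tanh y \<le> y" if "y \<ge> 0" for y :: real
    proof -
      have "0 - tanh 0 \<le> y - tanh y"
      proof (rule DERIV_nonneg_imp_nondecreasing[OF that])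
        fix u :: real
        have "((\<lambda>u. u - tanh u) has_real_derivative (tanh u)\<^sup>2) (at u)"
          by (auto intro!: derivative_eq_intros)
        then show "\<exists>d. ((\<lambda>u. u - tanh u) has_real_derivative d) (at u) \<and> 0 \<le> d" by auto
      qed
      then show ?thesis by simp
    qed
    have "0\<^sup>2 / 2 - ln (cosh 0) \<le> x\<^sup>2 / 2 - ln (cosh x)"
    proof (rule DERIV_nonneg_imp_nondecreasing[OF that])
      fix u :: real assume "0 \<le> u"
      have "((\<lambda>u. u\<^sup>2 / 2 - ln (cosh u)) has_real_derivative (u - tanh u)) (at u)"
        by (auto intro!: derivative_eq_intros simp: tanh_def)
      then show "\<exists>d. ((\<lambda>u. u\<^sup>2 / 2 - ln (cosh u)) has_real_derivative d) (at u) \<and> 0 \<le> d"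
        using tanh[OF \<open>0 \<le> u\<close>] by auto
    qed
    then show ?thesis by simp
  qed
  have "ln (cosh x) \<le> x\<^sup>2 / 2" using mono[of "\<bar>x\<bar>"] by simp
  then have "exp (ln (cosh x)) \<le> exp (x\<^sup>2 / 2)" by (rule exp_le_cancel_iff[THEN iffD2])
  then show ?thesis by (simp only: exp_ln[OF cosh_real_pos])
qed

text \<open>Averaging over the sign of \<open>\<phi>\<close> produces the factor
  \<open>cosh (l (\<phi> z))\<close>, so the moment factorizes as for independent signs.\<close>

lemma signed_sums_exp_moment:
  assumes l: "\<And>x y. l (x + y) = l x + l y" "\<And>x y. l (x - y) = l x - (l y :: real)"
  shows "(\<Sum>F\<leftarrow>signed_sums L. exp (l (F z))) \<le> 2 ^ length L * exp ((\<Sum>\<phi>\<leftarrow>L. (l (\<phi> z))\<^sup>2) / 2)"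
proof (induction L)
  case Nil
  have "l 0 = 0" using l(1)[of 0 0] by simp
  then show ?case by simp
next
  case (Cons \<phi> L)
  have "(\<Sum>F\<leftarrow>signed_sums (\<phi> # L). exp (l (F z)))
      = (\<Sum>F\<leftarrow>signed_sums L. exp (l (\<phi> z)) * exp (l (F z))) + (\<Sum>F\<leftarrow>signed_sums L. exp (- l (\<phi> z)) * exp (l (F z)))"
    by (simp add: o_def l exp_add[symmetric] algebra_simps)
  also have "\<dots> = 2 * cosh (l (\<phi> z)) * (\<Sum>F\<leftarrow>signed_sums L. exp (l (F z)))"
    unfolding sum_list_const_mult by (simp add: cosh_def algebra_simps)
  also have "\<dots> \<le> 2 * exp ((l (\<phi> z))\<^sup>2 / 2) * (2 ^ length L * exp ((\<Sum>\<phi>\<leftarrow>L. (l (\<phi> z))\<^sup>2) / 2))"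
    using Cons cosh_le_exp_square[of "l (\<phi> z)"] by (intro mult_mono sum_list_nonneg) auto
  also have "\<dots> = 2 ^ length (\<phi> # L) * exp ((\<Sum>\<phi>\<leftarrow>\<phi> # L. (l (\<phi> z))\<^sup>2) / 2)"
    by (simp add: exp_add add_divide_distrib)
  finally show ?case .
qed

text \<open>The exponential of the norm is split into those of plus and minus twice the real and
  imaginary parts. The squares of such a functional at the \<open>\<phi> z\<close> sum to at most 4,
  so each moment contributes \<open>exp 2\<close>, and half of the four moments is
  \<open>2 * exp 2\<close>, whatever the number of summands.\<close>

lemma signed_sums_exp_norm:
  assumes one: "(\<Sum>\<phi>\<leftarrow>L. norm (\<phi> z) ^ 2) = 1"
  shows "(\<Sum>F\<leftarrow>signed_sums L. exp (norm (F z))) \<le> 2 ^ length L * (2 * exp 2)"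
proof -
  have pw: "exp (norm w) \<le> (exp (2 * Re w) + exp (- 2 * Re w) + (exp (2 * Im w) + exp (- 2 * Im w))) / 2" for w
  proof -
    have a: "exp (2 * \<bar>x\<bar>) \<le> exp (2 * x) + exp (- 2 * x)" for x :: real by (cases "x \<ge> 0") auto
    have "exp (norm w) \<le> exp \<bar>Re w\<bar> * exp \<bar>Im w\<bar>"
      using cmod_le[of w] by (simp flip: exp_add)
    also have "\<dots> \<le> ((exp \<bar>Re w\<bar>)\<^sup>2 + (exp \<bar>Im w\<bar>)\<^sup>2) / 2"
      using sum_squares_bound[of "exp \<bar>Re w\<bar>" "exp \<bar>Im w\<bar>"] by simp
    also have "\<dots> = (exp (2 * \<bar>Re w\<bar>) + exp (2 * \<bar>Im w\<bar>)) / 2"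
      by (simp add: exp_double)
    also have "\<dots> \<le> (exp (2 * Re w) + exp (- 2 * Re w) + (exp (2 * Im w) + exp (- 2 * Im w))) / 2"
      using a[of "Re w"] a[of "Im w"] by simp
    finally show ?thesis .
  qed
  have mom: "(\<Sum>F\<leftarrow>signed_sums L. exp (l (F z))) \<le> 2 ^ length L * exp 2"
    if l: "\<And>x y. l (x + y) = l x + l y" "\<And>x y. l (x - y) = l x - (l y :: real)" "\<And>x. (l x)\<^sup>2 \<le> 4 * norm x ^ 2" for l
  proof -
    have "(\<Sum>\<phi>\<leftarrow>L. (l (\<phi> z))\<^sup>2) \<le> (\<Sum>\<phi>\<leftarrow>L. 4 * norm (\<phi> z) ^ 2)"
      using l(3) by (intro sum_list_mono) auto
    also have "\<dots> = 4" using one by (simp add: sum_list_const_mult)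
    finally have "exp ((\<Sum>\<phi>\<leftarrow>L. (l (\<phi> z))\<^sup>2) / 2) \<le> exp 2" by simp
    then have "2 ^ length L * exp ((\<Sum>\<phi>\<leftarrow>L. (l (\<phi> z))\<^sup>2) / 2) \<le> 2 ^ length L * exp 2"
      by (intro mult_left_mono) auto
    then show ?thesis using signed_sums_exp_moment[where l = l and L = L and z = z, OF l(1,2)] by linarith
  qed
  have sq: "(2 * Re x)\<^sup>2 \<le> 4 * norm x ^ 2" "(2 * Im x)\<^sup>2 \<le> 4 * norm x ^ 2" for x
    by (simp_all add: cmod_power2 power_mult_distrib)
  have "(\<Sum>F\<leftarrow>signed_sums L. exp (norm (F z)))
     \<le> (\<Sum>F\<leftarrow>signed_sums L. (exp (2 * Re (F z)) + exp (- 2 * Re (F z)) + (exp (2 * Im (F z)) + exp (- 2 * Im (F z)))) / 2)"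
    by (intro sum_list_mono pw)
  also have "\<dots> = ((\<Sum>F\<leftarrow>signed_sums L. exp (2 * Re (F z))) + (\<Sum>F\<leftarrow>signed_sums L. exp (- 2 * Re (F z)))
      + ((\<Sum>F\<leftarrow>signed_sums L. exp (2 * Im (F z))) + (\<Sum>F\<leftarrow>signed_sums L. exp (- 2 * Im (F z))))) / 2"
    by (simp only: divide_inverse sum_list_mult_const sum_list_addf)
  also have "\<dots> \<le> 2 ^ length L * (2 * exp 2)"
    using mom[of "\<lambda>x. 2 * Re x"] mom[of "\<lambda>x. - 2 * Re x"] mom[of "\<lambda>x. 2 * Im x"] mom[of "\<lambda>x. - 2 * Im x"] sq
    by (simp add: algebra_simps)
  finally show ?thesis .
qed

lemma powr_le_exp:
  assumes "q > 0"
  shows "\<exists>K>0. \<forall>t\<ge>0. t powr q \<le> K * exp (t::real)"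
proof -
  obtain m :: nat where m: "q \<le> real m" using real_arch_simple by blast
  have m0: "m > 0" using m assms by (cases m) auto
  have "t powr q \<le> (1 + real m ^ m) * exp t" if t: "t \<ge> 0" for t
  proof (cases "t \<le> 1")
    case True
    then have "t powr q \<le> 1" using t assms by (intro powr_le1) auto
    also have "1 \<le> (1 + real m ^ m) * exp t"
      using t mult_mono[of 1 "1 + real m ^ m" 1 "exp t"] by simp
    finally show ?thesis .
  next
    case False
    then have "t powr q \<le> t powr real m" using m by (intro powr_mono) auto
    also have "\<dots> = real m ^ m * (t / real m) ^ m" using False m0 by (simp add: powr_realpow power_divide)
    also have "\<dots> \<le> real m ^ m * exp (t / real m) ^ m"
      using t exp_ge_add_one_self[of "t / real m"] by (intro mult_left_mono power_mono) (auto simp del: exp_ge_add_one_self)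
    also have "exp (t / real m) ^ m = exp t" using m0 by (simp flip: exp_of_nat_mult)
    also have "real m ^ m * exp t \<le> (1 + real m ^ m) * exp t" by (intro mult_right_mono) auto
    finally show ?thesis .
  qed
  then show ?thesis by (intro exI[of _ "1 + real m ^ m"]) (auto intro: add_pos_nonneg)
qed

lemma norm_vec_square: "norm (z :: complex ^ 'n) ^ 2 = (\<Sum>i\<in>UNIV. norm (z $ i) ^ 2)"
  by (simp add: norm_vec_def L2_set_def sum_nonneg)

lemma exists_ge_average:
  fixes \<Phi> :: "'a \<Rightarrow> real"
  assumes "L \<noteq> []" "(\<Sum>x\<leftarrow>L. \<Phi> x) \<ge> real (length L) * c"
  shows "\<exists>x\<in>set L. \<Phi> x \<ge> c"
proof (rule ccontr)
  assume "\<not> ?thesis"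
  then have "\<forall>x\<in>set L. \<Phi> x < c" by auto
  with assms(1) have "(\<Sum>x\<leftarrow>L. \<Phi> x) < real (length L) * c"
  proof (induction L rule: list_nonempty_induct)
    case (cons x L)
    then show ?case by (simp add: algebra_simps add_less_le_mono)
  qed simp
  with assms(2) show False by simp
qed

lemma integral_sum_list:
  fixes f :: "'b \<Rightarrow> 'a \<Rightarrow> real"
  assumes "\<And>x. x \<in> set L \<Longrightarrow> integrable M (f x)"
  shows "integrable M (\<lambda>z. \<Sum>x\<leftarrow>L. f x z) \<and> (LINT z|M. (\<Sum>x\<leftarrow>L. f x z)) = (\<Sum>x\<leftarrow>L. (LINT z|M. f x z))"
  using assms by (induction L) auto

text \<open>Serves to bound means of arbitrarily small order from below, in the manner of Paley and
  Zygmund. The function is bounded above and nonpositive up to \<open>1 / 2\<close>, so a positive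
  mean forces values above \<open>1 / 2\<close> on a set of definite measure.\<close>

lemma moment_test_function:
  assumes "d > (0::real)"
  shows "\<exists>T>0. (\<forall>t\<ge>0. t\<^sup>2 - 1 / 4 - d * exp t \<le> T) \<and>
    (\<forall>t. 0 \<le> t \<longrightarrow> t \<le> 1 / 2 \<longrightarrow> t\<^sup>2 - 1 / 4 - d * exp t \<le> 0)"
\<comment> \<open>Since \<open>t^3 / 27 \<le> exp t\<close>, the subtracted exponential dominates
  the square once \<open>t > 27 / d\<close>.\<close>
proof (intro exI[of _ "(27 / d)\<^sup>2"] conjI allI impI)
  show "(27 / d)\<^sup>2 > 0" using assms by simp
  fix t :: real assume t: "t \<ge> 0"
  have "t / 3 \<le> exp (t / 3)" using exp_ge_add_one_self[of "t / 3"] by linarith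
  then have "(t / 3) ^ 3 \<le> exp (t / 3) ^ 3" using t by (intro power_mono) auto
  also have "exp (t / 3) ^ 3 = exp t" by (simp flip: exp_of_nat_mult)
  finally have e: "t ^ 3 / 27 \<le> exp t" by (simp add: power_divide)
  show "t\<^sup>2 - 1 / 4 - d * exp t \<le> (27 / d)\<^sup>2"
  proof (cases "t \<le> 27 / d")
    case True
    then have "t\<^sup>2 \<le> (27 / d)\<^sup>2" using t by (intro power_mono) auto
    moreover have "d * exp t \<ge> 0" using assms by simp
    ultimately show ?thesis by linarith
  next
    case False
    then have "27 \<le> d * t" using assms by (simp add: field_simps)
    then have "27 * t\<^sup>2 \<le> d * t * t\<^sup>2" by (intro mult_right_mono) auto
    then have "t\<^sup>2 \<le> d * (t ^ 3 / 27)" by (simp add: power3_eq_cube power2_eq_square mult.assoc)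
    also have "\<dots> \<le> d * exp t" using e assms by (intro mult_left_mono) auto
    finally show ?thesis using zero_le_power2[of "27 / d"] by linarith
  qed
next
  fix t :: real assume t: "0 \<le> t" "t \<le> 1 / 2"
  then have "t\<^sup>2 \<le> (1 / 2)\<^sup>2" by (intro power_mono) auto
  moreover have "d * exp t \<ge> 0" using assms by simp
  ultimately show "t\<^sup>2 - 1 / 4 - d * exp t \<le> 0" by (simp add: power2_eq_square)
qed

lemma integrable_norm_powr_mult:
  fixes F :: "complex ^ 'n \<Rightarrow> complex" and X :: "complex ^ 'n \<Rightarrow> real"
  assumes F: "continuous_on (sphere 0 1) F" and q: "q > 0" and X: "integrable sphere_measure X" "\<forall>z. X z \<ge> 0"
  shows "integrable sphere_measure (\<lambda>z. norm (F z) powr q * X z)"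
proof -
  obtain b where b: "\<And>z. z \<in> sphere 0 1 \<Longrightarrow> norm (F z) \<le> b"
    using compact_imp_bounded[OF compact_continuous_image[OF F compact_sphere]]
    unfolding bounded_iff by blast
  show ?thesis
  proof (rule Bochner_Integration.integrable_bound)
    show "integrable sphere_measure (\<lambda>z. b powr q * X z)" using X by (intro integrable_mult_right)
    have "(\<lambda>z. norm (F z) powr q) \<in> borel_measurable sphere_measure"
      by (intro borel_measurable_integrable integrable_sphere_continuous continuous_on_norm_powr F q)
    then show "(\<lambda>z. norm (F z) powr q * X z) \<in> borel_measurable sphere_measure"
      using X(1) by measurable
    have "norm (F z) powr q \<le> b powr q" if "norm z = 1" for z
      using b[of z] that q by (intro powr_mono2) auto
    then show "AE z in sphere_measure. norm (norm (F z) powr q * X z) \<le> norm (b powr q * X z)"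
      using X(2) by (intro AE_I2) (auto simp: abs_mult intro!: mult_right_mono)
  qed
qed

text \<open>The finite set depends on the degree alone and is fixed before the weight
  \<open>X\<close>. For given \<open>X\<close> the functional \<open>\<Phi>\<close> rewards a large
  mean of \<open>h\<close> and penalizes a large integral against \<open>X\<close>; its average over
  the signs is at least \<open>1 / 4\<close>, so a single choice of signs meets both
  requirements.\<close>

lemma random_homogeneous:
  fixes p q :: real
  assumes p: "p > 0" and q: "q > 0"
  shows "\<exists>c>0. \<exists>K\<ge>0. \<forall>k. \<exists>Fs :: (complex ^ 'n \<Rightarrow> complex) set. finite Fs \<and>
    (\<forall>F\<in>Fs. homogeneous k F \<and> (\<forall>z. norm (F z) \<le> real (k + 1) ^ CARD('n) * norm z ^ k)) \<and>
    (\<forall>X B. B > 0 \<longrightarrow> integrable sphere_measure X \<longrightarrow> (\<forall>z. X z \<ge> 0) \<longrightarrow> (LINT z|sphere_measure. X z) \<le> B \<longrightarrow>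
      (\<exists>F\<in>Fs. (LINT z|sphere_measure. norm (F z) powr p) \<ge> c \<and>
         (LINT z|sphere_measure. norm (F z) powr q * X z) \<le> K * B))"
proof -
  obtain Kq where Kq: "Kq > 0" "\<And>t. t \<ge> 0 \<Longrightarrow> t powr q \<le> Kq * exp t"
    using powr_le_exp[OF q] by blast
  define K' where "K' = Kq * (2 * exp 2)"
  have K': "K' > 0" using Kq by (simp add: K'_def)
  \<comment> \<open>This makes \<open>d\<close> times the exponential moment bound
    \<open>2 * exp 2\<close> equal to \<open>1 / 4\<close>, so the average of \<open>h\<close> is at
    least \<open>1 - 1 / 4 - 1 / 4 = 1 / 2\<close>.\<close>
  define d :: real where "d = 1 / (8 * exp 2)"
  have d: "d > 0" by (simp add: d_def)
  define h where "h = (\<lambda>t::real. t\<^sup>2 - 1 / 4 - d * exp t)"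
  obtain T where T: "T > 0" "\<And>t. t \<ge> 0 \<Longrightarrow> h t \<le> T" "\<And>t. 0 \<le> t \<Longrightarrow> t \<le> 1 / 2 \<Longrightarrow> h t \<le> 0"
    using moment_test_function[OF d] unfolding h_def by blast
  define A where "A = T * 2 powr p"
  have A: "A > 0" using T by (simp add: A_def)
  \<comment> \<open>For \<open>t > 1 / 2\<close> the factor \<open>(2 * t) powr p\<close> is at
    least 1 and the bound \<open>T\<close> suffices; for smaller \<open>t\<close> the left side is
    nonpositive.\<close>
  have hA: "h t \<le> A * t powr p" if t: "t \<ge> 0" for t
  proof (cases "t \<le> 1 / 2")
    case True
    have "0 \<le> A * t powr p" using A by simp
    then show ?thesis using T(3)[OF t True] by linarith
  next
    case False
    then have "1 \<le> (2 * t) powr p" using p by (intro ge_one_powr_ge_zero) auto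
    then have "T * 1 \<le> T * (2 * t) powr p" using T by (intro mult_left_mono) auto
    then show ?thesis using T(2)[OF t] by (simp add: A_def powr_mult)
  qed
  show ?thesis
  proof (rule exI[of _ "1 / (4 * A)"], intro conjI, use A in simp,
      rule exI[of _ "4 * K' * T"], intro conjI, use K' T in simp, intro allI)
    fix k :: nat
    obtain L :: "(complex ^ 'n \<Rightarrow> complex) list" where L: "length L \<le> (k + 1) ^ CARD('n)"
      "\<forall>\<phi>\<in>set L. homogeneous k \<phi>"
      "\<And>z. (\<Sum>\<phi>\<leftarrow>L. norm (\<phi> z) ^ 2) = (\<Sum>i\<in>UNIV. norm (z $ i) ^ 2) ^ k"
      using homogeneous_family_exists[of k "UNIV :: 'n set"] by blast
    have L2: "(\<Sum>\<phi>\<leftarrow>L. norm (\<phi> z) ^ 2) = (norm z ^ k) ^ 2" for z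
      unfolding L(3) norm_vec_square[symmetric] by (simp add: power_mult[symmetric] mult.commute)
    define Ls where "Ls = signed_sums L"
    have len: "length Ls = 2 ^ length L" by (simp add: Ls_def length_signed_sums)
    have hom: "homogeneous k F" if "F \<in> set Ls" for F
      using that homogeneous_signed_sums[OF L(2)] by (simp add: Ls_def)
    have bound: "norm (F z) \<le> real (k + 1) ^ CARD('n) * norm z ^ k" if "F \<in> set Ls" for F z
    proof -
      have "norm (F z) \<le> (\<Sum>\<phi>\<leftarrow>L. norm (\<phi> z))" using norm_signed_sums_le that by (simp add: Ls_def)
      also have "\<dots> \<le> (\<Sum>\<phi>\<leftarrow>L. norm z ^ k)"
      proof (rule sum_list_mono)
        fix \<phi> assume "\<phi> \<in> set L"
        then have "norm (\<phi> z) ^ 2 \<le> (\<Sum>\<phi>\<leftarrow>L. norm (\<phi> z) ^ 2)"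
          by (intro member_le_sum_list) auto
        then have "norm (\<phi> z) ^ 2 \<le> (norm z ^ k) ^ 2" unfolding L2 .
        then show "norm (\<phi> z) \<le> norm z ^ k" by (rule power2_le_imp_le) simp
      qed
      also have "\<dots> = real (length L) * norm z ^ k" by (simp add: sum_list_triv)
      also have "\<dots> \<le> real (k + 1) ^ CARD('n) * norm z ^ k"
      proof (rule mult_right_mono)
        have "real (length L) \<le> real ((k + 1) ^ CARD('n))" using L(1) by (rule of_nat_mono)
        then show "real (length L) \<le> real (k + 1) ^ CARD('n)" by simp
      qed simp
      finally show ?thesis .
    qed
    have one: "(\<Sum>\<phi>\<leftarrow>L. norm (\<phi> z) ^ 2) = 1" if "norm z = 1" for z
      unfolding L2 that by simp
    have contF: "continuous_on S F" if "F \<in> set Ls" for F and S :: "(complex ^ 'n) set"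
      using hom[OF that] continuous_on_subset unfolding homogeneous_def by blast
    have exp_mom: "(\<Sum>F\<leftarrow>Ls. exp (norm (F z))) \<le> 2 ^ length L * (2 * exp 2)" if "norm z = 1" for z
      unfolding Ls_def by (rule signed_sums_exp_norm[OF one[OF that]])
    have h_avg: "(\<Sum>F\<leftarrow>Ls. h (norm (F z))) \<ge> 2 ^ length L / 2" if z: "norm z = 1" for z
    proof -
      have "(\<Sum>F\<leftarrow>Ls. h (norm (F z))) = (\<Sum>F\<leftarrow>Ls. norm (F z) ^ 2) - (\<Sum>F\<leftarrow>Ls. 1 / 4) - d * (\<Sum>F\<leftarrow>Ls. exp (norm (F z)))"
        by (simp add: h_def sum_list_subtractf sum_list_const_mult)
      also have "(\<Sum>F\<leftarrow>Ls. norm (F z) ^ 2) = 2 ^ length L"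
        using signed_sums_second_moment[where x = 0 and L = L and z = z] one[OF z] by (simp add: Ls_def)
      also have "(\<Sum>F\<leftarrow>Ls. 1 / 4 :: real) = 2 ^ length L / 4"
        by (simp add: sum_list_triv len)
      finally have "(\<Sum>F\<leftarrow>Ls. h (norm (F z))) = 2 ^ length L - 2 ^ length L / 4 - d * (\<Sum>F\<leftarrow>Ls. exp (norm (F z)))" .
      moreover have "d * (\<Sum>F\<leftarrow>Ls. exp (norm (F z))) \<le> d * (2 ^ length L * (2 * exp 2))"
        using d exp_mom[OF z] by (intro mult_left_mono) auto
      moreover have "d * (2 ^ length L * (2 * exp 2)) = 2 ^ length L / 4" by (simp add: d_def)
      ultimately show ?thesis by simp
    qed
    have q_avg: "(\<Sum>F\<leftarrow>Ls. norm (F z) powr q) \<le> 2 ^ length L * K'" if z: "norm z = 1" for z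
    proof -
      have "(\<Sum>F\<leftarrow>Ls. norm (F z) powr q) \<le> (\<Sum>F\<leftarrow>Ls. Kq * exp (norm (F z)))"
        using Kq by (intro sum_list_mono) auto
      also have "\<dots> \<le> Kq * (2 ^ length L * (2 * exp 2))"
        unfolding sum_list_const_mult using Kq exp_mom[OF z] by (intro mult_left_mono) auto
      finally show ?thesis by (simp add: K'_def mult_ac)
    qed
    have "\<exists>F\<in>set Ls. (LINT z|sphere_measure. norm (F z) powr p) \<ge> 1 / (4 * A) \<and>
         (LINT z|sphere_measure. norm (F z) powr q * X z) \<le> 4 * K' * T * B"
      if B: "B > 0" and X: "integrable sphere_measure X" "\<forall>z. X z \<ge> 0" "(LINT z|sphere_measure. X z) \<le> B" for X B
    proof -
      have int_h: "integrable sphere_measure (\<lambda>z. h (norm (F z)))" if "F \<in> set Ls" for F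
        unfolding h_def by (intro integrable_sphere_continuous continuous_intros contF[OF that])
      have int_p: "integrable sphere_measure (\<lambda>z. norm (F z) powr p)" if "F \<in> set Ls" for F
        by (intro integrable_sphere_continuous continuous_on_norm_powr contF[OF that] p)
      have int_q: "integrable sphere_measure (\<lambda>z. norm (F z) powr q * X z)" if F: "F \<in> set Ls" for F
        by (rule integrable_norm_powr_mult[OF contF[OF F] q X(1,2)])
      \<comment> \<open>Scaled so that the penalty averages to at most \<open>1 / 4\<close>, half of
        what the average of \<open>h\<close> provides.\<close>
      define b where "b = 1 / (4 * K' * B)"
      have b: "b > 0" using K' B by (simp add: b_def)
      define \<Phi> where "\<Phi> = (\<lambda>F :: complex ^ 'n \<Rightarrow> complex. (LINT z|sphere_measure. h (norm (F z))) - b * (LINT z|sphere_measure. norm (F z) powr q * X z))"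
      have "(\<Sum>F\<leftarrow>Ls. \<Phi> F) = (\<Sum>F\<leftarrow>Ls. (LINT z|sphere_measure. h (norm (F z)))) - b * (\<Sum>F\<leftarrow>Ls. (LINT z|sphere_measure. norm (F z) powr q * X z))"
        by (simp add: \<Phi>_def sum_list_subtractf sum_list_const_mult)
      also have "(\<Sum>F\<leftarrow>Ls. (LINT z|sphere_measure. h (norm (F z)))) = (LINT z|sphere_measure. (\<Sum>F\<leftarrow>Ls. h (norm (F z))))"
        using integral_sum_list[of Ls sphere_measure "\<lambda>F z. h (norm (F z))"] int_h by simp
      also have "(\<Sum>F\<leftarrow>Ls. (LINT z|sphere_measure. norm (F z) powr q * X z)) = (LINT z|sphere_measure. (\<Sum>F\<leftarrow>Ls. norm (F z) powr q * X z))"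
        using integral_sum_list[of Ls sphere_measure "\<lambda>F z. norm (F z) powr q * X z"] int_q by simp
      finally have sum_eq: "(\<Sum>F\<leftarrow>Ls. \<Phi> F) = (LINT z|sphere_measure. (\<Sum>F\<leftarrow>Ls. h (norm (F z))))
          - b * (LINT z|sphere_measure. (\<Sum>F\<leftarrow>Ls. norm (F z) powr q * X z))" .
      have "(LINT z|(sphere_measure :: (complex ^ 'n) measure). 2 ^ length L / 2) \<le> (LINT z|sphere_measure. (\<Sum>F\<leftarrow>Ls. h (norm (F z))))"
        using integral_sum_list[of Ls sphere_measure "\<lambda>F z. h (norm (F z))"] int_h h_avg
        by (intro integral_mono) auto
      then have 1: "2 ^ length L / 2 \<le> (LINT z|sphere_measure. (\<Sum>F\<leftarrow>Ls. h (norm (F z))))" by simp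
      have "(LINT z|sphere_measure. (\<Sum>F\<leftarrow>Ls. norm (F z) powr q * X z)) \<le> (LINT z|sphere_measure. 2 ^ length L * K' * X z)"
      proof (rule integral_mono)
        show "integrable sphere_measure (\<lambda>z. \<Sum>F\<leftarrow>Ls. norm (F z) powr q * X z)"
          using integral_sum_list[of Ls sphere_measure "\<lambda>F z. norm (F z) powr q * X z"] int_q by simp
        show "integrable sphere_measure (\<lambda>z. 2 ^ length L * K' * X z)" using X by simp
        fix z :: "complex ^ 'n" assume "z \<in> space sphere_measure"
        then show "(\<Sum>F\<leftarrow>Ls. norm (F z) powr q * X z) \<le> 2 ^ length L * K' * X z"
          unfolding sum_list_mult_const using X(2) q_avg[of z] by (intro mult_right_mono) auto
      qed
      also have "\<dots> \<le> 2 ^ length L * K' * B" using X K' by simp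
      finally have "b * (LINT z|sphere_measure. (\<Sum>F\<leftarrow>Ls. norm (F z) powr q * X z)) \<le> b * (2 ^ length L * K' * B)"
        using b by (intro mult_left_mono) auto
      also have "\<dots> = 2 ^ length L / 4" using K' B by (simp add: b_def)
      finally have "(\<Sum>F\<leftarrow>Ls. \<Phi> F) \<ge> real (length Ls) * (1 / 4)"
        using 1 unfolding sum_eq len by simp
      moreover have "Ls \<noteq> []" using len by auto
      ultimately obtain F where F: "F \<in> set Ls" "\<Phi> F \<ge> 1 / 4" using exists_ge_average by blast
      have nn: "(LINT z|sphere_measure. norm (F z) powr q * X z) \<ge> 0"
        using X(2) by (intro Bochner_Integration.integral_nonneg) auto
      \<comment> \<open>The upper bound on \<open>h\<close> limits the reward, so
        \<open>\<Phi> F \<ge> 1 / 4\<close> also limits the penalty.\<close>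
      have h_le: "(LINT z|sphere_measure. h (norm (F z))) \<le> T"
        using T(2) by (intro integral_sphere_const_bound int_h F) auto
      have "(LINT z|sphere_measure. h (norm (F z))) \<le> (LINT z|sphere_measure. A * norm (F z) powr p)"
        using hA int_h[OF F(1)] int_p[OF F(1)] by (intro integral_mono) auto
      then have "(LINT z|sphere_measure. h (norm (F z))) \<le> A * (LINT z|sphere_measure. norm (F z) powr p)" by simp
      moreover have "b * (LINT z|sphere_measure. norm (F z) powr q * X z) \<ge> 0"
        using b nn by (intro mult_nonneg_nonneg) auto
      ultimately have "1 / 4 \<le> A * (LINT z|sphere_measure. norm (F z) powr p)"
        using F(2) unfolding \<Phi>_def by linarith
      then have "1 / (4 * A) \<le> (LINT z|sphere_measure. norm (F z) powr p)"
        using A by (simp add: field_simps)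
      moreover have "b * (LINT z|sphere_measure. norm (F z) powr q * X z) \<le> T"
        using F(2) h_le unfolding \<Phi>_def by simp
      then have "(LINT z|sphere_measure. norm (F z) powr q * X z) \<le> 4 * K' * T * B"
        using K' B by (simp add: b_def field_simps)
      ultimately show ?thesis using F(1) by blast
    qed
    then show "\<exists>Fs :: (complex ^ 'n \<Rightarrow> complex) set. finite Fs \<and>
      (\<forall>F\<in>Fs. homogeneous k F \<and> (\<forall>z. norm (F z) \<le> real (k + 1) ^ CARD('n) * norm z ^ k)) \<and>
      (\<forall>X B. B > 0 \<longrightarrow> integrable sphere_measure X \<longrightarrow> (\<forall>z. X z \<ge> 0) \<longrightarrow> (LINT z|sphere_measure. X z) \<le> B \<longrightarrow>
        (\<exists>F\<in>Fs. (LINT z|sphere_measure. norm (F z) powr p) \<ge> 1 / (4 * A) \<and>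
           (LINT z|sphere_measure. norm (F z) powr q * X z) \<le> 4 * K' * T * B))"
      using hom bound by (intro exI[of _ "set Ls"]) auto
  qed
qed

lemma volterra_homogeneous:
  assumes g: "g \<in> holo_ball" and F: "homogeneous k F" and k: "k > 0" and z: "norm z < 1"
  shows "volterra g F z = F z * dilation_defect g k z"
proof -
  obtain R where R: "R > 1" "(\<lambda>w. g (w *s z)) holomorphic_on ball 0 R"
    using slice_holomorphic_gt_1[OF g z] by blast
  define \<phi> where "\<phi> = (\<lambda>w. g (w *s z))"
  have d\<phi>: "(\<phi> has_field_derivative deriv \<phi> (of_real t)) (at (of_real t))" if "t \<in> {0..1}" for t :: real
    using R that unfolding \<phi>_def by (intro holomorphic_derivI[of _ "ball 0 R"]) auto
  \<comment> \<open>The derivative of \<open>t ^ k * (\<phi> t - \<phi> 1)\<close>: subtracting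
    \<open>\<phi> 1\<close> removes the boundary term at 1, and \<open>k > 0\<close> the one at
    0.\<close>
  have "((\<lambda>t::real. of_nat k * of_real t ^ (k - 1) * (\<phi> (of_real t) - \<phi> 1) + of_real t ^ k * deriv \<phi> (of_real t))
      has_integral (of_real 1 ^ k * (\<phi> (of_real 1) - \<phi> 1) - of_real 0 ^ k * (\<phi> (of_real 0) - \<phi> 1))) {0..1}"
  proof (rule fundamental_theorem_of_calculus)
    fix t :: real assume "t \<in> {0..1}"
    from d\<phi>[OF this] have "((\<lambda>w. w ^ k * (\<phi> w - \<phi> 1)) has_field_derivative
       (of_nat k * of_real t ^ (k - 1) * (\<phi> (of_real t) - \<phi> 1) + of_real t ^ k * deriv \<phi> (of_real t))) (at (of_real t))"
      by (auto intro!: derivative_eq_intros)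
    from has_vector_derivative_real_field[OF this]
    show "((\<lambda>t. of_real t ^ k * (\<phi> (of_real t) - \<phi> 1)) has_vector_derivative
       (of_nat k * of_real t ^ (k - 1) * (\<phi> (of_real t) - \<phi> 1) + of_real t ^ k * deriv \<phi> (of_real t))) (at t within {0..1})" .
  qed simp
  then have 0: "((\<lambda>t::real. of_nat k * of_real t ^ (k - 1) * (\<phi> (of_real t) - \<phi> 1) + of_real t ^ k * deriv \<phi> (of_real t))
      has_integral 0) {0..1}" using k by (simp add: power_0_left)
  have c: "continuous_on {0..1} (\<lambda>t::real. of_real (real k * t ^ (k - 1)) * (g z - g (of_real t *s z)))"
    by (intro continuous_intros continuous_on_real_line_smult g z)
  have "((\<lambda>t. of_real (real k * t ^ (k - 1)) * (g z - g (of_real t *s z))) has_integral dilation_defect g k z) {0..1}"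
    unfolding dilation_defect_def by (intro integrable_integral integrable_continuous_real c)
  from has_integral_add[OF 0 this]
  have "((\<lambda>t::real. of_real t ^ k * deriv \<phi> (of_real t)) has_integral dilation_defect g k z) {0..1}"
    by (simp add: \<phi>_def algebra_simps)
  from has_integral_mult_right[OF this, of "F z"]
  have "((\<lambda>t::real. F (of_real t *s z) * deriv \<phi> (of_real t)) has_integral F z * dilation_defect g k z) {0..1}"
    using F by (simp add: homogeneous_def mult_ac)
  then show ?thesis using volterra_eq[OF g z] by (simp add: \<phi>_def integral_unique)
qed

subsection \<open>The gliding hump\<close>

lemma hardy_mean_add_le:
  assumes f: "f \<in> holo_ball" and h: "h \<in> holo_ball" and p: "p > 0" and s: "0 \<le> s" "s < 1"
  shows "hardy_mean p (\<lambda>z. f z + h z) s \<le> 2 powr p * (hardy_mean p f s + hardy_mean p h s)"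
proof -
  have s': "norm (complex_of_real s) < 1" using s by simp
  note i = hardy_mean_integrable[OF f p s'] hardy_mean_integrable[OF h p s']
    hardy_mean_integrable[OF holo_ball_add[OF f h] p s']
  have "hardy_mean p (\<lambda>z. f z + h z) s
      \<le> (LINT \<zeta>|sphere_measure. 2 powr p * (norm (f (of_real s *s \<zeta>)) powr p + norm (h (of_real s *s \<zeta>)) powr p))"
    unfolding hardy_mean_def using i p by (intro integral_mono norm_add_powr_le) auto
  then show ?thesis using i by (simp add: hardy_mean_def)
qed

lemma hardy_mean_le_const:
  assumes f: "f \<in> holo_ball" and p: "p > 0" and s: "0 \<le> s" "s < 1"
    and B: "\<And>z. norm z \<le> s \<Longrightarrow> norm (f z) \<le> B"
  shows "hardy_mean p f s \<le> B powr p"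
  unfolding hardy_mean_def
  using s p by (intro integral_sphere_const_bound hardy_mean_integrable f powr_mono2 B) auto

lemma hardy_mean_cong:
  assumes "\<And>z. norm z < 1 \<Longrightarrow> f z = h z" "0 \<le> s" "s < 1"
  shows "hardy_mean p f s = hardy_mean p h s"
  unfolding hardy_mean_def using assms by (intro Bochner_Integration.integral_cong) auto

lemma hardy_mean_cmult:
  "hardy_mean p (\<lambda>z. c * f z) s = norm c powr p * hardy_mean p f s"
  unfolding hardy_mean_def by (simp add: norm_mult powr_mult)

text \<open>The lower bound \<open>c\<close> is independent of \<open>\<epsilon>\<close>, so these
  polynomials can later be scaled until their \<open>p\<close>-means are as large as desired with
  their images still small.\<close>

lemma homogeneous_small_volterra:
  fixes g :: "complex ^ 'n \<Rightarrow> complex"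
  assumes p: "p > 0" and q: "q > 0" and g: "g \<in> hardy_space q"
    and op: "\<And>f. f \<in> hardy_space p \<Longrightarrow> volterra g f \<in> hardy_space q"
  shows "\<exists>c>0. \<forall>\<epsilon>>0. \<exists>N0. \<forall>N\<ge>N0. \<exists>F. homogeneous (2 ^ N) F \<and>
      (\<forall>z. norm (F z) \<le> real (2 ^ N + 1) ^ CARD('n) * norm z ^ (2 ^ N)) \<and>
      (LINT z|sphere_measure. norm (F z) powr p) \<ge> c \<and>
      (\<forall>r\<in>{0..<1}. hardy_mean q (volterra g F) r \<le> \<epsilon>)"
proof -
  have gh: "g \<in> holo_ball" using g by (simp add: hardy_space_def)
  obtain c K where c: "c > 0" and K: "K \<ge> 0" and fam: "\<forall>k. \<exists>Fs :: (complex ^ 'n \<Rightarrow> complex) set. finite Fs \<and>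
    (\<forall>F\<in>Fs. homogeneous k F \<and> (\<forall>z. norm (F z) \<le> real (k + 1) ^ CARD('n) * norm z ^ k)) \<and>
    (\<forall>X B. B > 0 \<longrightarrow> integrable sphere_measure X \<longrightarrow> (\<forall>z. X z \<ge> 0) \<longrightarrow> (LINT z|sphere_measure. X z) \<le> B \<longrightarrow>
      (\<exists>F\<in>Fs. (LINT z|sphere_measure. norm (F z) powr p) \<ge> c \<and>
         (LINT z|sphere_measure. norm (F z) powr q * X z) \<le> K * B))"
    using random_homogeneous[OF p q, where 'n = 'n] by blast
  show ?thesis
  proof (intro exI[of _ c] conjI c allI impI)
    fix \<epsilon> :: real assume \<epsilon>: "\<epsilon> > 0"
    define B where "B = \<epsilon> / (K + 1)"
    have B: "B > 0" using K \<epsilon> by (simp add: B_def)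
    have KB: "K * B \<le> \<epsilon>"
    proof -
      have "K * B \<le> (K + 1) * B" using B by (intro mult_right_mono) auto
      also have "\<dots> = \<epsilon>" using K by (simp add: B_def)
      finally show ?thesis .
    qed
    obtain N0 s0 where s0: "0 \<le> s0" "s0 < 1" and dil:
      "\<And>N s. N \<ge> N0 \<Longrightarrow> s \<in> {s0..<1} \<Longrightarrow> \<exists>X. integrable sphere_measure X \<and> (\<forall>z. X z \<ge> 0) \<and>
       (\<forall>z. norm z = 1 \<longrightarrow> norm (dilation_defect g (2 ^ N) (of_real s *s z)) powr q \<le> X z) \<and>
       (LINT z|sphere_measure. X z) \<le> B"
      using dilation_defect_small[OF g q B] by blast
    show "\<exists>N0. \<forall>N\<ge>N0. \<exists>F. homogeneous (2 ^ N) F \<and>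
      (\<forall>z. norm (F z) \<le> real (2 ^ N + 1) ^ CARD('n) * norm z ^ (2 ^ N)) \<and>
      (LINT z|sphere_measure. norm (F z) powr p) \<ge> c \<and>
      (\<forall>r\<in>{0..<1}. hardy_mean q (volterra g F) r \<le> \<epsilon>)"
    proof (intro exI[of _ N0] allI impI)
      fix N assume N: "N0 \<le> N"
      define k :: nat where "k = 2 ^ N"
      obtain Fs :: "(complex ^ 'n \<Rightarrow> complex) set" where Fs: "finite Fs"
        "\<forall>F\<in>Fs. homogeneous k F \<and> (\<forall>z. norm (F z) \<le> real (k + 1) ^ CARD('n) * norm z ^ k)"
        "\<forall>X B. B > 0 \<longrightarrow> integrable sphere_measure X \<longrightarrow> (\<forall>z. X z \<ge> 0) \<longrightarrow> (LINT z|sphere_measure. X z) \<le> B \<longrightarrow>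
          (\<exists>F\<in>Fs. (LINT z|sphere_measure. norm (F z) powr p) \<ge> c \<and>
             (LINT z|sphere_measure. norm (F z) powr q * X z) \<le> K * B)"
        using spec[OF fam, of k] by (elim exE conjE)
      \<comment> \<open>\<open>F\<close> is bounded on the ball and so lies in
        \<open>hardy_space p\<close>; holomorphy of its image is then read off from
        \<open>op\<close> instead of from the defining integral.\<close>
      have holo: "volterra g F \<in> holo_ball" if F: "F \<in> Fs" for F
      proof -
        have "F \<in> hardy_space p"
        proof (rule bounded_imp_hardy_space[OF _ p])
          show "F \<in> holo_ball" using Fs(2) F by (simp add: homogeneous_def)
          show "norm (F z) \<le> real (k + 1) ^ CARD('n)" if "norm z < 1" for z
          proof -
            have "norm (F z) \<le> real (k + 1) ^ CARD('n) * norm z ^ k" using Fs(2) F by blast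
            also have "\<dots> \<le> real (k + 1) ^ CARD('n) * 1"
              using that by (intro mult_left_mono power_le_one) auto
            finally show ?thesis by simp
          qed
        qed
        from op[OF this] show ?thesis by (simp add: hardy_space_def)
      qed
      have good: "\<exists>F\<in>Fs. (LINT z|sphere_measure. norm (F z) powr p) \<ge> c \<and> hardy_mean q (volterra g F) s \<le> \<epsilon>"
        if s: "s0 \<le> s" "s < 1" for s
      proof -
        obtain X where X: "integrable sphere_measure X" "\<forall>z. X z \<ge> 0"
          "\<And>z. norm z = 1 \<Longrightarrow> norm (dilation_defect g k (of_real s *s z)) powr q \<le> X z"
          "(LINT z|sphere_measure. X z) \<le> B"
          using dil[OF N, of s] s unfolding k_def by auto
        obtain F where F: "F \<in> Fs" "(LINT z|sphere_measure. norm (F z) powr p) \<ge> c"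
          "(LINT z|sphere_measure. norm (F z) powr q * X z) \<le> K * B"
          using Fs(3)[rule_format, OF B X(1) X(2)[rule_format] X(4)] by blast
        have hom: "homogeneous k F" using Fs(2) F(1) by blast
        have contF: "continuous_on (sphere 0 1) F"
          using hom continuous_on_subset unfolding homogeneous_def by blast
        have s': "0 \<le> s" "norm (complex_of_real s) < 1" using s s0 by auto
        have pw: "norm (volterra g F (of_real s *s z)) powr q \<le> norm (F z) powr q * X z" if z: "norm z = 1" for z
        proof -
          have "volterra g F (of_real s *s z) = of_real s ^ k * F z * dilation_defect g k (of_real s *s z)"
            using volterra_homogeneous[OF gh hom, of "of_real s *s z"] z s' hom by (simp add: k_def homogeneous_def)
          then have "norm (volterra g F (of_real s *s z)) = s ^ k * (norm (F z) * norm (dilation_defect g k (of_real s *s z)))"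
            using s' by (simp add: norm_mult norm_power)
          also have "\<dots> \<le> norm (F z) * norm (dilation_defect g k (of_real s *s z))"
            using s s' by (intro mult_left_le_one_le power_le_one) auto
          finally have "norm (volterra g F (of_real s *s z)) powr q \<le> (norm (F z) * norm (dilation_defect g k (of_real s *s z))) powr q"
            using q by (intro powr_mono2) auto
          also have "\<dots> = norm (F z) powr q * norm (dilation_defect g k (of_real s *s z)) powr q"
            by (simp add: powr_mult)
          also have "\<dots> \<le> norm (F z) powr q * X z" using X(3)[OF z] by (intro mult_left_mono) auto
          finally show ?thesis .
        qed
        have int: "integrable sphere_measure (\<lambda>z. norm (F z) powr q * X z)"
          by (rule integrable_norm_powr_mult[OF contF q X(1,2)])
        have "hardy_mean q (volterra g F) s \<le> (LINT z|sphere_measure. norm (F z) powr q * X z)"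
          unfolding hardy_mean_def
          using pw by (intro integral_mono hardy_mean_integrable holo F q s' int) auto
        then show ?thesis using F KB by (intro bexI[of _ F]) auto
      qed
      \<comment> \<open>Pigeonhole: otherwise every \<open>F\<close> fails from some radius on, and
        at the largest of these finitely many radii, raised to at least \<open>s0\<close>, the
        statement \<open>good\<close> is contradicted.\<close>
      have "\<exists>F\<in>Fs. \<forall>r<1. \<exists>s. r \<le> s \<and> 0 \<le> s \<and> s < 1 \<and> (LINT z|sphere_measure. norm (F z) powr p) \<ge> c \<and> hardy_mean q (volterra g F) s \<le> \<epsilon>"
      proof (rule ccontr)
        assume "\<not> ?thesis"
        then have "\<forall>F\<in>Fs. \<exists>r<1. \<forall>s. r \<le> s \<longrightarrow> 0 \<le> s \<longrightarrow> s < 1 \<longrightarrow>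
            \<not> ((LINT z|sphere_measure. norm (F z) powr p) \<ge> c \<and> hardy_mean q (volterra g F) s \<le> \<epsilon>)" by blast
        then obtain r where r: "\<forall>F\<in>Fs. r F < 1 \<and> (\<forall>s. r F \<le> s \<longrightarrow> 0 \<le> s \<longrightarrow> s < 1 \<longrightarrow>
            \<not> ((LINT z|sphere_measure. norm (F z) powr p) \<ge> c \<and> hardy_mean q (volterra g F) s \<le> \<epsilon>))"
          using bchoice[of Fs "\<lambda>F r. r < 1 \<and> (\<forall>s. r \<le> s \<longrightarrow> 0 \<le> s \<longrightarrow> s < 1 \<longrightarrow>
            \<not> ((LINT z|sphere_measure. norm (F z) powr p) \<ge> c \<and> hardy_mean q (volterra g F) s \<le> \<epsilon>))"] by blast
        define s where "s = Max (insert s0 (r ` Fs))"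
        have fin: "finite (insert s0 (r ` Fs))" using Fs(1) by simp
        have "s0 \<le> s" unfolding s_def using fin by (intro Max_ge) auto
        moreover have "s < 1" unfolding s_def using fin s0 r by (subst Max_less_iff) auto
        ultimately obtain F where F: "F \<in> Fs" "(LINT z|sphere_measure. norm (F z) powr p) \<ge> c" "hardy_mean q (volterra g F) s \<le> \<epsilon>"
          using good by blast
        have "r F \<le> s" unfolding s_def using fin F by (intro Max_ge) auto
        then show False using r F \<open>s0 \<le> s\<close> \<open>s < 1\<close> s0 by force
      qed
      then obtain F where F: "F \<in> Fs" and Fr: "\<And>r. r < 1 \<Longrightarrow> \<exists>s. r \<le> s \<and> 0 \<le> s \<and> s < 1 \<and>
          (LINT z|sphere_measure. norm (F z) powr p) \<ge> c \<and> hardy_mean q (volterra g F) s \<le> \<epsilon>" by blast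
      have "hardy_mean q (volterra g F) r \<le> \<epsilon>" if r: "r \<in> {0..<1}" for r
      proof -
        obtain s where s: "r \<le> s" "s < 1" "hardy_mean q (volterra g F) s \<le> \<epsilon>" using Fr[of r] r by auto
        have "hardy_mean q (volterra g F) r \<le> hardy_mean q (volterra g F) s"
          using s that by (intro hardy_mean_mono holo F q) auto
        then show ?thesis using s by simp
      qed
      moreover have "(LINT z|sphere_measure. norm (F z) powr p) \<ge> c" using Fr[of 0] by auto
      ultimately show "\<exists>F. homogeneous (2 ^ N) F \<and>
        (\<forall>z. norm (F z) \<le> real (2 ^ N + 1) ^ CARD('n) * norm z ^ (2 ^ N)) \<and>
        (LINT z|sphere_measure. norm (F z) powr p) \<ge> c \<and>
        (\<forall>r\<in>{0..<1}. hardy_mean q (volterra g F) r \<le> \<epsilon>)"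
        using Fs(2) F unfolding k_def by (intro exI[of _ F]) auto
    qed
  qed
qed

text \<open>A homogeneous polynomial of high degree is scaled to dominate the bounded function
  \<open>S\<close> near the sphere. On the ball of radius \<open>s\<close> it remains small, since
  the decay of \<open>s ^ k\<close> beats both the scaling and the polynomial growth in
  \<open>k\<close> of its sup norm.\<close>

lemma hump_exists:
  fixes g S :: "complex ^ 'n \<Rightarrow> complex"
  assumes p: "p > 0" and q: "q > 0" and g: "g \<in> hardy_space q"
    and op: "\<And>f. f \<in> hardy_space p \<Longrightarrow> volterra g f \<in> hardy_space q"
    and S: "S \<in> holo_ball" "\<And>z. norm z < 1 \<Longrightarrow> norm (S z) \<le> B"
    and s: "0 \<le> s" "s < 1" and \<epsilon>: "\<epsilon> > 0"
  shows "\<exists>D s'. D \<in> holo_ball \<and> (\<exists>B'. \<forall>z. norm z < 1 \<longrightarrow> norm (D z) \<le> B') \<and>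
    (\<forall>z. norm z \<le> s \<longrightarrow> norm (D z) \<le> \<epsilon>) \<and>
    (\<forall>r\<in>{0..<1}. hardy_mean q (volterra g D) r \<le> \<epsilon>) \<and> s < s' \<and> s' < 1 \<and> hardy_mean p (\<lambda>z. S z + D z) s' \<ge> M"
proof -
  have gh: "g \<in> holo_ball" using g by (simp add: hardy_space_def)
  obtain c where c: "c > 0" and fam: "\<And>\<epsilon>. \<epsilon> > 0 \<Longrightarrow> \<exists>N0. \<forall>N\<ge>N0. \<exists>F. homogeneous (2 ^ N) F \<and>
      (\<forall>z. norm (F z) \<le> real (2 ^ N + 1) ^ CARD('n) * norm z ^ (2 ^ N)) \<and>
      (LINT z|sphere_measure. norm (F z) powr p) \<ge> c \<and>
      (\<forall>r\<in>{0..<1}. hardy_mean q (volterra g F) r \<le> \<epsilon>)"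
    using homogeneous_small_volterra[OF p q g op] by blast
  \<comment> \<open>This is the \<open>p\<close>-th power of the scaling factor \<open>a\<close>. Of
    \<open>4 powr p = 2 powr p * 2 powr p\<close>, one factor pays for
    \<open>s' ^ k \<ge> 1 / 2\<close>, the other for the inequality separating \<open>D\<close> from
    \<open>S + D\<close>.\<close>
  define x where "x = 4 powr p * (\<bar>M\<bar> + B powr p + 1) / c"
  have "\<bar>M\<bar> + B powr p + 1 > 0" using powr_ge_zero[of B p] by linarith
  then have x: "x > 0" using c unfolding x_def by (intro divide_pos_pos mult_pos_pos) auto
  define a where "a = x powr (1 / p)"
  have ap: "a powr p = 4 powr p * (\<bar>M\<bar> + B powr p + 1) / c"
    using x p by (simp add: a_def powr_powr flip: x_def)
  have a: "a > 0" using x by (simp add: a_def)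
  obtain N0 where N0: "\<And>N. N \<ge> N0 \<Longrightarrow> \<exists>F. homogeneous (2 ^ N) F \<and>
      (\<forall>z. norm (F z) \<le> real (2 ^ N + 1) ^ CARD('n) * norm z ^ (2 ^ N)) \<and>
      (LINT z|sphere_measure. norm (F z) powr p) \<ge> c \<and>
      (\<forall>r\<in>{0..<1}. hardy_mean q (volterra g F) r \<le> \<epsilon> / a powr q)"
    using fam[of "\<epsilon> / a powr q"] a \<epsilon> by auto
  have "(\<lambda>k. a * (real (k + 1) ^ CARD('n) * s ^ k)) \<longlonglongrightarrow> a * 0"
  proof (intro tendsto_mult tendsto_const)
    \<comment> \<open>Taking the root writes the sequence as a fixed power of
      \<open>(k + 1) * x ^ k\<close>, which tends to 0.\<close>
    define x where "x = root CARD('n) s"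
    have x: "0 \<le> x" "x < 1" "x ^ CARD('n) = s" using s real_root_lt_1_iff[of "CARD('n)" s] by (auto simp: x_def)
    have "(\<lambda>k. (real k * x ^ k + x ^ k) ^ CARD('n)) \<longlonglongrightarrow> (0 + 0) ^ CARD('n)"
      using x powser_times_n_limit_0[of x] by (intro tendsto_intros LIMSEQ_realpow_zero) auto
    also have "(\<lambda>k. (real k * x ^ k + x ^ k) ^ CARD('n)) = (\<lambda>k. real (k + 1) ^ CARD('n) * s ^ k)"
    proof
      fix k
      have "real k * x ^ k + x ^ k = real (k + 1) * x ^ k" by (simp add: algebra_simps)
      moreover have "(x ^ k) ^ CARD('n) = s ^ k" using x(3) by (metis power_commuting_commutes power_mult mult.commute)
      ultimately show "(real k * x ^ k + x ^ k) ^ CARD('n) = real (k + 1) ^ CARD('n) * s ^ k"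
        by (simp only: power_mult_distrib)
    qed
    finally show "(\<lambda>k. real (k + 1) ^ CARD('n) * s ^ k) \<longlonglongrightarrow> 0" by (simp add: power_0_left)
  qed
  then have "\<forall>\<^sub>F k in sequentially. a * (real (k + 1) ^ CARD('n) * s ^ k) < \<epsilon>"
    using \<epsilon> by (intro order_tendstoD(2)) auto
  then obtain k0 where k0: "\<And>k. k \<ge> k0 \<Longrightarrow> a * (real (k + 1) ^ CARD('n) * s ^ k) < \<epsilon>"
    by (auto simp: eventually_sequentially)
  define N where "N = max N0 k0"
  define k :: nat where "k = 2 ^ N"
  have "N < k" unfolding k_def by (rule less_exp)
  then have k: "k0 \<le> k" "k > 0" by (auto simp: N_def)
  obtain F where F: "homogeneous k F" "\<And>z. norm (F z) \<le> real (k + 1) ^ CARD('n) * norm z ^ k"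
    "(LINT z|sphere_measure. norm (F z) powr p) \<ge> c"
    "\<And>r. 0 \<le> r \<Longrightarrow> r < 1 \<Longrightarrow> hardy_mean q (volterra g F) r \<le> \<epsilon> / a powr q"
    using N0[of N] unfolding k_def N_def by force
  have Fh: "F \<in> holo_ball" using F(1) by (simp add: homogeneous_def)
  define D where "D = (\<lambda>z. of_real a * F z)"
  have D: "D \<in> holo_ball" unfolding D_def by (intro holo_ball_mult holo_ball_const Fh)
  have normD: "norm (D z) \<le> a * (real (k + 1) ^ CARD('n) * norm z ^ k)" for z
    using F(2)[of z] a by (simp add: D_def norm_mult)
  have D_bd: "norm (D z) \<le> a * real (k + 1) ^ CARD('n)" if "norm z < 1" for z
  proof -
    have "a * (real (k + 1) ^ CARD('n) * norm z ^ k) \<le> a * (real (k + 1) ^ CARD('n) * 1)"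
      using that a by (intro mult_left_mono power_le_one) auto
    then show ?thesis using normD[of z] by simp
  qed
  have D_small: "norm (D z) \<le> \<epsilon>" if "norm z \<le> s" for z
  proof -
    have "a * (real (k + 1) ^ CARD('n) * norm z ^ k) \<le> a * (real (k + 1) ^ CARD('n) * s ^ k)"
      using that a by (intro mult_left_mono power_mono) auto
    then show ?thesis using normD[of z] k0[OF k(1)] by simp
  qed
  have TD: "hardy_mean q (volterra g D) r \<le> \<epsilon>" if r: "r \<in> {0..<1}" for r
  proof -
    have "hardy_mean q (volterra g D) r = hardy_mean q (\<lambda>z. of_real a * volterra g F z) r"
      using r by (intro hardy_mean_cong) (auto simp: D_def volterra_cmult gh Fh)
    also have "\<dots> = a powr q * hardy_mean q (volterra g F) r" using a by (simp add: hardy_mean_cmult)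
    also have "\<dots> \<le> a powr q * (\<epsilon> / a powr q)" using r by (intro mult_left_mono F(4)) auto
    finally show ?thesis using a by simp
  qed
  \<comment> \<open>The first entry exceeds \<open>s\<close>; the second makes \<open>s' ^ k\<close>
    at least \<open>1 / 2\<close>.\<close>
  define s' where "s' = max ((1 + s) / 2) (root k (1 / 2))"
  have "s < s'" using s by (simp add: s'_def less_max_iff_disj)
  moreover have "s' < 1" using s k real_root_lt_1_iff[of k "1 / 2"] by (auto simp: s'_def)
  ultimately have s': "s < s'" "s' < 1" "0 \<le> s'" using s by auto
  have "root k (1 / 2) ^ k \<le> s' ^ k" using k by (intro power_mono) (auto simp: s'_def)
  then have sk: "1 / 2 \<le> s' ^ k" using k by simp
  have "hardy_mean p D s' \<ge> 2 powr p * (\<bar>M\<bar> + B powr p + 1)"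
  proof -
    have "hardy_mean p D s' = (LINT z|sphere_measure. (a * s' ^ k) powr p * norm (F z) powr p)"
      unfolding hardy_mean_def
    proof (rule Bochner_Integration.integral_cong[OF refl])
      fix z :: "complex ^ 'n"
      have "norm (D (of_real s' *s z)) = (a * s' ^ k) * norm (F z)"
        using F(1) a s' by (simp add: D_def homogeneous_def norm_mult norm_power)
      then show "norm (D (of_real s' *s z)) powr p = (a * s' ^ k) powr p * norm (F z) powr p"
        by (simp add: powr_mult)
    qed
    also have "\<dots> = (a * s' ^ k) powr p * (LINT z|sphere_measure. norm (F z) powr p)" by simp
    also have "\<dots> \<ge> (a * (1 / 2)) powr p * c"
      using a sk p c F(3) by (intro mult_mono powr_mono2 mult_left_mono) auto
    also have "(a * (1 / 2)) powr p * c = a powr p * c / 2 powr p"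
      using a by (simp add: powr_divide)
    also have "\<dots> = 2 powr p * (\<bar>M\<bar> + B powr p + 1)"
    proof -
      have "(4::real) powr p = 2 powr p * 2 powr p" by (simp flip: powr_mult)
      then show ?thesis unfolding ap using c by simp
    qed
    finally show ?thesis .
  qed
  moreover have "hardy_mean p D s' \<le> 2 powr p * (hardy_mean p (\<lambda>z. S z + D z) s' + hardy_mean p S s')"
  proof -
    have "hardy_mean p D s' = hardy_mean p (\<lambda>z. (S z + D z) + - 1 * S z) s'" by simp
    also have "\<dots> \<le> 2 powr p * (hardy_mean p (\<lambda>z. S z + D z) s' + hardy_mean p (\<lambda>z. - 1 * S z) s')"
      using s' by (intro hardy_mean_add_le holo_ball_add holo_ball_mult holo_ball_const S D p) auto
    also have "hardy_mean p (\<lambda>z. - 1 * S z) s' = hardy_mean p S s'"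
      unfolding hardy_mean_cmult by simp
    finally show ?thesis .
  qed
  moreover have "hardy_mean p S s' \<le> B powr p"
    using s' by (intro hardy_mean_le_const S p) auto
  ultimately have "2 powr p * (\<bar>M\<bar> + B powr p + 1) \<le> 2 powr p * (hardy_mean p (\<lambda>z. S z + D z) s' + B powr p)"
    by (smt (verit) mult_left_mono powr_ge_zero)
  then have "\<bar>M\<bar> + B powr p + 1 \<le> hardy_mean p (\<lambda>z. S z + D z) s' + B powr p"
    by simp
  then have "M \<le> hardy_mean p (\<lambda>z. S z + D z) s'" by linarith
  then show ?thesis using D D_bd D_small TD s' by (intro exI[of _ D] exI[of _ s']) auto
qed

text \<open>The sum is written with the summable weights \<open>(1 / 2) ^ i\<close>, so that
  \<open>weighted_sum_powr_le\<close> applies for every \<open>q\<close>. The terms become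
  \<open>2 ^ i * T i\<close>, and the factor \<open>((1 / 2) ^ i) powr q\<close> in the hypothesis
  cancels the growth; the bound does not depend on \<open>n\<close>.\<close>

lemma hardy_mean_sum_le:
  fixes T :: "nat \<Rightarrow> complex ^ 'n \<Rightarrow> complex"
  assumes q: "q > 0" and r: "0 \<le> r" "r < 1"
    and T: "\<And>i. T i \<in> holo_ball" "\<And>i. hardy_mean q (T i) r \<le> (1 / 2) ^ i * ((1 / 2) ^ i) powr q"
    and U: "U \<in> holo_ball" "\<And>z. norm z < 1 \<Longrightarrow> U z = (\<Sum>i<n. T i z)"
  shows "hardy_mean q U r \<le> 2 powr q * 2"
proof -
  have geo: "(\<Sum>i<n. (1 / 2 :: real) ^ i) \<le> 2" for n
    using two_sided_geometric_sum_le[of "1 / 2" n 0] by (simp add: sum_gp_strict)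
  have r': "norm (complex_of_real r) < 1" using r by simp
  have "hardy_mean q U r \<le> (LINT z|sphere_measure. 2 powr q * (\<Sum>i<n. (2 ^ i) powr q * norm (T i (of_real r *s z)) powr q))"
    unfolding hardy_mean_def
  proof (rule integral_mono)
    show "integrable sphere_measure (\<lambda>z. norm (U (of_real r *s z)) powr q)"
      by (rule hardy_mean_integrable[OF U(1) q r'])
    show "integrable sphere_measure (\<lambda>z. 2 powr q * (\<Sum>i<n. (2 ^ i) powr q * norm (T i (of_real r *s z)) powr q))"
      by (intro integrable_mult_right Bochner_Integration.integrable_sum hardy_mean_integrable T(1) q r')
    fix z :: "complex ^ 'n" assume "z \<in> space sphere_measure"
    then have "norm (of_real r *s z) < 1" using r by simp
    then have "norm (U (of_real r *s z)) \<le> (\<Sum>i<n. norm (T i (of_real r *s z)))"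
      unfolding U(2)[OF \<open>norm (of_real r *s z) < 1\<close>] by (intro norm_sum)
    also have "\<dots> = (\<Sum>i<n. (1 / 2) ^ i * (2 ^ i * norm (T i (of_real r *s z))))"
      by (simp add: power_one_over)
    finally have "norm (U (of_real r *s z)) powr q \<le> (\<Sum>i<n. (1 / 2) ^ i * (2 ^ i * norm (T i (of_real r *s z)))) powr q"
      using q by (intro powr_mono2) auto
    also have "\<dots> \<le> (\<Sum>i<n. (1 / 2) ^ i) powr q * (\<Sum>i<n. (2 ^ i * norm (T i (of_real r *s z))) powr q)"
      using q by (intro weighted_sum_powr_le) auto
    also have "\<dots> \<le> 2 powr q * (\<Sum>i<n. (2 ^ i * norm (T i (of_real r *s z))) powr q)"
      using geo q by (intro mult_right_mono powr_mono2 sum_nonneg) auto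
    finally show "norm (U (of_real r *s z)) powr q \<le> 2 powr q * (\<Sum>i<n. (2 ^ i) powr q * norm (T i (of_real r *s z)) powr q)"
      by (simp add: powr_mult)
  qed
  also have "\<dots> = 2 powr q * (\<Sum>i<n. (2 ^ i) powr q * hardy_mean q (T i) r)"
    using hardy_mean_integrable[OF T(1) q r'] by (simp add: hardy_mean_def)
  also have "\<dots> \<le> 2 powr q * (\<Sum>i<n. (1 / 2) ^ i)"
  proof (intro mult_left_mono sum_mono)
    fix i :: nat
    have "(2 ^ i) powr q * hardy_mean q (T i) r \<le> (2 ^ i) powr q * ((1 / 2) ^ i * ((1 / 2) ^ i) powr q)"
      by (intro mult_left_mono T(2)) auto
    also have "\<dots> = (1 / 2) ^ i * (2 ^ i * (1 / 2) ^ i) powr q" by (simp add: powr_mult)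
    also have "\<dots> = (1 / 2) ^ i" by (simp flip: power_mult_distrib)
    finally show "(2 ^ i) powr q * hardy_mean q (T i) r \<le> (1 / 2) ^ i" .
  qed simp
  also have "\<dots> \<le> 2 powr q * 2" using geo by (intro mult_left_mono) auto
  finally show ?thesis .
qed

text \<open>The radii \<open>\<sigma> n\<close> are forced to 1, and each new term is small on the
  ball of radius \<open>\<sigma> n\<close>, so the large mean already reached at that radius is not
  destroyed by later terms.\<close>

lemma hump_sequence_exists:
  fixes g :: "complex ^ 'n \<Rightarrow> complex"
  assumes p: "p > 0" and q: "q > 0" and g: "g \<in> hardy_space q"
    and op: "\<And>f. f \<in> hardy_space p \<Longrightarrow> volterra g f \<in> hardy_space q"
  shows "\<exists>S \<sigma>. S 0 = (\<lambda>_. 0) \<and> (\<forall>n. S n \<in> holo_ball \<and> S n \<in> hardy_space p \<and> 0 \<le> \<sigma> n \<and> \<sigma> n < 1 \<and> \<sigma> n \<le> \<sigma> (Suc n) \<and>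
      1 - (1 / 2) ^ n \<le> \<sigma> (Suc n) \<and> real n \<le> hardy_mean p (S (Suc n)) (\<sigma> (Suc n)) \<and>
      (\<exists>D. D \<in> hardy_space p \<and> S (Suc n) = (\<lambda>z. S n z + D z) \<and>
        (\<forall>z. norm z \<le> \<sigma> n \<longrightarrow> norm (D z) \<le> (1 / 2) ^ n) \<and>
        (\<forall>r\<in>{0..<1}. hardy_mean q (volterra g D) r \<le> (1 / 2) ^ n * ((1 / 2) ^ n) powr q)))"
proof -
  \<comment> \<open>Boundedness of the partial sum is the invariant under which
    \<open>hump_exists\<close> can be applied again.\<close>
  define P where "P = (\<lambda>(n::nat) (x :: (complex ^ 'n \<Rightarrow> complex) \<times> real). fst x \<in> holo_ball \<and>
    (\<exists>B. \<forall>z. norm z < 1 \<longrightarrow> norm (fst x z) \<le> B) \<and> 0 \<le> snd x \<and> snd x < 1 \<and> (n = 0 \<longrightarrow> fst x = (\<lambda>_. 0)))"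
  define Q where "Q = (\<lambda>(n::nat) (x :: (complex ^ 'n \<Rightarrow> complex) \<times> real) (y :: (complex ^ 'n \<Rightarrow> complex) \<times> real).
      snd x \<le> snd y \<and> 1 - (1 / 2) ^ n \<le> snd y \<and> real n \<le> hardy_mean p (fst y) (snd y) \<and>
      (\<exists>D. D \<in> hardy_space p \<and> fst y = (\<lambda>z. fst x z + D z) \<and>
        (\<forall>z. norm z \<le> snd x \<longrightarrow> norm (D z) \<le> (1 / 2) ^ n) \<and>
        (\<forall>r\<in>{0..<1}. hardy_mean q (volterra g D) r \<le> (1 / 2) ^ n * ((1 / 2) ^ n) powr q)))"
  have "\<exists>f. \<forall>n. P n (f n) \<and> Q n (f n) (f (Suc n))"
  proof (rule dependent_nat_choice)
    show "\<exists>x. P 0 x" by (rule exI[of _ "(\<lambda>_. 0, 0)"]) (auto simp: P_def holo_ball_const)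
  next
    fix x n assume "P n x"
    then obtain B where x: "fst x \<in> holo_ball" "\<And>z. norm z < 1 \<Longrightarrow> norm (fst x z) \<le> B" "0 \<le> snd x" "snd x < 1"
      by (auto simp: P_def)
    \<comment> \<open>The new radius exceeds \<open>s\<close>, hence both the previous radius and
      \<open>1 - (1 / 2) ^ n\<close>.\<close>
    define s where "s = max (snd x) (1 - (1 / 2) ^ n)"
    have s: "0 \<le> s" "s < 1" "snd x \<le> s" "1 - (1 / 2) ^ n \<le> s" using x by (auto simp: s_def)
    \<comment> \<open>The second factor is the compensation expected by
      \<open>hardy_mean_sum_le\<close>. As it is at most 1, the same number serves as the pointwise
      bound for \<open>D\<close>.\<close>
    define \<epsilon> where "\<epsilon> = (1 / 2 :: real) ^ n * ((1 / 2) ^ n) powr q"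
    have \<epsilon>: "\<epsilon> > 0" by (simp add: \<epsilon>_def)
    have "((1 / 2 :: real) ^ n) powr q \<le> 1" using q by (intro powr_le1) (auto intro: power_le_one)
    then have \<epsilon>_le: "\<epsilon> \<le> (1 / 2) ^ n" unfolding \<epsilon>_def by (intro mult_left_le) auto
    obtain D s' B' where D: "D \<in> holo_ball" "\<And>z. norm z < 1 \<Longrightarrow> norm (D z) \<le> B'"
      "\<And>z. norm z \<le> s \<Longrightarrow> norm (D z) \<le> \<epsilon>"
      "\<And>r. r \<in> {0..<1} \<Longrightarrow> hardy_mean q (volterra g D) r \<le> \<epsilon>" "s < s'" "s' < 1"
      "real n \<le> hardy_mean p (\<lambda>z. fst x z + D z) s'"
      using hump_exists[OF p q g op x(1,2) s(1,2) \<epsilon>, of "real n"] by blast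
    have "P (Suc n) (\<lambda>z. fst x z + D z, s')"
      unfolding P_def
    proof (intro conjI exI[of _ "B + B'"] allI impI)
      show "fst (\<lambda>z. fst x z + D z, s') \<in> holo_ball" using x D by (simp add: holo_ball_add)
      show "norm (fst (\<lambda>z. fst x z + D z, s') z) \<le> B + B'" if "norm z < 1" for z
        using norm_triangle_ineq[of "fst x z" "D z"] x(2)[OF that] D(2)[OF that] by simp
    qed (use s D in auto)
    moreover have "Q n x (\<lambda>z. fst x z + D z, s')"
      unfolding Q_def
    proof (intro conjI exI[of _ D] allI impI ballI)
      show "D \<in> hardy_space p" by (rule bounded_imp_hardy_space[OF D(1) p D(2)])
      show "norm (D z) \<le> (1 / 2) ^ n" if "norm z \<le> snd x" for z
        using D(3)[of z] that s \<epsilon>_le by linarith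
    qed (use s D in \<open>auto simp: \<epsilon>_def\<close>)
    ultimately show "\<exists>y. P (Suc n) y \<and> Q n x y" by blast
  qed
  then obtain f where f: "\<And>n. P n (f n)" "\<And>n. Q n (f n) (f (Suc n))" by blast
  show ?thesis
  proof (intro exI[of _ "\<lambda>n. fst (f n)"] exI[of _ "\<lambda>n. snd (f n)"] conjI allI)
    show "fst (f 0) = (\<lambda>_. 0)" using f(1)[of 0] by (simp add: P_def)
    fix n
    show "fst (f n) \<in> holo_ball" "0 \<le> snd (f n)" "snd (f n) < 1" using f(1)[of n] by (auto simp: P_def)
    show "fst (f n) \<in> hardy_space p"
      using f(1)[of n] bounded_imp_hardy_space[OF _ p] unfolding P_def by blast
    show "snd (f n) \<le> snd (f (Suc n))" "1 - (1 / 2) ^ n \<le> snd (f (Suc n))"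
      "real n \<le> hardy_mean p (fst (f (Suc n))) (snd (f (Suc n)))"
      "\<exists>D. D \<in> hardy_space p \<and> fst (f (Suc n)) = (\<lambda>z. fst (f n) z + D z) \<and>
        (\<forall>z. norm z \<le> snd (f n) \<longrightarrow> norm (D z) \<le> (1 / 2) ^ n) \<and>
        (\<forall>r\<in>{0..<1}. hardy_mean q (volterra g D) r \<le> (1 / 2) ^ n * ((1 / 2) ^ n) powr q)"
      using f(2)[of n] unfolding Q_def by blast+
  qed
qed

section \<open>The limit of the humps and the proper inclusion\<close>

lemma volterra_one:
  assumes g: "g \<in> holo_ball" and z: "norm z < 1"
  shows "volterra g (\<lambda>_. 1) z = g z - g 0"
proof -
  obtain R where R: "R > 1" "(\<lambda>w. g (w *s z)) holomorphic_on ball 0 R"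
    using slice_holomorphic_gt_1[OF g z] by blast
  have "((\<lambda>t::real. deriv (\<lambda>w. g (w *s z)) (of_real t)) has_integral (g (of_real 1 *s z) - g (of_real 0 *s z))) {0..1}"
  proof (rule fundamental_theorem_of_calculus)
    fix t :: real assume "t \<in> {0..1}"
    then have "((\<lambda>w. g (w *s z)) has_field_derivative deriv (\<lambda>w. g (w *s z)) (of_real t)) (at (of_real t))"
      using R by (intro holomorphic_derivI[of _ "ball 0 R"]) auto
    from has_vector_derivative_real_field[OF this]
    show "((\<lambda>t. g (of_real t *s z)) has_vector_derivative deriv (\<lambda>w. g (w *s z)) (of_real t)) (at t within {0..1})" .
  qed simp
  then show ?thesis using volterra_eq[OF g z, of "\<lambda>_. 1"] by (simp add: integral_unique)
qed

theorem corollary9: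
  fixes g :: "complex ^ 'n \<Rightarrow> complex" and p q :: real
  assumes "0 < p" and "0 < q"
    and "g \<in> holo_ball"
    and "bounded_hardy_operator p q (volterra g)"
  shows "hardy_space p \<subset> optimal_domain g q"
proof -
  note p = assms(1) and q = assms(2) and gh = assms(3)
  have op: "volterra g f \<in> hardy_space q" if "f \<in> hardy_space p" for f
    using assms(4) that by (auto simp: bounded_hardy_operator_def)
  have sub: "hardy_space p \<subseteq> optimal_domain g q"
    using op by (auto simp: optimal_domain_def hardy_space_def)
  have "(\<lambda>_. 1) \<in> hardy_space p"
    by (rule bounded_imp_hardy_space[OF holo_ball_const p, of _ 1]) simp
  from op[OF this] obtain B where T1: "volterra g (\<lambda>_. 1) \<in> holo_ball"
      "\<And>s. s \<in> {0..<1} \<Longrightarrow> hardy_mean q (volterra g (\<lambda>_. 1)) s \<le> B"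
    unfolding hardy_space_iff[OF q] by blast
  have g: "g \<in> hardy_space q"
    unfolding hardy_space_iff[OF q]
  proof (intro conjI gh exI ballI)
    fix s :: real assume s: "s \<in> {0..<1}"
    have "hardy_mean q g s = hardy_mean q (\<lambda>z. volterra g (\<lambda>_. 1) z + g 0) s"
      using s by (intro hardy_mean_cong) (auto simp: volterra_one[OF gh])
    also have "\<dots> \<le> 2 powr q * (hardy_mean q (volterra g (\<lambda>_. 1)) s + hardy_mean q (\<lambda>_ :: complex ^ 'n. g 0) s)"
      using s by (intro hardy_mean_add_le T1 holo_ball_const q) auto
    also have "\<dots> \<le> 2 powr q * (B + norm (g 0) powr q)"
      using T1(2)[OF s] by (intro mult_left_mono add_mono) (auto simp: hardy_mean_def)
    finally show "hardy_mean q g s \<le> 2 powr q * (B + norm (g 0) powr q)" .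
  qed
  obtain S \<sigma> where S0: "S 0 = (\<lambda>_. 0)" and SS: "\<forall>n. S n \<in> holo_ball \<and> S n \<in> hardy_space p \<and> 0 \<le> \<sigma> n \<and> \<sigma> n < 1 \<and> \<sigma> n \<le> \<sigma> (Suc n) \<and>
      1 - (1 / 2) ^ n \<le> \<sigma> (Suc n) \<and> real n \<le> hardy_mean p (S (Suc n)) (\<sigma> (Suc n)) \<and>
      (\<exists>D. D \<in> hardy_space p \<and> S (Suc n) = (\<lambda>z. S n z + D z) \<and>
        (\<forall>z. norm z \<le> \<sigma> n \<longrightarrow> norm (D z) \<le> (1 / 2) ^ n) \<and>
        (\<forall>r\<in>{0..<1}. hardy_mean q (volterra g D) r \<le> (1 / 2) ^ n * ((1 / 2) ^ n) powr q))"
    using hump_sequence_exists[OF p q g op] by blast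
  have Sh: "S n \<in> holo_ball" "S n \<in> hardy_space p" and \<sigma>: "0 \<le> \<sigma> n" "\<sigma> n < 1" "\<sigma> n \<le> \<sigma> (Suc n)"
    "1 - (1 / 2) ^ n \<le> \<sigma> (Suc n)" and large: "real n \<le> hardy_mean p (S (Suc n)) (\<sigma> (Suc n))" for n
    using spec[OF SS, of n] by blast+
  have "\<forall>n. \<exists>D. D \<in> hardy_space p \<and> S (Suc n) = (\<lambda>z. S n z + D z) \<and>
        (\<forall>z. norm z \<le> \<sigma> n \<longrightarrow> norm (D z) \<le> (1 / 2) ^ n) \<and>
        (\<forall>r\<in>{0..<1}. hardy_mean q (volterra g D) r \<le> (1 / 2) ^ n * ((1 / 2) ^ n) powr q)"
    using SS by blast
  from choice[OF this] obtain D where DD: "\<forall>n. D n \<in> hardy_space p \<and> S (Suc n) = (\<lambda>z. S n z + D n z) \<and>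
        (\<forall>z. norm z \<le> \<sigma> n \<longrightarrow> norm (D n z) \<le> (1 / 2) ^ n) \<and>
        (\<forall>r\<in>{0..<1}. hardy_mean q (volterra g (D n)) r \<le> (1 / 2) ^ n * ((1 / 2) ^ n) powr q)"
    by (rule exE)
  have S_Suc: "S (Suc n) = (\<lambda>z. S n z + D n z)" for n
    using spec[OF DD, of n] by (elim conjE)
  have D1: "D n \<in> hardy_space p" for n
    using spec[OF DD, of n] by (elim conjE)
  have D3: "norm z \<le> \<sigma> n \<Longrightarrow> norm (D n z) \<le> (1 / 2) ^ n" for n z
    using spec[OF DD, of n] by (elim conjE allE impE)
  have D4: "r \<in> {0..<1} \<Longrightarrow> hardy_mean q (volterra g (D n)) r \<le> (1 / 2) ^ n * ((1 / 2) ^ n) powr q" for n r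
    using spec[OF DD, of n] by (elim conjE) (rule bspec)
  have D2: "S (Suc n) z = S n z + D n z" for n z by (simp only: S_Suc)
  note D = D1 D2 D3 D4
  have D_holo: "D n \<in> holo_ball" for n using D(1)[of n] by (simp add: hardy_space_def)
  have \<sigma>_mono: "\<sigma> m \<le> \<sigma> n" if "m \<le> n" for m n
    using lift_Suc_mono_le[of \<sigma>, OF \<sigma>(3) that] .
  \<comment> \<open>The geometric sum in closed form lets the induction on \<open>j\<close> go
    through; as the radii increase, \<open>z\<close> stays in every ball on which
    \<open>D (n + j)\<close> is small.\<close>
  have diff: "norm (S (n + j) z - S n z) \<le> 2 * (1 / 2) ^ n - 2 * (1 / 2) ^ (n + j)" if z: "norm z \<le> \<sigma> n" for n j z
  proof (induction j)
    case (Suc j)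
    have "norm z \<le> \<sigma> (n + j)" using z \<sigma>_mono[of n "n + j"] by simp
    then have "norm (D (n + j) z) \<le> (1 / 2) ^ (n + j)" by (rule D(3))
    moreover have eq: "S (n + Suc j) z - S n z = (S (n + j) z - S n z) + D (n + j) z"
      using D(2)[of "n + j" z] by simp
    have "norm (S (n + Suc j) z - S n z) \<le> norm (S (n + j) z - S n z) + norm (D (n + j) z)"
      unfolding eq by (rule norm_triangle_ineq)
    ultimately show ?case using Suc by simp
  qed simp
  have close: "norm (S m z - S n z) \<le> 2 * (1 / 2) ^ n" if "norm z \<le> \<sigma> n" "n \<le> m" for m n z
  proof -
    have "(0::real) \<le> (1 / 2) ^ m" by simp
    moreover have "norm (S m z - S n z) \<le> 2 * (1 / 2) ^ n - 2 * (1 / 2) ^ m"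
      using diff[OF that(1), of "m - n"] that(2) by simp
    ultimately show ?thesis by linarith
  qed
  have \<sigma>_ge: "\<exists>N. \<forall>n\<ge>N. r \<le> \<sigma> n" if r: "r < 1" for r
  proof -
    obtain m where "(1 / 2) ^ m < 1 - r" using r real_arch_pow_inv[of "1 - r" "1 / 2"] by auto
    then have "r \<le> \<sigma> (Suc m)" using \<sigma>(4)[of m] by linarith
    then show ?thesis using \<sigma>_mono order.trans by blast
  qed
  define f where "f = (\<lambda>z. lim (\<lambda>n. S n z))"
  have half_lim: "(\<lambda>n. c * (1 / 2 :: real) ^ n) \<longlonglongrightarrow> 0" for c
    using tendsto_mult_right_zero[OF LIMSEQ_realpow_zero[of "1 / 2"], of c] by simp
  have f_lim: "(\<lambda>n. S n z) \<longlonglongrightarrow> f z" if z: "norm z < 1" for z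
  proof -
    have "Cauchy (\<lambda>n. S n z)"
    proof (rule CauchyI')
      fix e :: real assume e: "e > 0"
      obtain N where N: "\<And>n. n \<ge> N \<Longrightarrow> norm z \<le> \<sigma> n" using \<sigma>_ge[OF z] by blast
      have "\<forall>\<^sub>F n in sequentially. 2 * (1 / 2) ^ n < e"
        using half_lim[of 2] e by (intro order_tendstoD(2)) auto
      then obtain N' where N': "\<And>n. n \<ge> N' \<Longrightarrow> 2 * (1 / 2) ^ n < e" by (auto simp: eventually_sequentially)
      have "dist (S m z) (S n z) < e" if "m \<ge> max N N'" "n > m" for m n
        using close[OF N, of m n] N'[of m] that by (simp add: dist_norm norm_minus_commute)
      then show "\<exists>M. \<forall>m\<ge>M. \<forall>n>m. dist (S m z) (S n z) < e" by blast
    qed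
    then show ?thesis unfolding f_def by (simp add: Cauchy_convergent_iff convergent_LIMSEQ_iff)
  qed
  have f_close: "norm (f z - S n z) \<le> 2 * (1 / 2) ^ n" if z: "norm z \<le> \<sigma> n" for n z
  proof (rule tendsto_upperbound)
    show "(\<lambda>m. norm (S m z - S n z)) \<longlonglongrightarrow> norm (f z - S n z)"
      using z \<sigma>(2)[of n] by (intro tendsto_intros f_lim) simp
    show "\<forall>\<^sub>F m in sequentially. norm (S m z - S n z) \<le> 2 * (1 / 2) ^ n"
      using close[OF z] by (auto simp: eventually_sequentially)
  qed simp
  have lim_unif: "uniform_limit (cball 0 r) F h sequentially"
    if bd: "\<And>n z. norm z \<le> r \<Longrightarrow> r \<le> \<sigma> n \<Longrightarrow> norm (h z - F n z) \<le> c * (1 / 2) ^ n" and r: "r < 1"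
    for F :: "nat \<Rightarrow> complex ^ 'n \<Rightarrow> complex" and h r c
  proof (rule uniform_limitI)
    fix e :: real assume e: "e > 0"
    obtain N where N: "\<And>n. n \<ge> N \<Longrightarrow> r \<le> \<sigma> n" using \<sigma>_ge[OF r] by blast
    have "\<forall>\<^sub>F n in sequentially. c * (1 / 2) ^ n < e"
      using half_lim[of c] e by (intro order_tendstoD(2)) auto
    moreover have "\<forall>\<^sub>F n in sequentially. n \<ge> N" by (rule eventually_ge_at_top)
    ultimately show "\<forall>\<^sub>F n in sequentially. \<forall>z\<in>cball 0 r. dist (F n z) (h z) < e"
    proof eventually_elim
      case (elim n)
      show ?case
      proof
        fix z :: "complex ^ 'n" assume "z \<in> cball 0 r"
        then have "norm (h z - F n z) \<le> c * (1 / 2) ^ n" using N elim(2) by (intro bd) auto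
        then show "dist (F n z) (h z) < e" using elim(1) by (simp add: dist_norm norm_minus_commute)
      qed
    qed
  qed
  have fh: "f \<in> holo_ball"
  proof (rule holo_ball_limit[OF Sh(1)])
    show "uniform_limit (cball 0 r) S f sequentially" if "r < 1" for r
      by (rule lim_unif[OF _ that]) (rule f_close, linarith)
  qed
  have f_notin: "f \<notin> hardy_space p"
  proof
    assume "f \<in> hardy_space p"
    then obtain B where B: "\<And>s. s \<in> {0..<1} \<Longrightarrow> hardy_mean p f s \<le> B"
      unfolding hardy_space_iff[OF p] by blast
    \<comment> \<open>At radius \<open>\<sigma> (Suc n)\<close> the limit differs from
      \<open>S (Suc n)\<close> by at most 2 pointwise, so a bound on the means of \<open>f\<close>
      would bound \<open>n\<close>.\<close>
    have "real n \<le> 2 powr p * (B + 2 powr p)" for n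
    proof -
      let ?s = "\<sigma> (Suc n)" and ?h = "\<lambda>z. S (Suc n) z + - 1 * f z"
      have hh: "?h \<in> holo_ball" by (intro holo_ball_add holo_ball_mult holo_ball_const Sh fh)
      have "norm (?h z) \<le> 2" if "norm z \<le> ?s" for z
      proof -
        have "norm (f z - S (Suc n) z) \<le> 2 * (1 / 2) ^ Suc n" by (rule f_close[OF that])
        also have "\<dots> \<le> 2 * 1" by (intro mult_left_mono power_le_one) auto
        finally show ?thesis by (simp add: norm_minus_commute)
      qed
      then have h_le: "hardy_mean p ?h ?s \<le> 2 powr p"
        by (intro hardy_mean_le_const hh p \<sigma>)
      have "real n \<le> hardy_mean p (S (Suc n)) ?s" by (rule large)
      also have "hardy_mean p (S (Suc n)) ?s = hardy_mean p (\<lambda>z. f z + ?h z) ?s" by simp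
      also have "\<dots> \<le> 2 powr p * (hardy_mean p f ?s + hardy_mean p ?h ?s)"
        by (intro hardy_mean_add_le fh hh p \<sigma>)
      also have "\<dots> \<le> 2 powr p * (B + 2 powr p)"
        using B[of ?s] \<sigma>[of "Suc n"] h_le by (intro mult_left_mono add_mono) auto
      finally show ?thesis .
    qed
    then show False using reals_Archimedean2[of "2 powr p * (B + 2 powr p)"] by (meson not_le)
  qed
  have TS_holo: "volterra g (S n) \<in> holo_ball" for n
    using op[OF Sh(2)] by (simp add: hardy_space_def)
  have TD_holo: "volterra g (D n) \<in> holo_ball" for n
    using op[OF D(1)] by (simp add: hardy_space_def)
  have TS_sum: "volterra g (S n) z = (\<Sum>i<n. volterra g (D i) z)" if z: "norm z < 1" for n z
  proof (induction n)
    case 0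
    then show ?case by (simp add: S0 volterra_eq[OF gh z])
  next
    case (Suc n)
    show ?case using volterra_add[OF gh Sh(1) D_holo z] Suc by (simp add: S_Suc)
  qed
  \<comment> \<open>For \<open>norm z \<le> r \<le> \<sigma> n\<close> the whole segment from 0 to
    \<open>z\<close> lies where \<open>f\<close> and \<open>S n\<close> differ by at most
    \<open>2 * (1 / 2) ^ n\<close>, and Cauchy's estimate on a larger ball bounds the derivative of
    \<open>g\<close> along it.\<close>
  have T_close: "\<exists>c. \<forall>n z. norm z \<le> r \<longrightarrow> r \<le> \<sigma> n \<longrightarrow> norm (volterra g f z - volterra g (S n) z) \<le> c * (1 / 2) ^ n"
    if r: "0 \<le> r" "r < 1" for r
  proof -
    define r' where "r' = (1 + r) / 2"
    have r': "r < r'" "r' < 1" using r by (auto simp: r'_def)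
    obtain B where B: "B \<ge> 0" "\<And>z. norm z \<le> r' \<Longrightarrow> norm (g z) \<le> B" using holo_ball_bounded[OF gh r'(2)] by blast
    define C where "C = 2 * B / (r' - r)"
    have "norm (volterra g f z - volterra g (S n) z) \<le> 2 * C * (1 / 2) ^ n"
      if z: "norm z \<le> r" and n: "r \<le> \<sigma> n" for n z
    proof -
      have z1: "norm z < 1" using z r by simp
      let ?d = "\<lambda>t::real. deriv (\<lambda>w. g (w *s z)) (of_real t)"
      have i: "(\<lambda>t::real. f (of_real t *s z) * ?d t) integrable_on {0..1}" "(\<lambda>t::real. S n (of_real t *s z) * ?d t) integrable_on {0..1}"
        by (intro volterra_integrable gh fh Sh z1)+
      have "volterra g f z - volterra g (S n) z = integral {0..1} (\<lambda>t. (f (of_real t *s z) - S n (of_real t *s z)) * ?d t)"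
        using i by (simp add: volterra_eq[OF gh z1] left_diff_distrib Henstock_Kurzweil_Integration.integral_diff)
      also have "norm \<dots> \<le> integral {0..1} (\<lambda>t::real. 2 * (1 / 2) ^ n * C)"
      proof (rule integral_norm_bound_integral)
        show "(\<lambda>t. (f (of_real t *s z) - S n (of_real t *s z)) * ?d t) integrable_on {0..1}"
          using Henstock_Kurzweil_Integration.integrable_diff[OF i] by (simp add: left_diff_distrib)
        fix t :: real assume t: "t \<in> {0..1}"
        have "norm (of_real t *s z) \<le> \<sigma> n"
          using t z n mult_left_le_one_le[of "norm z" t] by simp
        then have "norm (f (of_real t *s z) - S n (of_real t *s z)) \<le> 2 * (1 / 2) ^ n" by (rule f_close)
        moreover have "norm (?d t) \<le> C"
          unfolding C_def using t B(2) by (intro deriv_slice_bound[OF gh z r(1) r']) auto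
        ultimately show "norm ((f (of_real t *s z) - S n (of_real t *s z)) * ?d t) \<le> 2 * (1 / 2) ^ n * C"
          unfolding norm_mult by (intro mult_mono) auto
      qed auto
      finally show ?thesis by (simp add: mult_ac)
    qed
    then show ?thesis by blast
  qed
  \<comment> \<open>The hypothesis on the operator covers only \<open>hardy_space p\<close>, which
    does not contain \<open>f\<close>; holomorphy is obtained from the locally uniform convergence
    of the images of \<open>S n\<close>.\<close>
  have Tf_holo: "volterra g f \<in> holo_ball"
  proof (rule holo_ball_limit[OF TS_holo])
    fix r :: real assume r: "r < 1"
    \<comment> \<open>\<open>holo_ball_limit\<close> asks for every \<open>r < 1\<close>, negative
      ones included, while \<open>T_close\<close> needs \<open>0 \<le> r\<close>.\<close>
    obtain c where c: "\<forall>n z. norm z \<le> max r 0 \<longrightarrow> max r 0 \<le> \<sigma> n \<longrightarrow> norm (volterra g f z - volterra g (S n) z) \<le> c * (1 / 2) ^ n"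
      using T_close[of "max r 0"] r by auto
    have "uniform_limit (cball 0 (max r 0)) (\<lambda>n. volterra g (S n)) (volterra g f) sequentially"
    proof (rule lim_unif)
      show "norm (volterra g f z - volterra g (S n) z) \<le> c * (1 / 2) ^ n"
        if "norm z \<le> max r 0" "max r 0 \<le> \<sigma> n" for n z
        using c that by blast
    qed (use r in simp)
    then show "uniform_limit (cball 0 r) (\<lambda>n. volterra g (S n)) (volterra g f) sequentially"
      by (rule uniform_limit_on_subset) auto
  qed
  \<comment> \<open>The index \<open>n\<close> chosen below depends on \<open>r\<close>, the bound
    does not: \<open>hardy_mean_sum_le\<close> bounds the image of \<open>S n\<close> uniformly in
    \<open>n\<close>, and the remainder is at most 1 pointwise on the ball of radius
    \<open>r\<close>.\<close>
  have "hardy_mean q (volterra g f) r \<le> 2 powr q * (2 powr q * 2 + 1)" if r: "r \<in> {0..<1}" for r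
  proof -
    obtain c where c: "\<forall>n z. norm z \<le> r \<longrightarrow> r \<le> \<sigma> n \<longrightarrow> norm (volterra g f z - volterra g (S n) z) \<le> c * (1 / 2) ^ n"
      using T_close[of r] r by auto
    obtain N where N: "\<And>n. n \<ge> N \<Longrightarrow> r \<le> \<sigma> n" using \<sigma>_ge[of r] r by auto
    have "\<forall>\<^sub>F n in sequentially. c * (1 / 2) ^ n < 1"
      using half_lim[of c] by (intro order_tendstoD(2)) auto
    then obtain N' where N': "\<And>n. n \<ge> N' \<Longrightarrow> c * (1 / 2) ^ n < 1" by (auto simp: eventually_sequentially)
    define n where "n = max N N'"
    have n: "r \<le> \<sigma> n" "c * (1 / 2) ^ n < 1" using N N' by (auto simp: n_def)
    let ?h = "\<lambda>z. volterra g f z + - 1 * volterra g (S n) z"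
    have hh: "?h \<in> holo_ball" by (intro holo_ball_add holo_ball_mult holo_ball_const TS_holo Tf_holo)
    have "hardy_mean q (volterra g f) r = hardy_mean q (\<lambda>z. volterra g (S n) z + ?h z) r" by simp
    also have "\<dots> \<le> 2 powr q * (hardy_mean q (volterra g (S n)) r + hardy_mean q ?h r)"
      using r by (intro hardy_mean_add_le TS_holo hh q) auto
    also have "\<dots> \<le> 2 powr q * (2 powr q * 2 + 1)"
    proof (intro mult_left_mono add_mono)
      show "hardy_mean q (volterra g (S n)) r \<le> 2 powr q * 2"
        using r D(4) by (intro hardy_mean_sum_le[OF q, of r "\<lambda>i. volterra g (D i)" _ n] TD_holo TS_holo TS_sum) auto
      have "norm (?h z) \<le> 1" if "norm z \<le> r" for z
        using c that n by fastforce
      then have "hardy_mean q ?h r \<le> 1 powr q"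
        using r by (intro hardy_mean_le_const hh q) auto
      then show "hardy_mean q ?h r \<le> 1" by simp
    qed simp
    finally show ?thesis .
  qed
  then have "volterra g f \<in> hardy_space q"
    unfolding hardy_space_iff[OF q] using Tf_holo by blast
  then have "f \<in> optimal_domain g q" using fh by (simp add: optimal_domain_def)
  then show ?thesis using sub f_notin by blast
qed

end
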